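(* Let $k$ be a field of characteristic zero, let $1\le p\le m$, and let $\omega$ be a closed $p$-form with coefficients in $K = k(x_1,\ldots,x_m)$. Then $\omega$ can be written in the form \[ \omega = d_p(\Psi^p) + \cdots + d_m(\Psi^m) = d(\Psi^p + \cdots + \Psi^m), \] where, for each $i = p,\ldots,m$, $\Psi^i$ is a $(p-1)$-form that is free of $dx_i,\ldots,dx_m$ and the coefficients $f_{i,\ell}$ of $\Psi^i$ are of the form (finite sums) \[ f_{i,\ell} = b_{i,\ell,0} + \sum_{j>0} c_{i,\ell,j}\,\log b_{i,\ell,j} \] with \begin{align*} b_{i,\ell,0} &\in k(x_1,\ldots,x_i),\\ c_{i,\ell,j} &\in \overline{k(x_1,\ldots,x_{i-1})},\\ b_{i,\ell,j} &\in k(x_1,\ldots,x_{i-1})(c_{i,\ell,j})[x_i],\quad j>0. \end{align*}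
   Context: Write $\partial_i=\partial/\partial x_i$ for the usual commuting partial derivatives on $K$ (zero on $k$). Let $\mathcal{U}$ be a universal differential extension field of $(K,\partial_1,\dots,\partial_m)$ (in Kolchin's sense): the $\partial_i$ extend to commuting derivations of $\mathcal{U}$, and any system of algebraic differential equations having a solution in some differential extension of $K$ has a solution in $\mathcal{U}$. Algebraic closures (denoted by a bar) are taken inside $\mathcal{U}$. Let $\mathcal{M}$ be the $\mathcal{U}$-vector space with basis $dx_1,\dots,dx_m$; a $p$-form is an element of $\bigwedge^p\mathcal{M}$, written uniquely as $\sum_{i_1<\cdots<i_p} f_{i_1,\dots,i_p}\,dx_{i_1}\wedge\cdots\wedge dx_{i_p}$, and the $f_{i_1,\dots,i_p}\in\mathcal{U}$ are its coefficients. A form is free of $dx_i$ if no term with nonzero coefficient in this expression involves $dx_i$. For $s=1,\dots,m$ define the additive operator $d^s$ on $\bigwedge\mathcal{M}$ by $d^s(f\,dx_I)=\partial_s(f)\,dx_s\wedge dx_I$, and set $d_s=d^1+\cdots+d^s$; the exterior derivative is $d=d_m$. A form $\omega$ is closed if $d\omega=0$. For $b\neq0$, $\log b$ denotes an element of $\mathcal{U}$ with $\partial_i(\log b)=\partial_i(b)/b$ for all $i=1,\dots,m$. *)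

theory Defs
  imports
    "HOL-Algebra.Algebraic_Closure_Type"
    "HOL-Algebra.Finite_Extensions"
    "HOL-Algebra.Generated_Fields"
begin

section \<open>Differential fields and universal extensions\<close>

definition derivation_on :: "('a, 'b) ring_scheme \<Rightarrow> ('a \<Rightarrow> 'a) \<Rightarrow> bool" where
  "derivation_on R D \<longleftrightarrow> D \<in> carrier R \<rightarrow> carrier R \<and>
     (\<forall>a\<in>carrier R. \<forall>b\<in>carrier R.
        D (a \<oplus>\<^bsub>R\<^esub> b) = D a \<oplus>\<^bsub>R\<^esub> D b \<and>
        D (a \<otimes>\<^bsub>R\<^esub> b) = (D a \<otimes>\<^bsub>R\<^esub> b) \<oplus>\<^bsub>R\<^esub> (a \<otimes>\<^bsub>R\<^esub> D b))"

definition differential_field :: "nat \<Rightarrow> ('a, 'b) ring_scheme \<Rightarrow> (nat \<Rightarrow> 'a \<Rightarrow> 'a) \<Rightarrow> bool" where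
  "differential_field m R D \<longleftrightarrow> field R \<and>
     (\<forall>i\<in>{1..m}. derivation_on R (D i)) \<and>
     (\<forall>i\<in>{1..m}. \<forall>j\<in>{1..m}. \<forall>a\<in>carrier R. D i (D j a) = D j (D i a))"

text \<open>
  Differential polynomials are represented by expressions: every differential polynomial in the
  unknowns \<open>y\<^sub>0, \<dots>, y\<^sub>n\<^sub>-\<^sub>1\<close> is denoted by such an expression, and its value at a tuple in a
  differential field is the value of the expression.
\<close>

datatype 'a dpoly =
    Coeff 'a
  | Unknown nat
  | Plus "'a dpoly" "'a dpoly"
  | Times "'a dpoly" "'a dpoly"
  | Deriv nat "'a dpoly"

primrec dpoly_over :: "nat \<Rightarrow> 'a set \<Rightarrow> nat \<Rightarrow> 'a dpoly \<Rightarrow> bool" where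
  "dpoly_over m K n (Coeff a) \<longleftrightarrow> a \<in> K"
| "dpoly_over m K n (Unknown j) \<longleftrightarrow> j < n"
| "dpoly_over m K n (Plus e f) \<longleftrightarrow> dpoly_over m K n e \<and> dpoly_over m K n f"
| "dpoly_over m K n (Times e f) \<longleftrightarrow> dpoly_over m K n e \<and> dpoly_over m K n f"
| "dpoly_over m K n (Deriv i e) \<longleftrightarrow> i \<in> {1..m} \<and> dpoly_over m K n e"

text \<open>Value in \<open>(R, D)\<close> at the tuple \<open>y\<close>, the coefficients being mapped into \<open>R\<close> by \<open>\<phi>\<close>.\<close>

primrec dpoly_eval ::
    "('b, 'c) ring_scheme \<Rightarrow> (nat \<Rightarrow> 'b \<Rightarrow> 'b) \<Rightarrow> ('a \<Rightarrow> 'b) \<Rightarrow> (nat \<Rightarrow> 'b) \<Rightarrow> 'a dpoly \<Rightarrow> 'b" where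
  "dpoly_eval R D \<phi> y (Coeff a) = \<phi> a"
| "dpoly_eval R D \<phi> y (Unknown j) = y j"
| "dpoly_eval R D \<phi> y (Plus e f) = dpoly_eval R D \<phi> y e \<oplus>\<^bsub>R\<^esub> dpoly_eval R D \<phi> y f"
| "dpoly_eval R D \<phi> y (Times e f) = dpoly_eval R D \<phi> y e \<otimes>\<^bsub>R\<^esub> dpoly_eval R D \<phi> y f"
| "dpoly_eval R D \<phi> y (Deriv i e) = D i (dpoly_eval R D \<phi> y e)"

definition solvable_in ::
    "nat \<Rightarrow> ('b, 'c) ring_scheme \<Rightarrow> (nat \<Rightarrow> 'b \<Rightarrow> 'b) \<Rightarrow> ('a \<Rightarrow> 'b) \<Rightarrow> 'a dpoly set \<Rightarrow> bool" where
  "solvable_in n R D \<phi> S \<longleftrightarrow>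
     (\<exists>y. (\<forall>j<n. y j \<in> carrier R) \<and> (\<forall>e\<in>S. dpoly_eval R D \<phi> y e = \<zero>\<^bsub>R\<^esub>))"

definition differential_extension ::
    "nat \<Rightarrow> ('a, 'b) ring_scheme \<Rightarrow> (nat \<Rightarrow> 'a \<Rightarrow> 'a) \<Rightarrow>
     ('c, 'd) ring_scheme \<Rightarrow> (nat \<Rightarrow> 'c \<Rightarrow> 'c) \<Rightarrow> ('a \<Rightarrow> 'c) \<Rightarrow> bool" where
  "differential_extension m K \<delta> R D \<phi> \<longleftrightarrow>
     differential_field m R D \<and> \<phi> \<in> ring_hom K R \<and>
     (\<forall>i\<in>{1..m}. \<forall>a\<in>carrier K. \<phi> (\<delta> i a) = D i (\<phi> a))"

text \<open>
  The type \<open>'u\<close> with the derivations \<open>\<delta> 1, \<dots>, \<delta> m\<close> is universal over its differential subfield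
  \<open>K\<close>: every system of algebraic differential equations over \<open>K\<close> in finitely many unknowns that
  is solvable in some differential extension field of \<open>K\<close> is solvable in \<open>'u\<close>.  The extensions
  \<open>R\<close> range over the differential fields whose carrier is a subset of \<open>'u\<close> (with operations and
  derivations unrelated to those of the type).  Up to isomorphism this is no restriction: the
  extension generated over the infinite field \<open>K\<close> by a solution has the cardinality of \<open>K\<close>.
  Universality over all finitely generated differential extensions of \<open>K\<close> inside \<open>'u\<close>
  implies this property.
\<close>

definition universal_over :: "nat \<Rightarrow> 'u::field_char_0 set \<Rightarrow> (nat \<Rightarrow> 'u \<Rightarrow> 'u) \<Rightarrow> bool" where
  "universal_over m K \<delta> \<longleftrightarrow>
     (\<forall>n (S :: 'u dpoly set) (R :: 'u ring) D \<phi>.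
        S \<subseteq> Collect (dpoly_over m K n) \<and>
        differential_extension m (ring_of_type_algebra\<lparr>carrier := K\<rparr>) \<delta> R D \<phi> \<and>
        solvable_in n R D \<phi> S
        \<longrightarrow> solvable_in n (ring_of_type_algebra :: 'u ring) \<delta> id S)"


section \<open>Rational functions\<close>

text \<open>
  \<open>x\<^sub>1, \<dots>, x\<^sub>m\<close> are algebraically independent over \<open>k\<close>: a polynomial \<open>\<Sum>\<^sub>e\<^sub>\<in>\<^sub>E c\<^sub>e x\<^sup>e\<close> with coefficients
  in \<open>k\<close> that vanishes at \<open>x\<close> has only zero coefficients.
\<close>

definition algebraically_independent :: "'u::field set \<Rightarrow> nat \<Rightarrow> (nat \<Rightarrow> 'u) \<Rightarrow> bool" where
  "algebraically_independent k m x \<longleftrightarrow>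
     (\<forall>(E :: (nat \<Rightarrow> nat) set) c.
        finite E \<and> (\<forall>e\<in>E. \<forall>i. i \<notin> {1..m} \<longrightarrow> e i = 0) \<and> (\<forall>e\<in>E. c e \<in> k) \<and>
        (\<Sum>e\<in>E. c e * (\<Prod>i=1..m. x i ^ e i)) = 0
        \<longrightarrow> (\<forall>e\<in>E. c e = 0))"

text \<open>The subfield \<open>F(A)\<close> of \<open>'u\<close>.\<close>

definition adjoin :: "'u::field_char_0 set \<Rightarrow> 'u set \<Rightarrow> 'u set" where
  "adjoin F A = generate_field ring_of_type_algebra (F \<union> A)"

definition ratfun :: "'u::field_char_0 set \<Rightarrow> (nat \<Rightarrow> 'u) \<Rightarrow> nat \<Rightarrow> 'u set" where
  "ratfun k x i = adjoin k (x ` {1..i})"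

definition alg_closure_in :: "'u::field_char_0 set \<Rightarrow> 'u set" where
  "alg_closure_in F = {c. ring.algebraic ring_of_type_algebra F c}"

text \<open>The subring \<open>F[t]\<close> of \<open>'u\<close>.\<close>

definition polys_in :: "'u::field_char_0 set \<Rightarrow> 'u \<Rightarrow> 'u set" where
  "polys_in F t = ring.simple_extension ring_of_type_algebra F t"


section \<open>Differential forms\<close>

text \<open>
  A form is represented by its coefficients in the basis
  \<open>dx\<^sub>I = dx\<^bsub>i\<^sub>1\<^esub> \<and> \<dots> \<and> dx\<^bsub>i\<^sub>p\<^esub>\<close>, where \<open>I = {i\<^sub>1 < \<dots> < i\<^sub>p} \<subseteq> {1..m}\<close>.
\<close>

type_synonym 'u form = "nat set \<Rightarrow> 'u"

definition is_form :: "nat \<Rightarrow> nat \<Rightarrow> 'u::field_char_0 form \<Rightarrow> bool" where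
  "is_form m p \<omega> \<longleftrightarrow> (\<forall>I. \<omega> I \<noteq> 0 \<longrightarrow> I \<subseteq> {1..m} \<and> card I = p)"

definition free_of :: "nat \<Rightarrow> 'u::field_char_0 form \<Rightarrow> bool" where
  "free_of s \<omega> \<longleftrightarrow> (\<forall>I. s \<in> I \<longrightarrow> \<omega> I = 0)"

text \<open>
  The form \<open>dx\<^sub>s \<and> \<omega>\<close>: one has \<open>dx\<^sub>s \<and> dx\<^sub>I = 0\<close> for \<open>s \<in> I\<close>, and otherwise
  \<open>dx\<^sub>s \<and> dx\<^sub>I = (-1)\<^sup>r dx\<^sub>J\<close>, where \<open>J = I \<union> {s}\<close> and \<open>r\<close> is the number of elements of \<open>J\<close> below \<open>s\<close>.
\<close>

definition dx_wedge :: "nat \<Rightarrow> 'u::field_char_0 form \<Rightarrow> 'u form" where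
  "dx_wedge s \<omega> = (\<lambda>J. if s \<in> J then (-1) ^ card {i \<in> J. i < s} * \<omega> (J - {s}) else 0)"

text \<open>\<open>d\<^sup>s\<close>, \<open>d\<^sub>s = d\<^sup>1 + \<dots> + d\<^sup>s\<close>, and the exterior derivative, for the derivations \<open>\<delta> 1, \<dots>, \<delta> m\<close>.\<close>

definition d_partial :: "(nat \<Rightarrow> 'u \<Rightarrow> 'u) \<Rightarrow> nat \<Rightarrow> 'u::field_char_0 form \<Rightarrow> 'u form" where
  "d_partial \<delta> s \<omega> = dx_wedge s (\<lambda>I. \<delta> s (\<omega> I))"

definition d_upto :: "(nat \<Rightarrow> 'u \<Rightarrow> 'u) \<Rightarrow> nat \<Rightarrow> 'u::field_char_0 form \<Rightarrow> 'u form" where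
  "d_upto \<delta> s \<omega> = (\<lambda>J. \<Sum>r=1..s. d_partial \<delta> r \<omega> J)"

abbreviation ext_d :: "nat \<Rightarrow> (nat \<Rightarrow> 'u \<Rightarrow> 'u) \<Rightarrow> 'u::field_char_0 form \<Rightarrow> 'u form" where
  "ext_d m \<delta> \<equiv> d_upto \<delta> m"

definition closed_form :: "nat \<Rightarrow> (nat \<Rightarrow> 'u \<Rightarrow> 'u) \<Rightarrow> 'u::field_char_0 form \<Rightarrow> bool" where
  "closed_form m \<delta> \<omega> \<longleftrightarrow> ext_d m \<delta> \<omega> = (\<lambda>J. 0)"

text \<open>
  The three rules of calculation in the exterior algebra that determine \<open>dx\<^sub>s \<and> dx\<^sub>I\<close>.
\<close>

lemma dx_wedge_least:
  assumes "\<forall>i\<in>I. s < i"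
  shows "dx_wedge s (\<lambda>I'. if I' = I then f else 0) = (\<lambda>J. if J = insert s I then f else 0)"
proof
  fix J
  have "s \<notin> I" using assms by auto
  moreover have "{i \<in> insert s I. i < s} = {}" using assms by auto
  moreover have "J - {s} = I \<and> s \<in> J \<longleftrightarrow> J = insert s I" using \<open>s \<notin> I\<close> by auto
  ultimately show "dx_wedge s (\<lambda>I'. if I' = I then f else 0) J = (if J = insert s I then f else 0)"
    unfolding dx_wedge_def by (auto simp del: Collect_empty_eq)
qed

lemma dx_wedge_same: "dx_wedge s (dx_wedge s \<omega>) = (\<lambda>J. 0)"
  by (auto simp: dx_wedge_def)

lemma dx_wedge_anticommute:
  assumes "s \<noteq> t" "finite J"
  shows "dx_wedge s (dx_wedge t \<omega>) J = - dx_wedge t (dx_wedge s \<omega>) J"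
proof -
  have *: "dx_wedge s (dx_wedge t \<omega>) J = - dx_wedge t (dx_wedge s \<omega>) J" if "s < t" for s t
  proof (cases "s \<in> J \<and> t \<in> J")
    case True
    have "{i \<in> J - {t}. i < s} = {i \<in> J. i < s}" using that by auto
    moreover have "{i \<in> J. i < t} = insert s {i \<in> J - {s}. i < t}" using that True by auto
    then have "card {i \<in> J. i < t} = Suc (card {i \<in> J - {s}. i < t})"
      using \<open>finite J\<close> by simp
    moreover have "J - {s} - {t} = J - {t} - {s}" by auto
    ultimately show ?thesis using True that by (simp add: dx_wedge_def)
  qed (auto simp: dx_wedge_def)
  show ?thesis using *[of s t] *[of t s] assms(1) by (cases s t rule: linorder_cases) auto
qed


section \<open>The admissible coefficients\<close>

definition is_log :: "nat \<Rightarrow> (nat \<Rightarrow> 'u \<Rightarrow> 'u) \<Rightarrow> 'u::field_char_0 \<Rightarrow> 'u \<Rightarrow> bool" where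
  "is_log m \<delta> b l \<longleftrightarrow> b \<noteq> 0 \<and> (\<forall>i\<in>{1..m}. \<delta> i l = \<delta> i b / b)"

text \<open>\<open>f = b\<^sub>0 + \<Sum>\<^sub>j\<^sub>>\<^sub>0 c\<^sub>j log b\<^sub>j\<close>, where \<open>l j\<close> is the element denoted by \<open>log b\<^sub>j\<close>.\<close>

definition log_expression ::
    "nat \<Rightarrow> (nat \<Rightarrow> 'u \<Rightarrow> 'u) \<Rightarrow> 'u set \<Rightarrow> (nat \<Rightarrow> 'u) \<Rightarrow> nat \<Rightarrow> 'u::field_char_0 \<Rightarrow> bool" where
  "log_expression m \<delta> k x i f \<longleftrightarrow>
     (\<exists>N :: nat. \<exists>b c l.
        f = b 0 + (\<Sum>j=1..N. c j * l j) \<and>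
        b 0 \<in> ratfun k x i \<and>
        (\<forall>j\<in>{1..N}.
           c j \<in> alg_closure_in (ratfun k x (i - 1)) \<and>
           b j \<in> polys_in (adjoin (ratfun k x (i - 1)) {c j}) (x i) \<and>
           is_log m \<delta> (b j) (l j)))"

end

theory Submission
  imports Defs "HOL-Computational_Algebra.Polynomial" "HOL-Computational_Algebra.Fraction_Field"
begin

text \<open>
  The variables are eliminated one by one, beginning with the last. Let \<open>\<omega>\<close> be a closed form in
  \<open>dx\<^sub>1, \<dots>, dx\<^sub>n\<close> with coefficients in \<open>F(x\<^sub>n)\<close>, where \<open>F = k(x\<^sub>1, \<dots>, x\<^sub>n\<^sub>-\<^sub>1)\<close>, and write
  \<open>\<omega> = \<alpha> + dx\<^sub>n \<and> \<beta>\<close>. Integration of the coefficients of \<open>\<beta>\<close> with respect to \<open>x\<^sub>n\<close> gives a form \<open>\<Psi>\<close>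
  with \<open>\<partial>\<^sub>n \<Psi> = \<beta>\<close>, and \<open>\<omega> - d\<^sub>n \<Psi>\<close> is a closed form free of \<open>dx\<^sub>n\<close> whose coefficients do not depend on
  \<open>x\<^sub>n\<close>. The induction can go on if these coefficients lie in \<open>F\<close>. This is not evident, because the
  logarithms in \<open>\<Psi>\<close> could survive in its partial derivatives with respect to the other variables.

  The integration follows Hermite, Rothstein and Trager (\<open>hermite_reduction\<close>,
  \<open>simultaneous_integration\<close>). The coefficients of \<open>\<beta>\<close> are brought to a common denominator and reduced, so
  that up to derivatives of elements of \<open>F(x\<^sub>n)\<close> each is \<open>A(x\<^sub>n) / D(x\<^sub>n)\<close> with one squarefree \<open>D\<close>. One
  logarithm \<open>L a\<close> of \<open>x\<^sub>n - a\<close> is fixed for each root \<open>a\<close> of \<open>D\<close>, and the integral of \<open>A / D\<close> is the sum of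
  the \<open>c a L a\<close>, where \<open>c a = A(a) / D'(a)\<close> is the residue. The product of \<open>x\<^sub>n - a\<close> over the roots with
  the same residue \<open>c\<close> is the greatest common divisor of \<open>D\<close> and \<open>A - c D'\<close>, so it lies in \<open>F(c)[x\<^sub>n]\<close>, and
  the sum of the corresponding \<open>L a\<close> is one of its logarithms.

  As the same \<open>L a\<close> serve all coefficients of \<open>\<Psi>\<close>, a coefficient of \<open>\<omega> - d\<^sub>n \<Psi>\<close> is \<open>\<rho> - (\<Sum>a. E a L a)\<close>
  with \<open>\<rho> \<in> F(x\<^sub>n)\<close> and with \<open>E a\<close> independent of \<open>x\<^sub>n\<close>. That its derivative with respect to \<open>x\<^sub>n\<close> vanishes
  means \<open>\<partial>\<^sub>n \<rho> = (\<Sum>a. E a / (x\<^sub>n - a))\<close>. A derivative has no residues, so \<open>E a = 0\<close> for all \<open>a\<close>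
  (\<open>log_derivative_not_exact\<close>). The coefficient is thus an element of \<open>F(x\<^sub>n)\<close> that does not depend on
  \<open>x\<^sub>n\<close>, and it lies in \<open>F\<close> (\<open>rational_constant\<close>, \<open>eliminate_variable\<close>).

  The roots and their logarithms exist in the universal field because they exist in differential
  extensions that are not larger than it: residue fields of polynomials for the roots, a field of
  rational functions in one indeterminate for the logarithms. As the field is universal over
  \<open>k(x\<^sub>1, \<dots>, x\<^sub>m)\<close> only, each extension is used to solve the whole system again with one more
  root or logarithm (\<open>distinct_roots_exist\<close>, \<open>roots_and_logs_exist\<close>).

  The exterior derivative of \<open>\<Psi>\<^sup>i\<close> is \<open>d\<^sub>i \<Psi>\<^sup>i\<close>, since the coefficients of \<open>\<Psi>\<^sup>i\<close> do not depend on the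
  variables after \<open>x\<^sub>i\<close> (\<open>log_expression_independent\<close>).
\<close>

section \<open>Derivations of commutative rings\<close>

locale derivation =
  fixes d :: "'a::idom \<Rightarrow> 'a"
  assumes add [simp]: "d (a + b) = d a + d b"
    and mult: "d (a * b) = d a * b + a * d b"
begin

lemma zero [simp]: "d 0 = 0"
  by (metis add add_0_right add_cancel_right_right)

lemma one [simp]: "d 1 = 0"
  by (metis mult mult_1 mult_1_right add_cancel_right_right)

lemma uminus [simp]: "d (- a) = - d a"
proof -
  have "d (- a) + d a = 0" by (simp flip: add)
  then show ?thesis by (simp add: eq_neg_iff_add_eq_0)
qed

lemma diff [simp]: "d (a - b) = d a - d b"
  using add[of a "- b"] by simp

lemma of_nat [simp]: "d (of_nat n) = 0"
  by (induction n) auto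

lemma sum: "d (sum f A) = (\<Sum>x\<in>A. d (f x))"
  by (induction A rule: infinite_finite_induct) auto

lemma const_mult: "d c = 0 \<Longrightarrow> d (c * a) = c * d a"
  by (simp add: mult)

lemma sign_mult: "d ((-1) ^ n * a) = (-1) ^ n * d a"
  by (induction n) (auto simp: mult)

lemma map_poly_mult: "map_poly d (p * q) = map_poly d p * q + p * map_poly d q"
  by (rule poly_eqI)
     (simp add: coeff_map_poly coeff_mult sum mult sum.distrib)

lemma map_poly_add: "map_poly d (p + q) = map_poly d p + map_poly d q"
  by (rule poly_eqI) (simp add: coeff_map_poly)

lemma pderiv_map_poly: "pderiv (map_poly d p) = map_poly d (pderiv p)"
  by (rule poly_eqI) (simp add: coeff_map_poly coeff_pderiv const_mult del: of_nat_Suc)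

lemma poly_rule: "d (poly p x) = poly (map_poly d p) x + poly (pderiv p) x * d x"
  by (induction p) (simp_all add: map_poly_pCons mult pderiv_pCons algebra_simps)

lemma prod_log:
  assumes "finite A" "\<And>a. a \<in> A \<Longrightarrow> f a * l a = d (f a)"
  shows "d (prod f A) = prod f A * (\<Sum>a\<in>A. l a)"
  using assms by (induction A rule: finite_induct) (auto simp: mult algebra_simps)

end

lemma derivation_divide:
  fixes d :: "'a::field \<Rightarrow> 'a"
  assumes "derivation d" "b \<noteq> 0"
  shows "d (a / b) = (d a * b - a * d b) / b\<^sup>2"
proof -
  interpret derivation d by fact
  have "d a = d (a / b * b)" using assms by simp
  also have "\<dots> = d (a / b) * b + a / b * d b" by (rule mult)
  finally show ?thesis using assms(2) by (simp add: field_simps power2_eq_square)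
qed

lemma derivation_constants_divide:
  fixes d :: "'a::field \<Rightarrow> 'a"
  assumes "derivation d" "d a = 0" "d b = 0"
  shows "d (a / b) = 0"
  using assms derivation_divide[of d b a] derivation.zero[of d] by (cases "b = 0") auto

text \<open>
  The derivation of the polynomial ring that extends \<open>d\<close> and sends the indeterminate to \<open>w\<close>.
\<close>

definition twist :: "('a::idom \<Rightarrow> 'a) \<Rightarrow> 'a poly \<Rightarrow> 'a poly \<Rightarrow> 'a poly" where
  "twist d w p = map_poly d p + w * pderiv p"

context derivation begin

lemma derivation_twist: "derivation (twist d w)"
  by unfold_locales (simp_all add: twist_def map_poly_add map_poly_mult pderiv_add pderiv_mult algebra_simps)

lemma twist_const: "twist d w [:c:] = [:d c:]"
  by (simp add: twist_def map_poly_pCons)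

lemma twist_X: "twist d w [:0, 1:] = w"
  by (simp add: twist_def map_poly_pCons pderiv_pCons)

end

text \<open>
  The two twists extend commuting derivations, so their commutator is a derivation that kills the
  constants: it is determined by its value on the indeterminate.
\<close>

lemma twist_commutator:
  assumes "derivation d" "derivation e" "\<And>a. d (e a) = e (d a)"
  shows "twist d v (twist e w p) - twist e w (twist d v p) = (twist d v w - twist e w v) * pderiv p"
proof -
  interpret d: derivation d by fact
  interpret e: derivation e by fact
  have "map_poly d (map_poly e p) = map_poly e (map_poly d p)"
    by (rule poly_eqI) (simp add: coeff_map_poly assms(3))
  then show ?thesis
    by (simp add: twist_def d.map_poly_add e.map_poly_add d.map_poly_mult e.map_poly_mult
        pderiv_add pderiv_mult d.pderiv_map_poly e.pderiv_map_poly algebra_simps)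
qed

section \<open>Subfields and polynomials with coefficients in a subfield\<close>

locale subfield_set =
  fixes F :: "'a::field set"
  assumes zero [simp, intro]: "0 \<in> F" and one [simp, intro]: "1 \<in> F"
    and add [intro]: "a \<in> F \<Longrightarrow> b \<in> F \<Longrightarrow> a + b \<in> F"
    and uminus [intro]: "a \<in> F \<Longrightarrow> - a \<in> F"
    and mult [intro]: "a \<in> F \<Longrightarrow> b \<in> F \<Longrightarrow> a * b \<in> F"
    and inverse [intro]: "a \<in> F \<Longrightarrow> inverse a \<in> F"
begin

lemma diff [intro]: "a \<in> F \<Longrightarrow> b \<in> F \<Longrightarrow> a - b \<in> F"
  using add[of a "- b"] uminus[of b] by simp

lemma divide [intro]: "a \<in> F \<Longrightarrow> b \<in> F \<Longrightarrow> a / b \<in> F"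
  by (auto simp: divide_inverse)

lemma of_nat [simp, intro]: "of_nat n \<in> F"
  by (induction n) auto

lemma sum [intro]: "(\<And>x. x \<in> A \<Longrightarrow> f x \<in> F) \<Longrightarrow> sum f A \<in> F"
  by (induction A rule: infinite_finite_induct) auto

lemma sign [simp, intro]: "(-1) ^ n \<in> F"
  by (induction n) auto

end

definition polys_over :: "'a::zero set \<Rightarrow> 'a poly set" where
  "polys_over F = {p. \<forall>i. poly.coeff p i \<in> F}"

lemma polys_over_mono: "F \<subseteq> G \<Longrightarrow> polys_over F \<subseteq> polys_over G"
  by (auto simp: polys_over_def)

lemma polys_over_UNIV [simp]: "polys_over UNIV = UNIV"
  by (auto simp: polys_over_def)

lemma polys_over_coeff: "p \<in> polys_over F \<Longrightarrow> poly.coeff p i \<in> F"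
  by (auto simp: polys_over_def)

lemma polys_over_pCons_iff: "pCons a p \<in> polys_over F \<longleftrightarrow> a \<in> F \<and> p \<in> polys_over F"
proof
  assume *: "pCons a p \<in> polys_over F"
  have "poly.coeff (pCons a p) 0 \<in> F" "\<And>i. poly.coeff (pCons a p) (Suc i) \<in> F"
    using * unfolding polys_over_def by blast+
  then show "a \<in> F \<and> p \<in> polys_over F" by (simp add: polys_over_def)
qed (auto simp: polys_over_def coeff_pCons split: nat.splits)

lemma map_poly_polys_over:
  assumes "p \<in> polys_over F" "\<And>a. a \<in> F \<Longrightarrow> d a \<in> G" "d 0 = 0"
  shows "map_poly d p \<in> polys_over G"
  using assms by (auto simp: polys_over_def coeff_map_poly)

lemma map_poly_polys_over_constants:
  assumes "p \<in> polys_over F" "\<And>a. a \<in> F \<Longrightarrow> d a = 0"  "d 0 = 0"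
  shows "map_poly d p = 0"
  using assms by (intro poly_eqI) (auto simp: polys_over_def coeff_map_poly)

context subfield_set begin

abbreviation "FX \<equiv> polys_over F"

lemma over_0 [simp, intro]: "0 \<in> FX"
  by (simp add: polys_over_def)

lemma over_pCons [intro]: "a \<in> F \<Longrightarrow> p \<in> FX \<Longrightarrow> pCons a p \<in> FX"
  by (simp add: polys_over_pCons_iff)

lemma over_1 [simp, intro]: "1 \<in> FX"
  by (simp add: one_pCons polys_over_pCons_iff)

lemma over_add [intro]: "p \<in> FX \<Longrightarrow> q \<in> FX \<Longrightarrow> p + q \<in> FX"
  by (auto simp: polys_over_def)

lemma over_uminus [intro]: "p \<in> FX \<Longrightarrow> - p \<in> FX"
  by (auto simp: polys_over_def)

lemma over_diff [intro]: "p \<in> FX \<Longrightarrow> q \<in> FX \<Longrightarrow> p - q \<in> FX"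
  by (auto simp: polys_over_def)

lemma over_smult [intro]: "a \<in> F \<Longrightarrow> p \<in> FX \<Longrightarrow> Polynomial.smult a p \<in> FX"
  by (auto simp: polys_over_def)

lemma over_mult [intro]: "p \<in> FX \<Longrightarrow> q \<in> FX \<Longrightarrow> p * q \<in> FX"
  by (auto simp: polys_over_def coeff_mult)

lemma over_power [intro]: "p \<in> FX \<Longrightarrow> p ^ n \<in> FX"
  by (induction n) auto

lemma over_sum [intro]: "(\<And>x. x \<in> A \<Longrightarrow> f x \<in> FX) \<Longrightarrow> sum f A \<in> FX"
  by (induction A rule: infinite_finite_induct) auto

lemma over_prod [intro]: "(\<And>x. x \<in> A \<Longrightarrow> f x \<in> FX) \<Longrightarrow> prod f A \<in> FX"
  by (induction A rule: infinite_finite_induct) auto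

lemma over_pderiv [intro]: "p \<in> FX \<Longrightarrow> pderiv p \<in> FX"
  by (auto simp: polys_over_def coeff_pderiv simp del: of_nat_Suc)

lemma over_eval [intro]: "p \<in> FX \<Longrightarrow> x \<in> F \<Longrightarrow> poly p x \<in> F"
  by (induction p) (auto simp: polys_over_pCons_iff)

lemma over_divmod:
  assumes "q \<in> FX" "p \<in> FX"
  shows "p div q \<in> FX \<and> p mod q \<in> FX"
proof (cases "q = 0")
  case False
  from assms(2) show ?thesis
  proof (induction p)
    case (pCons a p)
    then show ?case using assms(1) False
      by (auto simp: polys_over_pCons_iff div_pCons_eq mod_pCons Let_def intro!: divide polys_over_coeff)
  qed auto
qed (use assms in auto)

lemma over_div [intro]: "p \<in> FX \<Longrightarrow> q \<in> FX \<Longrightarrow> p div q \<in> FX"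
  and over_mod [intro]: "p \<in> FX \<Longrightarrow> q \<in> FX \<Longrightarrow> p mod q \<in> FX"
  using over_divmod by blast+

lemma over_divisor:
  assumes "p * q \<in> FX" "p \<in> FX" "p \<noteq> 0"
  shows "q \<in> FX"
  using over_div[OF assms(1,2)] assms(3) by simp

text \<open>
  The Euclidean algorithm does not leave the coefficient field. Every descent of coefficients in the
  sequel rests on this remark instead of on Galois theory.
\<close>

lemma bezout:
  assumes "f \<in> FX" "g \<in> FX"
  obtains h u v where "h \<in> FX" "u \<in> FX" "v \<in> FX" "h = u * f + v * g" "h dvd f" "h dvd g"
proof -
  have "\<exists>h\<in>FX. \<exists>u\<in>FX. \<exists>v\<in>FX. h = u * f + v * g \<and> h dvd f \<and> h dvd g"
    using assms
  proof (induction "if g = 0 then 0 else Suc (Polynomial.degree g)" arbitrary: f g rule: less_induct)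
    case less
    show ?case
    proof (cases "g = 0")
      case True
      then show ?thesis using less.prems by (intro bexI[of _ f] bexI[of _ 1] bexI[of _ 0]) auto
    next
      case False
      have "f mod g \<in> FX" using less.prems by auto
      moreover have "(if f mod g = 0 then 0 else Suc (Polynomial.degree (f mod g))) < Suc (Polynomial.degree g)"
        using False degree_mod_less[of g f] by auto
      ultimately obtain h u v where h: "h \<in> FX" "u \<in> FX" "v \<in> FX" "h = u * g + v * (f mod g)"
          "h dvd g" "h dvd f mod g"
        using less.hyps[of "f mod g" g] less.prems False by auto
      have "h = v * f + (u - v * (f div g)) * g"
        unfolding h(4) minus_div_mult_eq_mod[symmetric] by (simp add: algebra_simps)
      moreover have "h dvd f" using h(5,6) by (metis dvd_mod_iff)
      ultimately show ?thesis using h less.prems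
        by (intro bexI[of _ h] bexI[of _ v] bexI[of _ "u - v * (f div g)"]) auto
    qed
  qed
  then show thesis using that by blast
qed

end

section \<open>Coprimality and square factors over a subfield\<close>

context subfield_set begin

definition comaximal :: "'a poly \<Rightarrow> 'a poly \<Rightarrow> bool" where
  "comaximal p q \<longleftrightarrow> (\<exists>u\<in>FX. \<exists>v\<in>FX. u * p + v * q = 1)"

lemma comaximalI:
  assumes "p \<in> FX" "q \<in> FX" "\<And>h. h \<in> FX \<Longrightarrow> h dvd p \<Longrightarrow> h dvd q \<Longrightarrow> h \<noteq> 0 \<and> Polynomial.degree h = 0"
  shows "comaximal p q"
proof -
  obtain h u v where h: "h \<in> FX" "u \<in> FX" "v \<in> FX" "h = u * p + v * q" "h dvd p" "h dvd q"
    using bezout[OF assms(1,2)] .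
  with assms(3) have "h \<noteq> 0" "Polynomial.degree h = 0" by auto
  then obtain c where c: "h = [:c:]" "c \<noteq> 0" by (metis degree_eq_zeroE pCons_0_0)
  with h(1) have cF: "c \<in> F" by (simp add: polys_over_pCons_iff)
  have "Polynomial.smult (inverse c) u * p + Polynomial.smult (inverse c) v * q = Polynomial.smult (inverse c) h"
    unfolding h(4) by (simp add: smult_add_right)
  also have "\<dots> = 1" using c by (simp add: one_pCons)
  finally show ?thesis unfolding comaximal_def using h cF by blast
qed

text \<open>
  A nonconstant divisor over \<open>F\<close> of least degree is irreducible over \<open>F\<close>. The last clause is the
  form in which irreducibility is used.
\<close>

lemma irreducible_factor:
  assumes "f \<in> FX" "Polynomial.degree f > 0"
  obtains p where "p \<in> FX" "p dvd f" "Polynomial.degree p > 0"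
    "\<And>g. g \<in> FX \<Longrightarrow> \<not> p dvd g \<Longrightarrow> comaximal p g"
proof -
  define P where "P p \<longleftrightarrow> p \<in> FX \<and> p dvd f \<and> Polynomial.degree p > 0" for p
  have "P f" using assms by (simp add: P_def)
  then obtain p where p: "P p" "\<And>q. P q \<Longrightarrow> Polynomial.degree p \<le> Polynomial.degree q"
    using ex_has_least_nat[of P f Polynomial.degree] by blast
  have "comaximal p g" if g: "g \<in> FX" "\<not> p dvd g" for g
  proof (rule comaximalI)
    fix h assume h: "h \<in> FX" "h dvd p" "h dvd g"
    have "p \<noteq> 0" using p(1) by (auto simp: P_def)
    then have "h \<noteq> 0" using h by auto
    moreover have "Polynomial.degree h = 0"
    proof (rule ccontr)
      assume "Polynomial.degree h \<noteq> 0"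
      then have "P h" using h p(1) by (auto simp: P_def)
      then have le: "Polynomial.degree p \<le> Polynomial.degree h" using p(2) by blast
      obtain c where c: "p = h * c" using h(2) by blast
      with \<open>p \<noteq> 0\<close> have "c \<noteq> 0" "h \<noteq> 0" by auto
      with le have "Polynomial.degree c = 0" by (simp add: c degree_mult_eq)
      with \<open>c \<noteq> 0\<close> have "is_unit c" by (simp add: is_unit_iff_degree)
      then have "p dvd h" by (simp add: c)
      with h(3) g(2) show False by (meson dvd_trans)
    qed
    ultimately show "h \<noteq> 0 \<and> Polynomial.degree h = 0" by blast
  qed (use p g in \<open>auto simp: P_def\<close>)
  with p(1) that show thesis by (auto simp: P_def)
qed

lemma comaximal_imp_dvd:
  assumes "comaximal p q" "p dvd q * r"
  shows "p dvd r"
proof -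
  obtain u v where "u * p + v * q = 1" using assms(1) by (auto simp: comaximal_def)
  then have "r = r * (u * p + v * q)" by simp
  also have "\<dots> = (r * u) * p + v * (q * r)" by (simp add: algebra_simps)
  finally show ?thesis using assms(2) by (metis dvd_add dvd_mult dvd_mult2 dvd_triv_right)
qed

end

lemma power_factorization:
  fixes p Q :: "'a::field poly"
  assumes "Polynomial.degree p > 0" "Q \<noteq> 0"
  obtains e Q1 where "Q = p ^ e * Q1" "\<not> p dvd Q1"
proof -
  have "\<exists>e Q1. Q = p ^ e * Q1 \<and> \<not> p dvd Q1"
    using assms(2)
  proof (induction "Polynomial.degree Q" arbitrary: Q rule: less_induct)
    case less
    show ?case
    proof (cases "p dvd Q")
      case True
      then obtain R where R: "Q = p * R" by blast
      with less.prems assms(1) have "Polynomial.degree R < Polynomial.degree Q" "R \<noteq> 0"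
        by (auto simp: degree_mult_eq)
      then obtain e Q1 where "R = p ^ e * Q1" "\<not> p dvd Q1" using less.hyps by blast
      then show ?thesis using R by (intro exI[of _ "Suc e"] exI[of _ Q1]) (auto simp: mult_ac)
    qed (metis mult_1 power_0)
  qed
  then show thesis using that by blast
qed

locale subfield_set_0 = subfield_set F for F :: "'a::field_char_0 set"
begin

lemma pderiv_not_dvd:
  assumes "Polynomial.degree (p :: 'a poly) > 0"
  shows "\<not> p dvd pderiv p"
proof
  assume "p dvd pderiv p"
  moreover have "pderiv p \<noteq> 0" using assms by (simp add: pderiv_eq_0_iff)
  ultimately have "Polynomial.degree p \<le> Polynomial.degree (pderiv p)" by (rule dvd_imp_degree_le)
  then show False using assms by (simp add: degree_pderiv)
qed

text \<open>
  An irreducible common factor \<open>p\<close> of \<open>D = p r\<close> and \<open>D'\<close> divides \<open>p' r\<close>. In characteristic zero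
  it is coprime to \<open>p'\<close>, so it divides \<open>r\<close>.
\<close>

lemma squarefree_or_square_factor:
  assumes "D \<in> FX" "D \<noteq> 0" "\<not> comaximal D (pderiv D)"
  obtains p q where "p \<in> FX" "q \<in> FX" "D = p\<^sup>2 * q" "Polynomial.degree p > 0"
    "\<And>g. g \<in> FX \<Longrightarrow> \<not> p dvd g \<Longrightarrow> comaximal p g"
proof -
  obtain h where h: "h \<in> FX" "h dvd D" "h dvd pderiv D" "\<not> (h \<noteq> 0 \<and> Polynomial.degree h = 0)"
    using comaximalI[of D "pderiv D"] assms by blast
  with assms(2) have "Polynomial.degree h > 0" by auto
  then obtain p where p: "p \<in> FX" "p dvd h" "Polynomial.degree p > 0"
      "\<And>g. g \<in> FX \<Longrightarrow> \<not> p dvd g \<Longrightarrow> comaximal p g"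
    using irreducible_factor[OF h(1)] by blast
  obtain r where r: "D = p * r" using p(2) h(2) by (meson dvd_trans dvdE)
  have "p dvd p * pderiv r + r * pderiv p"
    using p(2) h(3) unfolding r pderiv_mult by (meson dvd_trans)
  then have "p dvd pderiv p * r" by (simp add: dvd_add_right_iff mult.commute)
  moreover have "comaximal p (pderiv p)" using p pderiv_not_dvd by blast
  ultimately have "p dvd r" using comaximal_imp_dvd by blast
  then obtain q where q: "r = p * q" by blast
  have D: "D = p\<^sup>2 * q" by (simp add: r q power2_eq_square mult_ac)
  moreover have "q \<in> FX"
    using over_divisor[of "p\<^sup>2" q] p(1) assms(1,2) D by auto
  ultimately show thesis using that p by blast
qed

lemma antiderivative:
  assumes "p \<in> FX"
  obtains q where "q \<in> FX" "pderiv q = p"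
proof -
  define q where "q = (\<Sum>i\<le>Polynomial.degree p. Polynomial.monom (poly.coeff p i / of_nat (Suc i)) (Suc i))"
  have "pderiv q = (\<Sum>i\<le>Polynomial.degree p. Polynomial.monom (poly.coeff p i) i)"
    unfolding q_def higher_pderiv_sum[of 1, simplified]
    by (intro sum.cong) (auto simp: pderiv_monom simp del: of_nat_Suc)
  also have "\<dots> = p" by (simp add: poly_as_sum_of_monoms)
  finally have "pderiv q = p" .
  moreover have "q \<in> FX" unfolding q_def
  proof (rule over_sum)
    fix i
    have "poly.coeff p i / of_nat (Suc i) \<in> F"
      using assms polys_over_coeff[of p F i] by (intro divide) auto
    then show "Polynomial.monom (poly.coeff p i / of_nat (Suc i)) (Suc i) \<in> FX"
      by (auto simp: polys_over_def)
  qed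
  ultimately show thesis using that by blast
qed

end

section \<open>Split polynomials\<close>

definition split_poly :: "'a::field set \<Rightarrow> 'a poly" where
  "split_poly S = (\<Prod>a\<in>S. [:-a, 1:])"

lemma poly_split_poly: "poly (split_poly S) x = (\<Prod>a\<in>S. x - a)"
  by (simp add: split_poly_def poly_prod)

lemma split_poly_remove: "finite S \<Longrightarrow> a \<in> S \<Longrightarrow> split_poly S = [:-a, 1:] * split_poly (S - {a})"
  by (simp add: split_poly_def prod.remove)

lemma split_poly_nonzero [simp]: "finite S \<Longrightarrow> split_poly S \<noteq> 0"
  by (simp add: split_poly_def)

lemma degree_split_poly: "finite S \<Longrightarrow> Polynomial.degree (split_poly S) = card S"
  by (simp add: split_poly_def degree_prod_eq_sum_degree)

lemma poly_split_poly_eq_0_iff: "finite S \<Longrightarrow> poly (split_poly S) x = 0 \<longleftrightarrow> x \<in> S"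
  by (simp add: poly_split_poly)

lemma pderiv_split_poly_root:
  assumes "finite S" "a \<in> S"
  shows "poly (pderiv (split_poly S)) a = poly (split_poly (S - {a})) a"
  unfolding split_poly_remove[OF assms] pderiv_mult by (simp add: pderiv_pCons)

lemma lagrange_interpolation:
  assumes "finite S" "Polynomial.degree A < card S" "c \<noteq> 0" "D = Polynomial.smult c (split_poly S)"
  shows "A = (\<Sum>a\<in>S. Polynomial.smult (poly A a / poly (pderiv D) a * c) (split_poly (S - {a})))"
proof (rule poly_eqI_degree[of S])
  fix x assume x: "x \<in> S"
  have "poly (split_poly (S - {a})) x = 0" if "a \<in> S" "a \<noteq> x" for a
    using assms(1) x that by (simp add: poly_split_poly_eq_0_iff)
  then have "(\<Sum>a\<in>S. poly A a / poly (pderiv D) a * c * poly (split_poly (S - {a})) x)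
      = poly A x / poly (pderiv D) x * c * poly (split_poly (S - {x})) x"
    using assms(1) x by (subst sum.remove[OF assms(1) x]) (simp add: sum.neutral)
  also have "\<dots> = poly A x"
  proof -
    have "poly (split_poly (S - {x})) x \<noteq> 0" using assms(1) by (simp add: poly_split_poly_eq_0_iff)
    then show ?thesis
      using assms(1,3) x by (simp add: assms(4) pderiv_smult pderiv_split_poly_root)
  qed
  finally show "poly A x = poly (\<Sum>a\<in>S. Polynomial.smult (poly A a / poly (pderiv D) a * c) (split_poly (S - {a}))) x"
    by (simp add: poly_sum)
next
  show "Polynomial.degree (\<Sum>a\<in>S. Polynomial.smult (poly A a / poly (pderiv D) a * c) (split_poly (S - {a}))) < card S"
  proof (rule degree_sum_less)
    fix a assume a: "a \<in> S"
    have "Polynomial.degree (split_poly (S - {a})) < card S"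
      using assms(1) a by (metis degree_split_poly card_Diff1_less finite_Diff)
    then show "Polynomial.degree (Polynomial.smult (poly A a / poly (pderiv D) a * c) (split_poly (S - {a}))) < card S"
      by (meson degree_smult_le le_less_trans)
  qed (use assms in auto)
qed (use assms in auto)

text \<open>
  Lagrange interpolation at the simple roots of the denominator. The numbers \<open>A(a) / D'(a)\<close> are the
  residues.
\<close>

lemma partial_fractions:
  assumes "finite S" "A = 0 \<or> Polynomial.degree A < card S" "c \<noteq> 0" "D = Polynomial.smult c (split_poly S)" "x \<notin> S"
  shows "poly A x / poly D x = (\<Sum>a\<in>S. poly A a / poly (pderiv D) a / (x - a))"
proof (cases "A = 0")
  case False
  have *: "poly (split_poly S) x = (x - a) * poly (split_poly (S - {a})) x" if "a \<in> S" for a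
    by (simp add: split_poly_remove[OF assms(1) that] algebra_simps)
  have nz: "poly (split_poly S) x \<noteq> 0" using assms(1,5) by (simp add: poly_split_poly_eq_0_iff)
  have "poly A x = (\<Sum>a\<in>S. poly A a / poly (pderiv D) a * c * poly (split_poly (S - {a})) x)"
    by (subst lagrange_interpolation[OF assms(1) _ assms(3,4)]) (use False assms in \<open>auto simp: poly_sum\<close>)
  also have "\<dots> = (\<Sum>a\<in>S. poly A a / poly (pderiv D) a / (x - a) * poly D x)"
  proof (rule sum.cong)
    fix a assume a: "a \<in> S"
    then have "x - a \<noteq> 0" using assms(5) by auto
    then show "poly A a / poly (pderiv D) a * c * poly (split_poly (S - {a})) x
        = poly A a / poly (pderiv D) a / (x - a) * poly D x"
      by (simp add: assms(4) *[OF a])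
  qed simp
  finally have "poly A x = (\<Sum>a\<in>S. poly A a / poly (pderiv D) a / (x - a)) * poly D x"
    by (simp add: sum_distrib_right)
  then show ?thesis using nz assms(3,4) by simp
qed simp

lemma monic_divisor_of_split_poly:
  assumes "finite S" "h dvd split_poly S" "Polynomial.lead_coeff h = 1"
  shows "h = split_poly {a \<in> S. poly h a = 0}"
  using assms
proof (induction S arbitrary: h rule: finite_induct)
  case empty
  then have "is_unit h" by (simp add: split_poly_def)
  then obtain c where "h = [:c:]" by (auto simp: is_unit_poly_iff)
  with empty.prems show ?case by (simp add: split_poly_def one_pCons)
next
  case (insert a S)
  have eq: "split_poly (insert a S) = [:-a, 1:] * split_poly S"
    using insert.hyps by (simp add: split_poly_def)
  show ?case
  proof (cases "poly h a = 0")
    case True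
    then obtain g where g: "h = [:-a, 1:] * g" by (auto simp: poly_eq_0_iff_dvd)
    have "g dvd split_poly S" using insert.prems(1) unfolding g eq
      by (simp only: dvd_mult_cancel_left) simp
    moreover have "Polynomial.lead_coeff g = 1"
      using insert.prems(2) unfolding g lead_coeff_mult by simp
    ultimately have IH: "g = split_poly {b \<in> S. poly g b = 0}" by (rule insert.IH)
    have "{b \<in> insert a S. poly h b = 0} = insert a {b \<in> S. poly g b = 0}"
      using True by (auto simp: g)
    then show ?thesis using IH insert.hyps g by (simp add: split_poly_def)
  next
    case False
    obtain r where r: "split_poly (insert a S) = h * r" using insert.prems(1) by blast
    then have "poly r a = 0" using False eq
      by (metis mult_eq_0_iff poly_mult poly_eq_0_iff_dvd dvd_triv_left)
    then obtain r' where "r = [:-a, 1:] * r'" by (auto simp: poly_eq_0_iff_dvd)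
    with r eq have "[:-a, 1:] * split_poly S = [:-a, 1:] * (h * r')" by (simp only: mult_ac)
    then have "split_poly S = h * r'" by (simp only: mult_cancel_left) simp
    then have "h = split_poly {b \<in> S. poly h b = 0}"
      using insert.IH[of h] insert.prems(2) by simp
    moreover have "{b \<in> insert a S. poly h b = 0} = {b \<in> S. poly h b = 0}"
      using False by auto
    ultimately show ?thesis by simp
  qed
qed

text \<open>
  The product is the monic greatest common divisor of \<open>g\<close> and the split polynomial, and the
  Euclidean algorithm computes it inside \<open>F\<close>. The roots themselves need not lie in \<open>F\<close>.
\<close>

lemma (in subfield_set) split_common_roots:
  assumes "finite S" "c \<noteq> 0" "Polynomial.smult c (split_poly S) \<in> FX" "g \<in> FX"
  shows "split_poly {a \<in> S. poly g a = 0} \<in> FX"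
proof -
  define D where "D = Polynomial.smult c (split_poly S)"
  have "D \<noteq> 0" using assms by (simp add: D_def)
  obtain h u v where h: "h \<in> FX" "u \<in> FX" "v \<in> FX" "h = u * D + v * g" "h dvd D" "h dvd g"
    using bezout[OF assms(3,4), folded D_def] .
  have "h \<noteq> 0" using h(5) \<open>D \<noteq> 0\<close> by auto
  define m where "m = Polynomial.smult (inverse (Polynomial.lead_coeff h)) h"
  have "m \<in> FX" using h(1) by (auto simp: m_def intro: polys_over_coeff)
  have "m = split_poly {a \<in> S. poly m a = 0}"
  proof (rule monic_divisor_of_split_poly)
    show "m dvd split_poly S"
      using h(5) \<open>h \<noteq> 0\<close> assms(2) by (simp add: m_def D_def smult_dvd_iff dvd_smult_iff)
    show "Polynomial.lead_coeff m = 1" using \<open>h \<noteq> 0\<close> by (simp add: m_def)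
  qed fact
  also have "{a \<in> S. poly m a = 0} = {a \<in> S. poly g a = 0}"
  proof -
    have "poly h a = 0 \<longleftrightarrow> poly g a = 0" if "a \<in> S" for a
    proof -
      have "poly D a = 0" using that assms(1) by (simp add: D_def poly_split_poly_eq_0_iff)
      moreover have "poly g a = 0" if "poly h a = 0"
        using that h(6) by (auto simp: poly_eq_0_iff_dvd intro: dvd_trans)
      ultimately show ?thesis by (auto simp: h(4))
    qed
    then show ?thesis using \<open>h \<noteq> 0\<close> by (auto simp: m_def)
  qed
  finally show ?thesis using \<open>m \<in> FX\<close> by simp
qed

text \<open>
  A derivative has no residues. The last hypothesis is the equation
  \<open>(f / g)' = (\<Sum>b\<in>S. e b / (Y - b))\<close> with its denominators cleared. A common zero of \<open>f\<close> and \<open>g\<close> at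
  \<open>a\<close> can be cancelled. If then \<open>g\<close> still vanishes at \<open>a\<close>, the left side has a pole of order at least
  two there, which the right side has not. Otherwise the left side is regular at \<open>a\<close>, and so is the right.
\<close>

lemma residues_of_derivative:
  fixes f g :: "'a::field_char_0 poly"
  assumes S: "finite S" "a \<in> S" and "g \<noteq> 0"
    and "(pderiv f * g - f * pderiv g) * split_poly S
       = g\<^sup>2 * (\<Sum>b\<in>S. Polynomial.smult (e b) (split_poly (S - {b})))"
  shows "e a = 0"
  using assms(3-)
proof (induction "Polynomial.degree g" arbitrary: f g rule: less_induct)
  case less
  define Y :: "'a poly" where "Y = [:-a, 1:]"
  define M where "M = split_poly (S - {a})"
  define T where "T = (\<Sum>b\<in>S. Polynomial.smult (e b) (split_poly (S - {b})))"
  have Y: "poly Y a = 0" "Y \<noteq> 0" "pderiv Y = 1" "Polynomial.degree Y = 1" by (auto simp: Y_def pderiv_pCons one_pCons)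
  have M: "poly M a \<noteq> 0" using S by (simp add: M_def poly_split_poly_eq_0_iff)
  have sp: "split_poly S = Y * M" using split_poly_remove[OF S] by (simp add: Y_def M_def)
  have T: "poly T a = e a * poly M a"
  proof -
    have "poly (split_poly (S - {b})) a = 0" if "b \<in> S" "b \<noteq> a" for b
      using S that by (simp add: poly_split_poly_eq_0_iff)
    then show ?thesis unfolding T_def M_def poly_sum poly_smult
      by (subst sum.remove[OF S]) (simp add: sum.neutral)
  qed
  note eq = less.prems(2)[folded T_def, unfolded sp]
  have divY: "\<exists>q. p = Y * q" if "poly p a = 0" for p
    using that by (auto simp: poly_eq_0_iff_dvd Y_def elim!: dvdE)
  show ?case
  proof (cases "poly g a = 0")
    case False
    have "poly ((pderiv f * g - f * pderiv g) * (Y * M)) a = poly (g\<^sup>2 * T) a" by (simp only: eq)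
    then have "0 = (poly g a)\<^sup>2 * (e a * poly M a)" by (simp add: Y T)
    then show ?thesis using False M by simp
  next
    case g0: True
    show ?thesis
    proof (cases "poly f a = 0")
      case True
      obtain f1 where f1: "f = Y * f1" using divY[OF True] by blast
      obtain g1 where g1: "g = Y * g1" using divY[OF g0] by blast
      have "g1 \<noteq> 0" using less.prems(1) g1 by auto
      have "Y\<^sup>2 * ((pderiv f1 * g1 - f1 * pderiv g1) * (Y * M)) = Y\<^sup>2 * (g1\<^sup>2 * T)"
        using eq unfolding f1 g1 pderiv_mult Y(3) by (simp add: algebra_simps power2_eq_square)
      then have "(pderiv f1 * g1 - f1 * pderiv g1) * (Y * M) = g1\<^sup>2 * T"
        using Y(2) by (simp only: mult_cancel_left) simp
      moreover have "Polynomial.degree g1 < Polynomial.degree g"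
        using \<open>g1 \<noteq> 0\<close> Y by (simp add: g1 degree_mult_eq)
      ultimately show ?thesis using less.hyps[of g1 f1] \<open>g1 \<noteq> 0\<close> by (simp add: sp T_def)
    next
      case f0: False
      obtain j g1 where j: "g = Y ^ j * g1" "\<not> Y dvd g1"
        using power_factorization[of Y g] Y less.prems(1) by auto
      obtain i where i: "j = Suc i" using j g0 by (cases j) (auto simp: Y_def poly_eq_0_iff_dvd)
      have "poly g1 a \<noteq> 0" using j(2) by (simp add: poly_eq_0_iff_dvd Y_def)
      define B where "B = Y * pderiv f * g1 - f * (of_nat j * g1 + Y * pderiv g1)"
      have dg: "pderiv g = Y ^ i * (of_nat j * g1 + Y * pderiv g1)"
        unfolding j(1) i pderiv_mult pderiv_power_Suc Y(3)
        by (simp add: algebra_simps flip: of_nat_Suc) (simp add: of_nat_poly)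
      have "Y ^ j * (B * M) = (pderiv f * g - f * pderiv g) * (Y * M)"
        unfolding dg B_def by (simp add: j(1) i algebra_simps)
      also have "\<dots> = Y ^ j * (Y * (Y ^ i * g1\<^sup>2 * T))"
        unfolding eq by (simp add: j(1) i algebra_simps power2_eq_square)
      finally have "B * M = Y * (Y ^ i * g1\<^sup>2 * T)"
        using Y(2) by (simp only: mult_cancel_left) simp
      then have "poly (B * M) a = poly (Y * (Y ^ i * g1\<^sup>2 * T)) a" by (simp only:)
      then have "poly f a * (of_nat j * poly g1 a) * poly M a = 0"
        by (simp add: Y B_def of_nat_poly)
      then show ?thesis using f0 M \<open>poly g1 a \<noteq> 0\<close> i by (simp del: of_nat_Suc)
    qed
  qed
qed

section \<open>Rational functions of a variable over a field of constants\<close>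

definition rational_values :: "'a::field set \<Rightarrow> 'a \<Rightarrow> 'a set" where
  "rational_values F t =
     {poly P t / poly Q t |P Q. P \<in> polys_over F \<and> Q \<in> polys_over F \<and> poly Q t \<noteq> 0}"

lemma rational_valuesI:
  "P \<in> polys_over F \<Longrightarrow> Q \<in> polys_over F \<Longrightarrow> poly Q t \<noteq> 0 \<Longrightarrow> poly P t / poly Q t \<in> rational_values F t"
  unfolding rational_values_def by blast

lemma rational_valuesE:
  assumes "f \<in> rational_values F t"
  obtains P Q where "P \<in> polys_over F" "Q \<in> polys_over F" "poly Q t \<noteq> 0" "f = poly P t / poly Q t"
  using assms unfolding rational_values_def by blast

context subfield_set begin

lemma poly_value_rational: "P \<in> FX \<Longrightarrow> poly P t \<in> rational_values F t"
  using rational_valuesI[of P F 1 t] by simp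

lemma subfield_rational_values: "subfield_set (rational_values F t)"
proof
  show "0 \<in> rational_values F t" "1 \<in> rational_values F t"
    using poly_value_rational[of 0 t] poly_value_rational[of 1 t] by simp_all
next
  fix a b assume "a \<in> rational_values F t" "b \<in> rational_values F t"
  then obtain P Q P' Q' where PQ: "P \<in> FX" "Q \<in> FX" "poly Q t \<noteq> 0" "a = poly P t / poly Q t"
     "P' \<in> FX" "Q' \<in> FX" "poly Q' t \<noteq> 0" "b = poly P' t / poly Q' t"
    by (elim rational_valuesE)
  have "a + b = poly (P * Q' + P' * Q) t / poly (Q * Q') t"
    using PQ by (simp add: add_frac_eq)
  then show "a + b \<in> rational_values F t"
    using PQ rational_valuesI[of "P * Q' + P' * Q" F "Q * Q'" t] by auto
  have "a * b = poly (P * P') t / poly (Q * Q') t" using PQ by simp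
  then show "a * b \<in> rational_values F t"
    using PQ rational_valuesI[of "P * P'" F "Q * Q'" t] by auto
next
  fix a assume "a \<in> rational_values F t"
  then obtain P Q where PQ: "P \<in> FX" "Q \<in> FX" "poly Q t \<noteq> 0" "a = poly P t / poly Q t"
    by (elim rational_valuesE)
  have "- a = poly (- P) t / poly Q t" using PQ by simp
  then show "- a \<in> rational_values F t"
    using PQ rational_valuesI[of "- P" F Q t] by auto
  show "inverse a \<in> rational_values F t"
  proof (cases "poly P t = 0")
    case True
    then show ?thesis using PQ poly_value_rational[of 0 t] by simp
  next
    case False
    then show ?thesis using PQ rational_valuesI[of Q F P t] by simp
  qed
qed

lemma rational_values_minimal:
  assumes "subfield_set G" "F \<subseteq> G" "t \<in> G"
  shows "rational_values F t \<subseteq> G"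
proof
  interpret G: subfield_set G by fact
  fix f assume "f \<in> rational_values F t"
  then show "f \<in> G" using assms(2,3) polys_over_mono[of F G]
    by (auto elim!: rational_valuesE intro!: G.divide G.over_eval)
qed

end

text \<open>
  The rational functions of one variable \<open>t\<close> over a field of constants. That \<open>t\<close> is transcendental is a
  consequence of \<open>d t = 1\<close>.
\<close>

locale constants_and_variable = derivation d + subfield_set_0 F
  for d :: "'a::field_char_0 \<Rightarrow> 'a" and F :: "'a set" +
  fixes t :: 'a
  assumes const: "c \<in> F \<Longrightarrow> d c = 0" and var: "d t = 1"
begin

lemma deriv_poly: "P \<in> FX \<Longrightarrow> d (poly P t) = poly (pderiv P) t"
  using map_poly_polys_over_constants[of P F d] const by (simp add: poly_rule var)

text \<open>
  The derivative of a nontrivial algebraic relation for \<open>t\<close> is a nontrivial relation of smaller degree.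
\<close>

lemma transcendental:
  assumes "P \<in> FX" "poly P t = 0"
  shows "P = 0"
  using assms
proof (induction "Polynomial.degree P" arbitrary: P rule: less_induct)
  case less
  show ?case
  proof (cases "Polynomial.degree P = 0")
    case True
    then show ?thesis using less.prems by (auto elim!: degree_eq_zeroE)
  next
    case False
    have "poly (pderiv P) t = 0" using deriv_poly[OF less.prems(1)] less.prems(2) by simp
    moreover have "Polynomial.degree (pderiv P) < Polynomial.degree P"
      using False by (simp add: degree_pderiv)
    ultimately have "pderiv P = 0" using less by blast
    then show ?thesis using False by (simp add: pderiv_eq_0_iff)
  qed
qed

lemma deriv_quotient:
  assumes "P \<in> FX" "Q \<in> FX" "Q \<noteq> 0"
  shows "d (poly P t / poly Q t) = (poly (pderiv P) t * poly Q t - poly P t * poly (pderiv Q) t) / (poly Q t)\<^sup>2"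
  using assms transcendental[of Q] derivation_divide[OF derivation_axioms, of "poly Q t" "poly P t"]
  by (auto simp: deriv_poly)

text \<open>
  Write \<open>P = u p + v p' q\<close>. The second term contributes \<open>v p' / p\<^bsup>e+2\<^esup>\<close>, which is the derivative of
  \<open>- v / ((e + 1) p\<^bsup>e+1\<^esup>)\<close> up to a fraction with the smaller exponent \<open>e + 1\<close>.
\<close>

lemma hermite_step:
  assumes "p \<in> FX" "q \<in> FX" "P \<in> FX" "p \<noteq> 0" "q \<noteq> 0" "comaximal p (pderiv p * q)"
  obtains b R where "b \<in> rational_values F t" "R \<in> FX"
    "poly P t / poly (p ^ Suc (Suc e) * q) t = d b + poly R t / poly (p ^ Suc e * q) t"
proof -
  obtain u0 v0 where u0: "u0 \<in> FX" "v0 \<in> FX" "u0 * p + v0 * (pderiv p * q) = 1"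
    using assms(6) by (auto simp: comaximal_def)
  define u v where "u = P * u0" and "v = P * v0"
  have "P = P * (u0 * p + v0 * (pderiv p * q))" by (simp add: u0(3))
  also have "\<dots> = u * p + v * pderiv p * q" unfolding u_def v_def by (simp only: algebra_simps)
  finally have uv: "u \<in> FX" "v \<in> FX" "P = u * p + v * pderiv p * q"
    using assms(3) u0 by (auto simp: u_def v_def)
  define c :: 'a where "c = of_nat (Suc e)"
  have c: "c \<noteq> 0" "c \<in> F" unfolding c_def by (simp_all only: of_nat_eq_0_iff of_nat)
  define v' where "v' = Polynomial.smult (inverse c) v"
  have v': "v' \<in> FX" using uv(2) c by (auto simp: v'_def)
  define R where "R = u + pderiv v' * q"
  define b where "b = poly (- v') t / poly (p ^ Suc e) t"
  define z where "z = poly p t ^ e"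
  have nz: "poly p t \<noteq> 0" "poly q t \<noteq> 0" "z \<noteq> 0" using assms transcendental by (auto simp: z_def)
  have "d b = (poly (pderiv (- v')) t * poly (p ^ Suc e) t - poly (- v') t * poly (pderiv (p ^ Suc e)) t)
      / (poly (p ^ Suc e) t)\<^sup>2"
    unfolding b_def by (rule deriv_quotient) (use v' assms in auto)
  also have "\<dots> = - poly (pderiv v') t / (poly p t * z) + poly v t * poly (pderiv p) t / ((poly p t)\<^sup>2 * z)"
  proof -
    have "poly (pderiv (p ^ Suc e)) t = c * z * poly (pderiv p) t" "poly (p ^ Suc e) t = poly p t * z"
      unfolding pderiv_power_Suc c_def[symmetric] by (simp_all add: z_def)
    moreover have "poly v t = c * poly v' t" using c by (simp add: v'_def)
    ultimately show ?thesis using nz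
      by (simp add: pderiv_minus divide_simps) (simp add: power2_eq_square algebra_simps)
  qed
  finally have db: "d b = - poly (pderiv v') t / (poly p t * z) + poly v t * poly (pderiv p) t / ((poly p t)\<^sup>2 * z)" .
  have "poly P t / poly (p ^ Suc (Suc e) * q) t = d b + poly R t / poly (p ^ Suc e * q) t"
  proof -
    have "poly (p ^ Suc (Suc e) * q) t = (poly p t)\<^sup>2 * z * poly q t" "poly (p ^ Suc e * q) t = poly p t * z * poly q t"
      by (simp_all add: z_def power2_eq_square)
    moreover have "poly P t = poly u t * poly p t + poly v t * poly (pderiv p) t * poly q t"
      "poly R t = poly u t + poly (pderiv v') t * poly q t"
      by (simp_all add: uv(3) R_def)
    ultimately show ?thesis unfolding db using nz
      by (simp add: divide_simps) (simp add: power2_eq_square algebra_simps)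
  qed
  moreover have "b \<in> rational_values F t" unfolding b_def
    using v' assms nz by (intro rational_valuesI) auto
  moreover have "R \<in> FX" using uv v' assms by (auto simp: R_def)
  ultimately show thesis using that by blast
qed

text \<open>
  Hermite reduction: as long as \<open>Q\<close> has a multiple irreducible factor, its exponent can be lowered at
  the cost of a derivative. The squarefree denominator \<open>D\<close> depends on \<open>Q\<close> alone. Hence all functions with
  the denominator \<open>Q\<close> can be integrated with logarithms of the same linear factors.
\<close>

lemma hermite_reduction:
  assumes "Q \<in> FX" "Q \<noteq> 0"
  obtains D where "D \<in> FX" "D \<noteq> 0" "comaximal D (pderiv D)"
    "\<And>P. P \<in> FX \<Longrightarrow> \<exists>b\<in>rational_values F t. \<exists>A\<in>FX. (A = 0 \<or> Polynomial.degree A < Polynomial.degree D) \<and>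
        poly P t / poly Q t = d b + poly A t / poly D t"
proof -
  interpret R: subfield_set "rational_values F t" by (rule subfield_rational_values)
  have "\<exists>D\<in>FX. D \<noteq> 0 \<and> comaximal D (pderiv D) \<and>
    (\<forall>P\<in>FX. \<exists>b\<in>rational_values F t. \<exists>A\<in>FX. (A = 0 \<or> Polynomial.degree A < Polynomial.degree D) \<and>
        poly P t / poly Q t = d b + poly A t / poly D t)"
    using assms
  proof (induction "Polynomial.degree Q" arbitrary: Q rule: less_induct)
    case less
    show ?case
    proof (cases "comaximal Q (pderiv Q)")
      case True
      have "\<exists>b\<in>rational_values F t. \<exists>A\<in>FX. (A = 0 \<or> Polynomial.degree A < Polynomial.degree Q) \<and>
          poly P t / poly Q t = d b + poly A t / poly Q t" if P: "P \<in> FX" for P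
      proof -
        have "P div Q \<in> FX" using P less.prems by auto
        then obtain q where q: "q \<in> FX" "pderiv q = P div Q" by (rule antiderivative)
        have nz: "poly Q t \<noteq> 0" using less.prems transcendental by auto
        have "poly P t = poly (P div Q) t * poly Q t + poly (P mod Q) t"
          by (metis div_mult_mod_eq Polynomial.poly_add Polynomial.poly_mult)
        then have "poly P t / poly Q t = d (poly q t) + poly (P mod Q) t / poly Q t"
          using nz by (simp only: deriv_poly[OF q(1)] q(2) add_divide_distrib) simp
        moreover have "P mod Q = 0 \<or> Polynomial.degree (P mod Q) < Polynomial.degree Q"
          by (rule degree_mod_less[OF less.prems(2)])
        moreover have "P mod Q \<in> FX" using P less.prems by auto
        moreover have "poly q t \<in> rational_values F t" by (rule poly_value_rational[OF q(1)])
        ultimately show ?thesis by (intro bexI[of _ "poly q t"] bexI[of _ "P mod Q"]) simp_all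
      qed
      then show ?thesis using True less.prems by blast
    next
      case False
      then obtain p r where p: "p \<in> FX" "r \<in> FX" "Q = p\<^sup>2 * r" "Polynomial.degree p > 0"
          "\<And>g. g \<in> FX \<Longrightarrow> \<not> p dvd g \<Longrightarrow> comaximal p g"
        using squarefree_or_square_factor less.prems by blast
      have "r \<noteq> 0" "p \<noteq> 0" using less.prems p by auto
      obtain e q where q: "r = p ^ e * q" "\<not> p dvd q"
        using power_factorization[OF p(4) \<open>r \<noteq> 0\<close>] .
      have "p ^ e \<noteq> 0" using \<open>p \<noteq> 0\<close> by simp
      have "q \<noteq> 0" using q(2) by auto
      have "p ^ e \<in> FX" using p(1) by (rule over_power)
      then have "q \<in> FX" using over_divisor[of "p ^ e" q] p(2) q(1) \<open>p ^ e \<noteq> 0\<close> by simp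
      have Q: "Q = p ^ Suc (Suc e) * q" by (simp add: p(3) q(1) power2_eq_square)
      have "comaximal p (pderiv p)"
        by (rule p(5)[OF over_pderiv[OF p(1)] pderiv_not_dvd[OF p(4)]])
      then have "\<not> p dvd pderiv p * q" using comaximal_imp_dvd q(2) by metis
      with p(5)[OF over_mult[OF over_pderiv[OF p(1)] \<open>q \<in> FX\<close>]]
      have co: "comaximal p (pderiv p * q)" .
      define Q' where "Q' = p ^ Suc e * q"
      have "Q' \<in> FX" unfolding Q'_def by (intro over_mult over_power p(1) \<open>q \<in> FX\<close>)
      moreover have "Q' \<noteq> 0" using \<open>q \<noteq> 0\<close> \<open>p \<noteq> 0\<close> by (simp add: Q'_def)
      moreover have "Q = p * Q'" by (simp add: Q Q'_def)
      then have "Polynomial.degree Q' < Polynomial.degree Q"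
        using \<open>Q' \<noteq> 0\<close> \<open>p \<noteq> 0\<close> p(4) by (simp add: degree_mult_eq)
      ultimately obtain D where D: "D \<in> FX" "D \<noteq> 0" "comaximal D (pderiv D)"
        "\<And>P. P \<in> FX \<Longrightarrow> \<exists>b\<in>rational_values F t. \<exists>A\<in>FX. (A = 0 \<or> Polynomial.degree A < Polynomial.degree D) \<and>
            poly P t / poly Q' t = d b + poly A t / poly D t"
        using less.hyps[of Q'] by blast
      have "\<exists>b\<in>rational_values F t. \<exists>A\<in>FX. (A = 0 \<or> Polynomial.degree A < Polynomial.degree D) \<and>
            poly P t / poly Q t = d b + poly A t / poly D t" if P: "P \<in> FX" for P
      proof -
        obtain b R where b: "b \<in> rational_values F t" "R \<in> FX"
          "poly P t / poly Q t = d b + poly R t / poly Q' t"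
          using hermite_step[OF p(1) \<open>q \<in> FX\<close> P \<open>p \<noteq> 0\<close> \<open>q \<noteq> 0\<close> co, of e] unfolding Q Q'_def by blast
        obtain b' A where b': "b' \<in> rational_values F t" "A \<in> FX" "A = 0 \<or> Polynomial.degree A < Polynomial.degree D"
           "poly R t / poly Q' t = d b' + poly A t / poly D t"
          using D(4)[OF b(2)] by blast
        have "poly P t / poly Q t = d (b + b') + poly A t / poly D t" by (simp add: b(3) b'(4))
        then show ?thesis using R.add[OF b(1) b'(1)] b'(2,3) by blast
      qed
      then show ?thesis using D(1-3) by blast
    qed
  qed
  then show thesis using that by blast
qed

lemma common_denominator:
  assumes "finite I" "\<And>i. i \<in> I \<Longrightarrow> f i \<in> rational_values F t"
  obtains Q where "Q \<in> FX" "Q \<noteq> 0" "\<And>i. i \<in> I \<Longrightarrow> \<exists>P\<in>FX. f i = poly P t / poly Q t"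
proof -
  have "\<exists>Q\<in>FX. Q \<noteq> 0 \<and> (\<forall>i\<in>I. \<exists>P\<in>FX. f i = poly P t / poly Q t)"
    using assms
  proof (induction I rule: finite_induct)
    case (insert i I)
    then obtain Q where Q: "Q \<in> FX" "Q \<noteq> 0" "\<And>j. j \<in> I \<Longrightarrow> \<exists>P\<in>FX. f j = poly P t / poly Q t" by auto
    obtain P' Q' where P': "P' \<in> FX" "Q' \<in> FX" "poly Q' t \<noteq> 0" "f i = poly P' t / poly Q' t"
      using insert.prems by (blast elim: rational_valuesE)
    have nz: "poly Q t \<noteq> 0" using Q transcendental by auto
    have "\<exists>P\<in>FX. f j = poly P t / poly (Q * Q') t" if "j \<in> insert i I" for j
    proof (cases "j = i")
      case True
      then show ?thesis using P' Q(1) nz by (intro bexI[of _ "P' * Q"]) auto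
    next
      case False
      then obtain P where "P \<in> FX" "f j = poly P t / poly Q t" using Q(3)[of j] \<open>j \<in> insert i I\<close> by blast
      then show ?thesis using P' by (intro bexI[of _ "P * Q'"]) auto
    qed
    moreover have "Q * Q' \<noteq> 0" using nz P'(3) by auto
    ultimately show ?case using Q(1) P'(2) by (intro bexI[of _ "Q * Q'"]) auto
  qed (auto intro: bexI[of _ 1])
  then show thesis using that by blast
qed

end


lemma subfield_constants:
  assumes "derivation d"
  shows "subfield_set {c :: 'a::field. d c = 0}"
proof -
  interpret derivation d by fact
  have "d (inverse a) = 0" if "d a = 0" for a
    using derivation_constants_divide[OF assms, of 1 a] that by (simp add: divide_inverse)
  then show ?thesis by unfold_locales (auto simp: mult)
qed

context constants_and_variable begin

abbreviation "C \<equiv> {c. d c = 0}"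

lemma constants: "constants_and_variable d C t"
proof -
  interpret C: subfield_set C by (rule subfield_constants) (rule derivation_axioms)
  show ?thesis by unfold_locales (auto simp: var)
qed

text \<open>
  The variable is transcendental over the field of all constants, which contains \<open>f\<close>. Thus
  \<open>P(t) = f Q(t)\<close> is an identity between coefficients, and \<open>f\<close> is a quotient of two of them.
\<close>

lemma rational_constant:
  assumes "f \<in> rational_values F t" "d f = 0"
  shows "f \<in> F"
proof -
  interpret C: constants_and_variable d C t by (rule constants)
  obtain P Q where PQ: "P \<in> FX" "Q \<in> FX" "poly Q t \<noteq> 0" "f = poly P t / poly Q t"
    using assms(1) by (rule rational_valuesE)
  have "F \<subseteq> C" using const by auto
  then have "P - Polynomial.smult f Q \<in> C.FX"
    using PQ assms(2) polys_over_mono[of F C] by (intro C.over_diff C.over_smult) auto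
  then have "P - Polynomial.smult f Q = 0" by (rule C.transcendental) (use PQ in simp)
  then have "poly.coeff P i = f * poly.coeff Q i" for i by (metis coeff_smult eq_iff_diff_eq_0)
  moreover have "Q \<noteq> 0" using PQ(3) by auto
  ultimately have "f = poly.coeff P (Polynomial.degree Q) / poly.coeff Q (Polynomial.degree Q)" by simp
  then show ?thesis using PQ(1,2) polys_over_coeff by (metis divide)
qed

text \<open>
  Over the field of all constants the equation between values at \<open>t\<close> is an identity of rational
  functions, and the residues on the left vanish.
\<close>

lemma log_derivative_not_exact:
  assumes S: "finite S" "S \<subseteq> C" "\<And>a. a \<in> S \<Longrightarrow> e a \<in> C"
    and f: "f \<in> rational_values C t" "d f = (\<Sum>a\<in>S. e a / (t - a))"
    and a: "a \<in> S"
  shows "e a = 0"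
proof -
  interpret C: constants_and_variable d C t by (rule constants)
  obtain P Q where PQ: "P \<in> C.FX" "Q \<in> C.FX" "poly Q t \<noteq> 0" "f = poly P t / poly Q t"
    using f(1) by (rule rational_valuesE)
  then have "Q \<noteq> 0" by auto
  define T where "T = (\<Sum>b\<in>S. Polynomial.smult (e b) (split_poly (S - {b})))"
  have sp: "split_poly A \<in> C.FX" if "A \<subseteq> S" for A
    unfolding split_poly_def using S(2) that by (intro C.over_prod C.over_pCons) auto
  have "t \<notin> S" using S(2) var by auto
  then have nz: "poly (split_poly S) t \<noteq> 0" using S(1) by (simp add: poly_split_poly_eq_0_iff)
  have "(\<Sum>a\<in>S. e a / (t - a)) * poly (split_poly S) t = poly T t"
    unfolding T_def Polynomial.poly_sum sum_distrib_right
  proof (rule sum.cong)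
    fix b assume b: "b \<in> S"
    then have "t - b \<noteq> 0" using \<open>t \<notin> S\<close> by auto
    moreover have "poly (split_poly S) t = (t - b) * poly (split_poly (S - {b})) t"
      by (subst split_poly_remove[OF S(1) b]) (simp add: algebra_simps)
    ultimately show "e b / (t - b) * poly (split_poly S) t = poly (Polynomial.smult (e b) (split_poly (S - {b}))) t"
      by simp
  qed simp
  then have "poly T t * (poly Q t)\<^sup>2 = (d f * (poly Q t)\<^sup>2) * poly (split_poly S) t"
    by (simp add: f(2) mult_ac)
  also have "d f * (poly Q t)\<^sup>2 = poly (pderiv P * Q - P * pderiv Q) t"
    using C.deriv_quotient[OF PQ(1,2) \<open>Q \<noteq> 0\<close>] PQ(3,4) by simp
  finally have "poly ((pderiv P * Q - P * pderiv Q) * split_poly S - Q\<^sup>2 * T) t = 0"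
    by (simp add: mult_ac)
  moreover have "(pderiv P * Q - P * pderiv Q) * split_poly S - Q\<^sup>2 * T \<in> C.FX"
    unfolding T_def using PQ(1,2) sp S(3)
    by (intro C.over_diff C.over_mult C.over_sum C.over_smult C.over_pderiv C.over_power) auto
  ultimately have "(pderiv P * Q - P * pderiv Q) * split_poly S = Q\<^sup>2 * T"
    using C.transcendental by fastforce
  then show ?thesis using residues_of_derivative[OF S(1) a \<open>Q \<noteq> 0\<close>] unfolding T_def by blast
qed

end

section \<open>Subfields of a field given as a type\<close>

abbreviation (input) type_ring :: "'a::field ring" where "type_ring \<equiv> ring_of_type_algebra"

lemma type_ring_simps [simp]:
  "carrier (type_ring :: 'a::field ring) = UNIV" "\<one>\<^bsub>type_ring :: 'a ring\<^esub> = 1" "\<zero>\<^bsub>type_ring :: 'a ring\<^esub> = 0"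
  "a \<otimes>\<^bsub>type_ring\<^esub> b = a * (b :: 'a)" "a \<oplus>\<^bsub>type_ring\<^esub> b = a + b"
  by (simp_all add: ring_of_type_algebra_def)

lemma type_ring_uminus [simp]: "\<ominus>\<^bsub>type_ring\<^esub> a = - (a :: 'a::field)"
proof -
  interpret field "type_ring :: 'a ring" by (rule field_from_type_algebra)
  show ?thesis using minus_equality[of "- a" a] by simp
qed

lemma type_ring_inverse [simp]:
  assumes "a \<noteq> 0"
  shows "inv\<^bsub>type_ring\<^esub> a = inverse (a :: 'a::field)"
proof -
  interpret field "type_ring :: 'a ring" by (rule field_from_type_algebra)
  show ?thesis using comm_inv_char[of a "inverse a"] assms by simp
qed

lemma type_ring_power [simp]: "a [^]\<^bsub>type_ring\<^esub> (n::nat) = (a :: 'a::field) ^ n"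
proof -
  interpret field "type_ring :: 'a ring" by (rule field_from_type_algebra)
  show ?thesis by (induction n) (simp_all add: mult.commute)
qed

lemma subfield_iff_subfield_set: "subfield F type_ring \<longleftrightarrow> subfield_set (F :: 'a::field set)"
proof
  interpret field "type_ring :: 'a ring" by (rule field_from_type_algebra)
  {
    assume F: "subfield F type_ring"
    note sub = subfieldE(1)[OF F]
    show "subfield_set F"
    proof
      show "0 \<in> F" using subringE(2)[OF sub] by simp
      show "1 \<in> F" using subringE(3)[OF sub] by simp
      show "a + b \<in> F" if "a \<in> F" "b \<in> F" for a b using subringE(7)[OF sub that] by simp
      show "a * b \<in> F" if "a \<in> F" "b \<in> F" for a b using subringE(6)[OF sub that] by simp
      show "- a \<in> F" if "a \<in> F" for a using subringE(5)[OF sub that] by simp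
      show "inverse a \<in> F" if "a \<in> F" for a
        using subfield_m_inv(1)[OF F, of a] that by (cases "a = 0") auto
    qed
  }
  {
    assume "subfield_set F"
    then interpret F: subfield_set F .
    show "subfield F type_ring"
    proof (rule subfieldI')
      show "subring F type_ring" by (rule subringI) auto
      show "inv\<^bsub>type_ring\<^esub> a \<in> F" if "a \<in> F - {\<zero>\<^bsub>type_ring\<^esub>}" for a
        using that by auto
    qed
  }
qed

lemma subfield_adjoin: "subfield_set (adjoin F A)"
proof -
  interpret field "type_ring :: 'a ring" by (rule field_from_type_algebra)
  show ?thesis unfolding adjoin_def
    by (subst subfield_iff_subfield_set[symmetric]) (rule generate_field_is_subfield, simp)
qed

lemma adjoin_incl: "F \<subseteq> adjoin F A" "A \<subseteq> adjoin F A"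
  unfolding adjoin_def by (auto intro: generate_field.incl)

lemma adjoin_minimal:
  assumes "subfield_set G" "F \<subseteq> G" "A \<subseteq> G"
  shows "adjoin F A \<subseteq> G"
proof -
  interpret field "type_ring :: 'a ring" by (rule field_from_type_algebra)
  show ?thesis unfolding adjoin_def
    by (rule generate_field_min_subfield1) (use assms in \<open>auto simp: subfield_iff_subfield_set\<close>)
qed

lemma subfield_ratfun: "subfield_set (ratfun k x i)"
  unfolding ratfun_def by (rule subfield_adjoin)

lemma ratfun_mono: "i \<le> j \<Longrightarrow> ratfun k x i \<subseteq> ratfun k x j"
  unfolding ratfun_def
proof (rule adjoin_minimal[OF subfield_adjoin adjoin_incl(1)])
  assume "i \<le> j"
  then have "x ` {1..i} \<subseteq> x ` {1..j}" by (intro image_mono) auto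
  then show "x ` {1..i} \<subseteq> adjoin k (x ` {1..j})" using adjoin_incl(2) by blast
qed

lemma ratfun_var: "1 \<le> i \<Longrightarrow> i \<le> j \<Longrightarrow> x i \<in> ratfun k x j"
  unfolding ratfun_def using adjoin_incl(2)[of "x ` {1..j}" k] by auto

lemma ratfun_base: "k \<subseteq> ratfun k x j"
  unfolding ratfun_def by (rule adjoin_incl)

lemma ratfun_Suc: "ratfun k x (Suc i) = rational_values (ratfun k x i) (x (Suc i))"
proof
  interpret F: subfield_set "ratfun k x i" by (rule subfield_ratfun)
  have const: "ratfun k x i \<subseteq> rational_values (ratfun k x i) (x (Suc i))"
  proof
    fix c assume "c \<in> ratfun k x i"
    then have "[:c:] \<in> F.FX" by auto
    from F.poly_value_rational[OF this, of "x (Suc i)"]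
    show "c \<in> rational_values (ratfun k x i) (x (Suc i))" by simp
  qed
  have "[:0, 1:] \<in> F.FX" by auto
  from F.poly_value_rational[OF this, of "x (Suc i)"]
  have "x (Suc i) \<in> rational_values (ratfun k x i) (x (Suc i))" by simp
  moreover have "x ` {1..Suc i} \<subseteq> insert (x (Suc i)) (ratfun k x i)"
    by (auto simp: le_Suc_eq intro: ratfun_var)
  ultimately have "x ` {1..Suc i} \<subseteq> rational_values (ratfun k x i) (x (Suc i))"
    using const by (meson insert_subset order_trans)
  then show "ratfun k x (Suc i) \<subseteq> rational_values (ratfun k x i) (x (Suc i))"
    unfolding ratfun_def[of k x "Suc i"]
    by (rule adjoin_minimal[OF F.subfield_rational_values order_trans[OF ratfun_base const]])
  show "rational_values (ratfun k x i) (x (Suc i)) \<subseteq> ratfun k x (Suc i)"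
    by (rule F.rational_values_minimal[OF subfield_ratfun ratfun_mono]) (auto intro: ratfun_var)
qed

lemma derivation_closed_adjoin:
  assumes "derivation d" "\<And>a. a \<in> F \<union> A \<Longrightarrow> d a \<in> adjoin F A" "f \<in> adjoin F A"
  shows "d f \<in> adjoin F A"
proof -
  interpret derivation d by fact
  interpret G: subfield_set "adjoin F A" by (rule subfield_adjoin)
  have "subfield_set {f \<in> adjoin F A. d f \<in> adjoin F A}"
  proof
    fix a assume a: "a \<in> {f \<in> adjoin F A. d f \<in> adjoin F A}"
    have "d (inverse a) = - d a * (inverse a * inverse a)"
      using derivation_divide[OF assms(1), of a 1]
      by (cases "a = 0") (auto simp: field_simps power2_eq_square)
    then show "inverse a \<in> {f \<in> adjoin F A. d f \<in> adjoin F A}" using a by auto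
  qed (auto simp: mult)
  then have "adjoin F A \<subseteq> {f \<in> adjoin F A. d f \<in> adjoin F A}"
    using adjoin_incl[of F A] adjoin_incl(2)[of A F] assms(2) by (intro adjoin_minimal) auto
  then show ?thesis using assms(3) by blast
qed

lemma derivation_zero_adjoin:
  assumes "derivation d" "\<And>a. a \<in> F \<union> A \<Longrightarrow> d a = 0" "f \<in> adjoin F A"
  shows "d f = 0"
  using adjoin_minimal[OF subfield_constants[OF assms(1)], of F A] assms(2,3) by auto

section \<open>Algebraic elements\<close>

lemma eval_type_ring: "ring.eval type_ring p x = poly (Poly (rev p)) (x :: 'a::field)"
proof -
  interpret field "type_ring :: 'a ring" by (rule field_from_type_algebra)
  show ?thesis by (induction p) (simp_all add: Poly_append poly_monom algebra_simps)
qed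

lemma mem_alg_closure_in_iff:
  assumes "subfield_set F"
  shows "c \<in> alg_closure_in F \<longleftrightarrow> (\<exists>P\<in>polys_over F. P \<noteq> 0 \<and> poly P c = 0)"
proof
  interpret field "type_ring :: 'a ring" by (rule field_from_type_algebra)
  interpret F: subfield_set F by fact
  have sub: "subring F type_ring"
    using assms by (intro subfieldE(1)) (simp add: subfield_iff_subfield_set)
  {
    assume "c \<in> alg_closure_in F"
    then have "(algebraic over F) c" by (simp add: alg_closure_in_def over_def)
    then obtain p where p: "p \<in> carrier (univ_poly type_ring F)" "p \<noteq> []" "eval p c = 0"
      using algebraicE[OF sub, of c] by auto
    then have p': "set p \<subseteq> F" "hd p \<noteq> 0"
      by (auto simp: univ_poly_carrier[symmetric] polynomial_def)
    have "poly.coeff (Poly (rev p)) (length p - 1) = hd p"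
      using p(2) by (simp add: coeff_Poly_eq nth_default_def rev_nth hd_conv_nth)
    then have "Poly (rev p) \<noteq> 0" using p'(2) by (metis coeff_0)
    moreover have "Poly (rev p) \<in> F.FX"
      using p'(1) by (auto simp: polys_over_def coeff_Poly_eq nth_default_def rev_nth subset_iff)
    ultimately show "\<exists>P\<in>F.FX. P \<noteq> 0 \<and> poly P c = 0"
      using p(3) by (auto simp: eval_type_ring)
  }
  {
    assume "\<exists>P\<in>F.FX. P \<noteq> 0 \<and> poly P c = 0"
    then obtain P where P: "P \<in> F.FX" "P \<noteq> 0" "poly P c = 0" by blast
    have "rev (coeffs P) \<in> carrier (univ_poly type_ring F)"
      using P(1,2) by (auto simp: univ_poly_carrier[symmetric] polynomial_def hd_rev last_coeffs_eq_coeff_degree polys_over_def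
          coeffs_def)
    moreover have "rev (coeffs P) \<noteq> []" using P(2) by simp
    moreover have "eval (rev (coeffs P)) c = 0" using P(3) by (simp add: eval_type_ring)
    ultimately have "(algebraic over F) c" using algebraicI by auto
    then show "c \<in> alg_closure_in F" by (simp add: alg_closure_in_def over_def)
  }
qed

lemma subfield_alg_closure_in:
  assumes "subfield_set F"
  shows "subfield_set (alg_closure_in F)"
proof -
  interpret field "type_ring :: 'a ring" by (rule field_from_type_algebra)
  have "alg_closure_in F = {c \<in> carrier type_ring. (algebraic over F) c}"
    by (auto simp: alg_closure_in_def over_def)
  then show ?thesis
    using subfield_of_algebraics[of F] assms by (simp add: subfield_iff_subfield_set)
qed

lemma alg_closure_in_incl:
  assumes "subfield_set F"
  shows "F \<subseteq> alg_closure_in F"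
proof
  interpret subfield_set F by fact
  fix c assume "c \<in> F"
  then show "c \<in> alg_closure_in F"
    unfolding mem_alg_closure_in_iff[OF assms] by (intro bexI[of _ "[:-c, 1:]"]) auto
qed

text \<open>
  Differentiate the relation of least degree.
\<close>

lemma derivation_algebraic:
  fixes d :: "'a::field_char_0 \<Rightarrow> 'a"
  assumes "derivation d" "subfield_set F" "\<And>a. a \<in> F \<Longrightarrow> d a = 0" "c \<in> alg_closure_in F"
  shows "d c = 0"
proof -
  interpret derivation d by fact
  interpret F: subfield_set_0 F using assms(2) by (simp add: subfield_set_0_def)
  define P where "P p \<longleftrightarrow> p \<in> F.FX \<and> p \<noteq> 0 \<and> poly p c = 0" for p
  obtain p0 where "P p0" using assms(4) mem_alg_closure_in_iff[OF assms(2)] by (auto simp: P_def)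
  then obtain p where p: "P p" "\<And>q. P q \<Longrightarrow> Polynomial.degree p \<le> Polynomial.degree q"
    using ex_has_least_nat[of P p0 Polynomial.degree] by blast
  have "Polynomial.degree p > 0"
    using p(1) by (auto simp: P_def elim!: degree_eq_zeroE intro!: Nat.gr0I)
  then have "pderiv p \<noteq> 0" "Polynomial.degree (pderiv p) < Polynomial.degree p"
    by (simp_all add: pderiv_eq_0_iff degree_pderiv)
  moreover have "pderiv p \<in> F.FX" using p(1) by (auto simp: P_def)
  ultimately have "poly (pderiv p) c \<noteq> 0" using p(2)[of "pderiv p"] by (auto simp: P_def)
  moreover have "d (poly p c) = poly (pderiv p) c * d c"
    using map_poly_polys_over_constants[of p F d, OF _ assms(3)] p(1) unfolding P_def poly_rule by simp
  ultimately show ?thesis using p(1) by (simp add: P_def)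
qed

lemma polys_in_eval:
  assumes "subfield_set F" "P \<in> polys_over F"
  shows "poly P t \<in> polys_in F t"
proof -
  interpret field "type_ring :: 'a ring" by (rule field_from_type_algebra)
  show ?thesis using assms(2)
  proof (induction P)
    case 0
    then show ?case using simple_extension.zero by (simp add: polys_in_def)
  next
    case (pCons a P)
    then show ?case
      using simple_extension.lin[of "poly P t" F t a]
      by (simp add: polys_in_def polys_over_pCons_iff mult.commute add.commute)
  qed
qed

lemma polys_in_subfield:
  assumes "subfield_set G" "F \<subseteq> G" "t \<in> G" "b \<in> polys_in F t"
  shows "b \<in> G"
proof -
  interpret field "type_ring :: 'a ring" by (rule field_from_type_algebra)
  interpret G: subfield_set G by fact
  show ?thesis using assms(4) unfolding polys_in_def
    by (induction rule: simple_extension.induct) (use assms(2,3) in auto)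
qed

section \<open>Injections into an infinite set\<close>

text \<open>
  Fix an injective pairing and elements \<open>a \<noteq> b\<close>. The empty list is coded by \<open>(a, a)\<close> and \<open>x # xs\<close> by
  \<open>(b, (x, y))\<close>, where \<open>y\<close> is the code of \<open>xs\<close>.
\<close>

lemma inj_list_into_infinite:
  assumes "infinite (UNIV :: 'a set)"
  shows "\<exists>f :: 'a list \<Rightarrow> 'a. inj f"
proof -
  obtain pr :: "'a \<times> 'a \<Rightarrow> 'a" where pr: "inj pr"
    using card_of_Times_same_infinite[OF assms] card_of_ordIso[of "UNIV \<times> UNIV" "UNIV :: 'a set"]
    by (auto simp: bij_betw_def)
  obtain a b :: 'a where ab: "a \<noteq> b"
    using assms by (metis (full_types) finite.simps UNIV_eq_I finite.insertI insertCI)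
  define f :: "'a list \<Rightarrow> 'a" where "f xs = rec_list (pr (a, a)) (\<lambda>x _ y. pr (b, pr (x, y))) xs" for xs
  have f: "f [] = pr (a, a)" "f (x # xs) = pr (b, pr (x, f xs))" for x xs
    by (simp_all add: f_def)
  have "f xs = f ys \<Longrightarrow> xs = ys" for xs ys
  proof (induction xs arbitrary: ys)
    case Nil
    then show ?case using ab by (cases ys) (auto simp: f dest: injD[OF pr])
  next
    case (Cons x xs)
    then show ?case using ab by (cases ys) (auto simp: f dest!: injD[OF pr])
  qed
  then show ?thesis by (auto simp: inj_def)
qed

lemma inj_poly_into_infinite:
  assumes "infinite (UNIV :: 'a::zero set)"
  shows "\<exists>f :: 'a poly \<Rightarrow> 'a. inj f"
proof -
  obtain f :: "'a list \<Rightarrow> 'a" where "inj f" using inj_list_into_infinite[OF assms] by blast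
  moreover have "inj (coeffs :: 'a poly \<Rightarrow> _)" by (simp add: inj_def coeffs_eq_iff)
  ultimately show ?thesis using inj_compose by blast
qed

lemma inj_fract_into_infinite:
  assumes "infinite (UNIV :: 'a::idom set)"
  shows "\<exists>f :: 'a fract \<Rightarrow> 'a. inj f"
proof -
  obtain f :: "'a list \<Rightarrow> 'a" where f: "inj f" using inj_list_into_infinite[OF assms] by blast
  define g :: "'a fract \<Rightarrow> 'a list" where
    "g q = (let (a, b) = (SOME (a, b). q = Fract a b) in [a, b])" for q
  have g: "\<exists>a b. g q = [a, b] \<and> q = Fract a b" for q
  proof -
    obtain a b where "q = Fract a b" by (cases q)
    then have "case (SOME (a, b). q = Fract a b) of (a, b) \<Rightarrow> q = Fract a b"
      by (intro someI[of "\<lambda>(a, b). q = Fract a b" "(a, b)"]) simp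
    then show ?thesis by (auto simp: g_def Let_def split: prod.splits)
  qed
  have "inj g"
  proof (rule injI)
    fix p q assume "g p = g q"
    then show "p = q" using g[of p] g[of q] by auto
  qed
  then show ?thesis using inj_compose[OF f] by blast
qed

section \<open>Differential equations over a universal extension\<close>

lemma dpoly_over_mono: "dpoly_over m K n e \<Longrightarrow> n \<le> n' \<Longrightarrow> dpoly_over m K n' e"
  by (induction e) auto

lemma dpoly_eval_cong:
  "dpoly_over m K n e \<Longrightarrow> (\<And>j. j < n \<Longrightarrow> y j = z j) \<Longrightarrow> dpoly_eval R D \<phi> y e = dpoly_eval R D \<phi> z e"
  by (induction e) auto

lemma dpoly_eval_closed:
  assumes "differential_extension m K \<delta> R D \<psi>" "dpoly_over m (carrier K) n e" "\<And>j. j < n \<Longrightarrow> y j \<in> carrier R"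
  shows "dpoly_eval R D \<psi> y e \<in> carrier R"
proof -
  interpret field R using assms(1) by (simp add: differential_extension_def differential_field_def)
  show ?thesis using assms
    by (induction e)
       (auto simp: differential_extension_def differential_field_def derivation_on_def ring_hom_def Pi_iff)
qed

lemma differential_extension_restrict:
  assumes "differential_extension m type_ring \<delta> R D \<psi>"
  shows "differential_extension m (type_ring\<lparr>carrier := K\<rparr>) \<delta> R D \<psi>"
  using assms by (auto simp: differential_extension_def ring_hom_def)

text \<open>
  Universality refers to extensions whose carrier is a subset of a fixed type. An extension of any type
  can be moved there along an injection.
\<close>

lemma differential_extension_image:
  assumes ext: "differential_extension m K \<delta> R D \<psi>" and f: "inj_on f (carrier R)"
  defines "D' \<equiv> \<lambda>i a. f (D i (inv_into (carrier R) f a))"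
  shows "differential_extension m K \<delta> (image_ring f R) D' (f \<circ> \<psi>)"
    and "\<lbrakk>dpoly_over m (carrier K) n e; \<And>j. j < n \<Longrightarrow> y j \<in> carrier R\<rbrakk> \<Longrightarrow>
      dpoly_eval (image_ring f R) D' (f \<circ> \<psi>) (f \<circ> y) e = f (dpoly_eval R D \<psi> y e)"
proof -
  have fld: "field R" and der: "\<And>i. i \<in> {1..m} \<Longrightarrow> derivation_on R (D i)"
    and comm: "\<And>i j a. i \<in> {1..m} \<Longrightarrow> j \<in> {1..m} \<Longrightarrow> a \<in> carrier R \<Longrightarrow> D i (D j a) = D j (D i a)"
    and hom: "\<psi> \<in> ring_hom K R" and \<psi>: "\<And>i a. i \<in> {1..m} \<Longrightarrow> a \<in> carrier K \<Longrightarrow> \<psi> (\<delta> i a) = D i (\<psi> a)"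
    using ext by (auto simp: differential_extension_def differential_field_def)
  interpret field R by fact
  have iso: "f \<in> ring_iso R (image_ring f R)" using f by (rule inj_imp_image_ring_iso)
  note isoE = ring_iso_memE[OF iso]
  have D'[simp]: "D' i (f a) = f (D i a)" if "a \<in> carrier R" for i a
    using that f by (simp add: D'_def)
  have cl: "D i a \<in> carrier R" if "i \<in> {1..m}" "a \<in> carrier R" for i a
    using der[OF that(1)] that(2) by (auto simp: derivation_on_def)
  show "differential_extension m K \<delta> (image_ring f R) D' (f \<circ> \<psi>)"
    unfolding differential_extension_def differential_field_def
  proof (intro conjI ballI)
    show "field (image_ring f R)" using f by (rule inj_imp_image_ring_is_field)
    show "derivation_on (image_ring f R) (D' i)" if i: "i \<in> {1..m}" for i
      unfolding derivation_on_def image_ring_carrier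
    proof (intro conjI ballI)
      show "D' i \<in> f ` carrier R \<rightarrow> f ` carrier R" using cl[OF i] by auto
      fix a b assume "a \<in> f ` carrier R" "b \<in> f ` carrier R"
      then obtain a' b' where ab: "a = f a'" "b = f b'" "a' \<in> carrier R" "b' \<in> carrier R" by blast
      show "D' i (a \<oplus>\<^bsub>image_ring f R\<^esub> b) = D' i a \<oplus>\<^bsub>image_ring f R\<^esub> D' i b"
        using ab der[OF i] cl[OF i] by (simp add: derivation_on_def flip: isoE(3))
      show "D' i (a \<otimes>\<^bsub>image_ring f R\<^esub> b) =
          D' i a \<otimes>\<^bsub>image_ring f R\<^esub> b \<oplus>\<^bsub>image_ring f R\<^esub> a \<otimes>\<^bsub>image_ring f R\<^esub> D' i b"
        using ab der[OF i] cl[OF i] by (simp add: derivation_on_def flip: isoE(2,3))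
    qed
    show "D' i (D' j a) = D' j (D' i a)"
      if "i \<in> {1..m}" "j \<in> {1..m}" "a \<in> carrier (image_ring f R)" for i j a
      using that cl comm by (auto simp: image_ring_carrier)
    show "f \<circ> \<psi> \<in> ring_hom K (image_ring f R)"
      using iso hom ring_hom_trans by (auto simp: ring_iso_def)
    show "(f \<circ> \<psi>) (\<delta> i a) = D' i ((f \<circ> \<psi>) a)" if "i \<in> {1..m}" "a \<in> carrier K" for i a
      using that \<psi> hom by (simp add: ring_hom_closed)
  qed
  assume e: "dpoly_over m (carrier K) n e" and y: "\<And>j. j < n \<Longrightarrow> y j \<in> carrier R"
  have *: "dpoly_eval R D \<psi> y e \<in> carrier R" if "dpoly_over m (carrier K) n e" for e
    using dpoly_eval_closed[OF ext that y] .
  show "dpoly_eval (image_ring f R) D' (f \<circ> \<psi>) (f \<circ> y) e = f (dpoly_eval R D \<psi> y e)"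
    using e
  proof (induction e)
    case (Plus e1 e2)
    then show ?case by (simp add: isoE(3) *)
  next
    case (Times e1 e2)
    then show ?case by (simp add: isoE(2) *)
  next
    case (Deriv i e)
    then show ?case by (simp add: *)
  qed auto
qed

text \<open>
  The product expresses by one inequation that none of finitely many differential polynomials vanishes.
\<close>

primrec dpoly_product :: "'a::one dpoly list \<Rightarrow> 'a dpoly" where
  "dpoly_product [] = Coeff 1"
| "dpoly_product (e # es) = Times e (dpoly_product es)"

lemma dpoly_over_dpoly_product: "1 \<in> K \<Longrightarrow> (\<And>e. e \<in> set es \<Longrightarrow> dpoly_over m K n e) \<Longrightarrow> dpoly_over m K n (dpoly_product es)"
  by (induction es) auto

lemma dpoly_eval_dpoly_product:
  assumes "domain R" "\<phi> 1 = \<one>\<^bsub>R\<^esub>" "\<And>e. e \<in> set es \<Longrightarrow> dpoly_eval R D \<phi> y e \<in> carrier R"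
  shows "dpoly_eval R D \<phi> y (dpoly_product es) \<in> carrier R \<and>
       (dpoly_eval R D \<phi> y (dpoly_product es) = \<zero>\<^bsub>R\<^esub> \<longleftrightarrow> (\<exists>e\<in>set es. dpoly_eval R D \<phi> y e = \<zero>\<^bsub>R\<^esub>))"
proof -
  interpret domain R by fact
  show ?thesis using assms(2,3) by (induction es) (auto simp: integral_iff)
qed

text \<open>
  An inequation \<open>g \<noteq> 0\<close> is the equation \<open>g z = 1\<close> in one more unknown \<open>z\<close>, so universality also applies to
  finitely many inequations. Here \<open>R\<close> extends all of \<open>'u\<close>, but only relations over \<open>K\<close> are transferred: the
  part of \<open>y\<close> that comes from \<open>'u\<close> is in general replaced by other elements with the same relations.
\<close>

lemma universal_realization:
  fixes K :: "'u::field_char_0 set" and R :: "('b, 'c) ring_scheme" and f :: "'b \<Rightarrow> 'u"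
  assumes univ: "universal_over m K \<delta>" and K: "subfield_set K"
    and ext: "differential_extension m type_ring \<delta> R D \<psi>" and f: "inj_on f (carrier R)"
    and y: "\<And>j. j < n \<Longrightarrow> y j \<in> carrier R"
    and N: "finite N" "\<forall>e\<in>N. dpoly_over m K n e" "\<forall>e\<in>N. dpoly_eval R D \<psi> y e \<noteq> \<zero>\<^bsub>R\<^esub>"
  shows "\<exists>z. (\<forall>e. dpoly_over m K n e \<longrightarrow> dpoly_eval R D \<psi> y e = \<zero>\<^bsub>R\<^esub> \<longrightarrow> dpoly_eval type_ring \<delta> id z e = 0) \<and>
    (\<forall>e\<in>N. dpoly_eval type_ring \<delta> id z e \<noteq> 0)"
proof -
  interpret K: subfield_set K by fact
  have extK: "differential_extension m (type_ring\<lparr>carrier := K\<rparr>) \<delta> R D \<psi>"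
    using ext by (rule differential_extension_restrict)
  interpret R: field R using ext by (simp add: differential_extension_def differential_field_def)
  have hom: "\<psi> \<in> ring_hom type_ring R" using ext by (simp add: differential_extension_def)
  have \<psi>1: "\<psi> 1 = \<one>\<^bsub>R\<^esub>" using ring_hom_one[OF hom] by simp
  have \<psi>m1: "\<psi> (- 1) = \<ominus>\<^bsub>R\<^esub> \<one>\<^bsub>R\<^esub>"
  proof -
    have "\<psi> (-1) \<oplus>\<^bsub>R\<^esub> \<psi> 1 = \<psi> 0" using ring_hom_add[OF hom, of "-1" 1] by simp
    moreover have "\<psi> 0 \<oplus>\<^bsub>R\<^esub> \<psi> 0 = \<psi> 0" using ring_hom_add[OF hom, of 0 0] by simp
    moreover have "\<psi> a \<in> carrier R" for a using ring_hom_closed[OF hom, of a] by simp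
    ultimately show ?thesis by (metis R.minus_equality R.one_closed R.add.r_cancel_one \<psi>1)
  qed
  obtain es where es: "set es = N" using finite_list[OF N(1)] by blast
  define g where "g = dpoly_product es"
  have g: "dpoly_over m K n g" unfolding g_def using N(2) es by (intro dpoly_over_dpoly_product) auto
  have "dpoly_eval R D \<psi> y e \<in> carrier R" if "dpoly_over m K n e" for e
    using dpoly_eval_closed[OF extK _ y] that by simp
  then have gR: "dpoly_eval R D \<psi> y g \<in> carrier R" "dpoly_eval R D \<psi> y g \<noteq> \<zero>\<^bsub>R\<^esub>"
    using dpoly_eval_dpoly_product[of R \<psi> es D y] R.domain_axioms \<psi>1 N es by (auto simp: g_def)
  define y' where "y' = y(n := inv\<^bsub>R\<^esub> dpoly_eval R D \<psi> y g)"
  have inv: "inv\<^bsub>R\<^esub> dpoly_eval R D \<psi> y g \<in> carrier R" using gR by (simp add: R.field_Units)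
  have y': "y' j \<in> carrier R" if "j < Suc n" for j
    using y that inv by (auto simp: y'_def less_Suc_eq)
  have ev: "dpoly_eval R D \<psi> y' e = dpoly_eval R D \<psi> y e" if "dpoly_over m K n e" for e
    by (rule dpoly_eval_cong[OF that]) (simp add: y'_def)
  \<comment> \<open>The additional unknown \<open>n\<close> is the inverse of \<open>g\<close>.\<close>
  define h where "h = Plus (Times g (Unknown n)) (Coeff (- 1))"
  define S where "S = insert h {e. dpoly_over m K n e \<and> dpoly_eval R D \<psi> y e = \<zero>\<^bsub>R\<^esub>}"
  have "dpoly_eval R D \<psi> y' h = \<zero>\<^bsub>R\<^esub>"
    using gR inv \<psi>m1 by (simp add: h_def ev[OF g]) (simp add: y'_def R.field_Units R.r_neg)
  then have S0: "dpoly_eval R D \<psi> y' e = \<zero>\<^bsub>R\<^esub>" if "e \<in> S" for e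
    using that ev by (auto simp: S_def)
  have Sover: "dpoly_over m K (Suc n) e" if "e \<in> S" for e
    using that dpoly_over_mono[of m K n _ "Suc n"] g K.uminus[OF K.one] by (auto simp: S_def h_def)
  have f0: "\<zero>\<^bsub>image_ring f R\<^esub> = f \<zero>\<^bsub>R\<^esub>" by (rule image_ring_zero)
  have "solvable_in (Suc n) (image_ring f R) (\<lambda>i a. f (D i (inv_into (carrier R) f a))) (f \<circ> \<psi>) S"
    unfolding solvable_in_def
  proof (intro exI[of _ "f \<circ> y'"] conjI allI impI ballI)
    show "(f \<circ> y') j \<in> carrier (image_ring f R)" if "j < Suc n" for j
      using y'[OF that] by (simp add: image_ring_carrier)
    show "dpoly_eval (image_ring f R) (\<lambda>i a. f (D i (inv_into (carrier R) f a))) (f \<circ> \<psi>) (f \<circ> y') e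
        = \<zero>\<^bsub>image_ring f R\<^esub>" if "e \<in> S" for e
      using differential_extension_image(2)[OF extK f _ y', of "Suc n" e] Sover[OF that] S0[OF that] f0 by simp
  qed
  then have "solvable_in (Suc n) type_ring \<delta> id S"
    using univ[unfolded universal_over_def, rule_format, of S "Suc n" "image_ring f R"
        "\<lambda>i a. f (D i (inv_into (carrier R) f a))" "f \<circ> \<psi>"]
      differential_extension_image(1)[OF extK f] Sover by blast
  then obtain z where z: "\<And>e. e \<in> S \<Longrightarrow> dpoly_eval type_ring \<delta> id z e = 0"
    by (auto simp: solvable_in_def)
  have "dpoly_eval type_ring \<delta> id z g \<noteq> 0" using z[of h] by (auto simp: S_def h_def)
  moreover have "domain (type_ring :: 'u ring)"
    using field_from_type_algebra by (rule field.axioms)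
  ultimately have "dpoly_eval type_ring \<delta> id z e \<noteq> 0" if "e \<in> N" for e
    using dpoly_eval_dpoly_product[of type_ring id es \<delta> z] that es by (auto simp: g_def)
  then show ?thesis using z by (auto simp: S_def)
qed

section \<open>Differential extensions by a root and by a logarithm\<close>

definition diff_field_type :: "nat \<Rightarrow> (nat \<Rightarrow> 'a::field \<Rightarrow> 'a) \<Rightarrow> bool" where
  "diff_field_type m \<delta> \<longleftrightarrow> (\<forall>i\<in>{1..m}. derivation (\<delta> i)) \<and>
     (\<forall>i\<in>{1..m}. \<forall>j\<in>{1..m}. \<forall>a. \<delta> i (\<delta> j a) = \<delta> j (\<delta> i a))"

lemma differential_field_type_iff: "differential_field m type_ring \<delta> \<longleftrightarrow> diff_field_type m \<delta>"
  by (auto simp: differential_field_def derivation_on_def diff_field_type_def derivation_def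
      field_from_type_algebra)

text \<open>
  The residue classes modulo \<open>P\<close> are represented by the remainders.
\<close>

definition residue_field :: "'a::field poly \<Rightarrow> 'a poly ring" where
  "residue_field P = \<lparr>carrier = range (\<lambda>g. g mod P), monoid.mult = (\<lambda>a b. (a * b) mod P),
      one = 1 mod P, ring.zero = 0, add = (+)\<rparr>"

lemma residue_field_simps [simp]:
  "a \<otimes>\<^bsub>residue_field P\<^esub> b = (a * b) mod P" "\<one>\<^bsub>residue_field P\<^esub> = 1 mod P"
  "\<zero>\<^bsub>residue_field P\<^esub> = 0" "a \<oplus>\<^bsub>residue_field P\<^esub> b = a + b"
  by (simp_all add: residue_field_def)

lemma mem_residue_field: "a \<in> carrier (residue_field P) \<longleftrightarrow> a mod P = a"
  by (auto simp: residue_field_def) (metis rangeI)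

lemma residue_field_is_field:
  fixes P :: "'a::field poly"
  assumes P: "Polynomial.degree P > 0" and inv: "\<And>g. \<not> P dvd g \<Longrightarrow> \<exists>u v. u * P + v * g = 1"
  shows "field (residue_field P)"
proof -
  have one: "1 mod P = 1" using P by (simp add: mod_poly_less)
  have "cring (residue_field P)"
  proof (intro cringI abelian_groupI comm_monoidI)
    fix x assume x: "x \<in> carrier (residue_field P)"
    then have "- x \<in> carrier (residue_field P)" by (simp add: mem_residue_field poly_mod_minus_left)
    then show "\<exists>y\<in>carrier (residue_field P). y \<oplus>\<^bsub>residue_field P\<^esub> x = \<zero>\<^bsub>residue_field P\<^esub>"
      by (intro bexI[of _ "- x"]) auto
  qed (auto simp: mem_residue_field poly_mod_add_left mod_mult_left_eq mod_mult_right_eq one mult_ac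
      algebra_simps)
  then show ?thesis
  proof (rule cring.cring_fieldI2)
    show "\<zero>\<^bsub>residue_field P\<^esub> \<noteq> \<one>\<^bsub>residue_field P\<^esub>" by (simp add: one)
    fix a assume a: "a \<in> carrier (residue_field P)" "a \<noteq> \<zero>\<^bsub>residue_field P\<^esub>"
    then have "\<not> P dvd a" by (auto simp: mem_residue_field mod_eq_0_iff_dvd[symmetric])
    then obtain u v where uv: "u * P + v * a = 1" using inv by blast
    have "(a * (v mod P)) mod P = (v * a) mod P" by (simp add: mod_mult_right_eq mult.commute)
    also have "v * a = 1 - u * P" by (simp flip: uv)
    also have "(1 - u * P) mod P = 1" using one by (simp add: poly_mod_diff_left)
    finally show "\<exists>b\<in>carrier (residue_field P). a \<otimes>\<^bsub>residue_field P\<^esub> b = \<one>\<^bsub>residue_field P\<^esub>"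
      using one by (intro bexI[of _ "v mod P"]) (simp_all add: mem_residue_field)
  qed
qed

text \<open>
  Differentiating \<open>P(y) = 0\<close> forces the derivatives of the root \<open>y\<close>: they are represented by polynomials
  \<open>w i\<close> for which the twisted derivation maps \<open>P\<close> to a multiple of \<open>P\<close>, and so passes to the residue
  classes. The commutator of two of these derivations is a multiple of \<open>pderiv\<close>. It maps \<open>P\<close> to a multiple
  of \<open>P\<close>, and as \<open>pderiv P\<close> is invertible modulo \<open>P\<close>, the factor vanishes modulo \<open>P\<close>.
\<close>

lemma residue_field_differential_extension:
  fixes P :: "'a::field_char_0 poly"
  assumes \<delta>: "diff_field_type m \<delta>"
    and P: "Polynomial.degree P > 0" "\<And>g. \<not> P dvd g \<Longrightarrow> \<exists>u v. u * P + v * g = 1"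
  obtains D where "differential_extension m type_ring \<delta> (residue_field P) D (\<lambda>a. [:a:])"
proof -
  interpret U: subfield_set_0 "UNIV :: 'a set" by unfold_locales auto
  obtain u v where uv: "u * P + v * pderiv P = 1" using P(2)[OF U.pderiv_not_dvd[OF P(1)]] by blast
  \<comment> \<open>\<open>v\<close> is the inverse of \<open>pderiv P\<close> modulo \<open>P\<close>.\<close>
  define w where "w i = - v * map_poly (\<delta> i) P" for i
  define T where "T i = twist (\<delta> i) (w i)" for i
  have der: "derivation (\<delta> i)" "derivation (T i)" if "i \<in> {1..m}" for i
    using \<delta> that derivation.derivation_twist[of "\<delta> i"] by (auto simp: diff_field_type_def T_def)
  have TP: "P dvd T i P" for i
  proof -
    have "T i P = map_poly (\<delta> i) P * (1 - v * pderiv P)"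
      by (simp add: T_def twist_def w_def algebra_simps)
    also have "1 - v * pderiv P = u * P" by (simp flip: uv)
    finally show ?thesis by simp
  qed
  have Tmul: "P dvd T i (P * q)" if "i \<in> {1..m}" for i q
    using TP[of i] by (simp add: derivation.mult[OF der(2)[OF that]])
  have Tmod: "T i (g mod P) mod P = T i g mod P" if "i \<in> {1..m}" for i g
  proof -
    have "T i g = T i (P * (g div P)) + T i (g mod P)"
      by (simp flip: derivation.add[OF der(2)[OF that]])
    moreover have "T i (P * (g div P)) mod P = 0" using Tmul[OF that] by (simp add: mod_eq_0_iff_dvd)
    ultimately show ?thesis by (simp add: poly_mod_add_left)
  qed
  have comm: "P dvd T i (T j g) - T j (T i g)" if ij: "i \<in> {1..m}" "j \<in> {1..m}" for i j g
  proof -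
    have c: "T i (T j g) - T j (T i g) = (T i (w j) - T j (w i)) * pderiv g" for g
      unfolding T_def using \<delta> ij by (intro twist_commutator der) (auto simp: diff_field_type_def)
    obtain q r where "T j P = P * q" "T i P = P * r" using TP by (meson dvdE)
    then have "P dvd T i (T j P) - T j (T i P)" using Tmul ij by auto
    then have "P dvd (T i (w j) - T j (w i)) * pderiv P" by (simp only: c)
    then have "P dvd (T i (w j) - T j (w i)) * u * P + v * ((T i (w j) - T j (w i)) * pderiv P)"
      by (intro dvd_add[OF dvd_triv_right] dvd_mult[of P "(T i (w j) - T j (w i)) * pderiv P"])
    also have "\<dots> = (T i (w j) - T j (w i)) * (u * P + v * pderiv P)" by (simp only: algebra_simps)
    finally have "P dvd T i (w j) - T j (w i)" by (simp add: uv)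
    then show ?thesis unfolding c by simp
  qed
  have "differential_extension m type_ring \<delta> (residue_field P) (\<lambda>i g. T i g mod P) (\<lambda>a. [:a:])"
    unfolding differential_extension_def differential_field_def
  proof (intro conjI ballI)
    show "field (residue_field P)" using P by (rule residue_field_is_field)
    show "derivation_on (residue_field P) (\<lambda>g. T i g mod P)" if i: "i \<in> {1..m}" for i
    proof -
      have "T i (a * b mod P) mod P = ((T i a mod P) * b mod P + a * (T i b mod P) mod P)" for a b
        by (simp add: Tmod[OF i] derivation.mult[OF der(2)[OF i]] poly_mod_add_left mod_mult_left_eq mod_mult_right_eq)
      then show ?thesis
        by (auto simp: derivation_on_def mem_residue_field derivation.add[OF der(2)[OF i]] poly_mod_add_left)
    qed
    show "T i (T j a mod P) mod P = T j (T i a mod P) mod P" if "i \<in> {1..m}" "j \<in> {1..m}" for i j a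
      using comm[OF that, of a] that by (simp add: Tmod mod_eq_dvd_iff)
    have *: "[:a:] mod P = [:a:]" for a using P(1) by (simp add: mod_poly_less)
    then have "1 mod P = 1" by (metis one_pCons)
    with * show "(\<lambda>a. [:a:]) \<in> ring_hom type_ring (residue_field P)"
      by (auto simp: ring_hom_def mem_residue_field one_pCons)
    show "[:\<delta> i a:] = T i [:a:] mod P" if "i \<in> {1..m}" for i a
      by (simp add: T_def derivation.twist_const[OF der(1)[OF that]] *)
  qed
  then show thesis by (rule that)
qed

text \<open>
  The quotient rule gives the same value for all representations of a fraction.
\<close>

lemma derivation_fract:
  fixes d :: "'a::idom \<Rightarrow> 'a"
  assumes "derivation d"
  obtains E where "derivation E" "\<And>a. E (Fract a 1) = Fract (d a) 1"
proof -
  interpret derivation d by fact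
  define rep where "rep q = (SOME p. snd p \<noteq> 0 \<and> q = Fract (fst p) (snd p))" for q :: "'a fract"
  define E where "E q = (case rep q of (a, b) \<Rightarrow> Fract (d a * b - a * d b) (b * b))" for q
  have E: "E (Fract a b) = Fract (d a * b - a * d b) (b * b)" if b: "b \<noteq> 0" for a b
  proof -
    have "snd (rep (Fract a b)) \<noteq> 0 \<and> Fract a b = Fract (fst (rep (Fract a b))) (snd (rep (Fract a b)))"
      unfolding rep_def by (rule someI[of _ "(a, b)"]) (use b in simp)
    then obtain a' b' where r: "rep (Fract a b) = (a', b')" "b' \<noteq> 0" "Fract a b = Fract a' b'"
      by (cases "rep (Fract a b)") auto
    then have eq: "a * b' = a' * b" using b by (simp add: eq_fract)
    then have "d (a * b') = d (a' * b)" by simp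
    then have deq: "d a * b' + a * d b' = d a' * b + a' * d b" by (simp add: mult)
    have "(d a' * b' - a' * d b') * (b * b) - (d a * b - a * d b) * (b' * b')
        = (d a' * b + a' * d b - (d a * b' + a * d b')) * (b * b')
          + (a * b' - a' * b) * (d b * b' + d b' * b)"
      by (simp add: algebra_simps)
    also have "\<dots> = 0" by (simp add: eq deq)
    finally have "(d a' * b' - a' * d b') * (b * b) = (d a * b - a * d b) * (b' * b')" by simp
    then show ?thesis using b r(2) by (simp add: E_def r(1) eq_fract)
  qed
  have "derivation E"
  proof
    fix p q :: "'a fract"
    obtain a b where p: "p = Fract a b" "b \<noteq> 0" by (rule Fract_cases)
    obtain a' b' where q: "q = Fract a' b'" "b' \<noteq> 0" by (rule Fract_cases)
    show "E (p + q) = E p + E q" using p q by (simp add: E eq_fract mult) (simp add: algebra_simps)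
    show "E (p * q) = E p * q + p * E q" using p q by (simp add: E eq_fract mult) (simp add: algebra_simps)
  qed
  then show thesis using that[of E] E by simp
qed

text \<open>
  It follows that derivations of a fraction field commute if they commute on the ring.
\<close>

lemma derivations_commute_subfield:
  fixes d e :: "'a::field \<Rightarrow> 'a"
  assumes "derivation d" "derivation e"
  shows "subfield_set {a. d (e a) = e (d a)}"
proof -
  interpret d: derivation d by fact
  interpret e: derivation e by fact
  have inv: "d (inverse a) = - d a * (inverse a * inverse a)" "e (inverse a) = - e a * (inverse a * inverse a)"
    if "a \<noteq> 0" for a
    using derivation_divide[OF assms(1), of a 1] derivation_divide[OF assms(2), of a 1] that
    by (simp_all add: field_simps power2_eq_square)
  show ?thesis
  proof
    fix a assume "a \<in> {a. d (e a) = e (d a)}"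
    then show "inverse a \<in> {a. d (e a) = e (d a)}"
      by (cases "a = 0") (auto simp: inv d.mult e.mult algebra_simps)
  qed (auto simp: d.mult e.mult algebra_simps)
qed

text \<open>
  The indeterminate becomes an element with the prescribed derivatives \<open>w i\<close>. The hypothesis on \<open>w\<close> makes
  the commutators of the twisted derivations vanish.
\<close>

lemma fract_differential_extension:
  fixes \<delta> :: "nat \<Rightarrow> 'a::field_char_0 \<Rightarrow> 'a" and w :: "nat \<Rightarrow> 'a"
  assumes \<delta>: "diff_field_type m \<delta>"
    and w: "\<And>i j. i \<in> {1..m} \<Longrightarrow> j \<in> {1..m} \<Longrightarrow> \<delta> i (w j) = \<delta> j (w i)"
  obtains D t where "differential_extension m type_ring \<delta> (type_ring :: 'a poly fract ring) D (\<lambda>a. Fract [:a:] 1)"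
    "\<And>i. i \<in> {1..m} \<Longrightarrow> D i t = Fract [:w i:] 1"
proof -
  define T where "T i = twist (\<delta> i) [:w i:]" for i
  have der: "derivation (\<delta> i)" "derivation (T i)" if "i \<in> {1..m}" for i
    using \<delta> that derivation.derivation_twist[of "\<delta> i"] by (auto simp: diff_field_type_def T_def)
  have "\<forall>i. \<exists>E. i \<in> {1..m} \<longrightarrow> derivation E \<and> (\<forall>a. E (Fract a 1) = Fract (T i a) 1)"
    using derivation_fract[OF der(2)] by metis
  then obtain E where E: "\<And>i. i \<in> {1..m} \<Longrightarrow> derivation (E i)"
    "\<And>i a. i \<in> {1..m} \<Longrightarrow> E i (Fract a 1) = Fract (T i a) 1" by metis
  have T: "T i (T j g) = T j (T i g)" if ij: "i \<in> {1..m}" "j \<in> {1..m}" for i j g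
  proof -
    have "T i (T j g) - T j (T i g) = (T i [:w j:] - T j [:w i:]) * pderiv g"
      unfolding T_def using \<delta> ij by (intro twist_commutator der) (auto simp: diff_field_type_def)
    also have "T i [:w j:] - T j [:w i:] = 0"
      using w ij by (simp add: T_def derivation.twist_const[OF der(1)])
    finally show ?thesis by simp
  qed
  have comm: "E i (E j q) = E j (E i q)" if ij: "i \<in> {1..m}" "j \<in> {1..m}" for i j q
  proof -
    interpret S: subfield_set "{a. E i (E j a) = E j (E i a)}"
      by (rule derivations_commute_subfield) (use E ij in auto)
    have *: "Fract a 1 \<in> {a. E i (E j a) = E j (E i a)}" for a using E(2) ij T by simp
    obtain a b where q: "q = Fract a b" "b \<noteq> 0" by (rule Fract_cases)
    then have "q = Fract a 1 / Fract b 1" by simp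
    then show ?thesis using S.divide[OF *[of a] *[of b]] by simp
  qed
  have "differential_extension m type_ring \<delta> type_ring E (\<lambda>a. Fract [:a:] 1)"
    unfolding differential_extension_def differential_field_type_iff
  proof (intro conjI ballI)
    show "diff_field_type m E" using E comm by (auto simp: diff_field_type_def)
    show "(\<lambda>a. Fract [:a:] 1) \<in> ring_hom type_ring (type_ring :: 'a poly fract ring)"
      by (auto simp: ring_hom_def One_fract_def one_pCons mult.commute)
    show "Fract [:\<delta> i a:] 1 = E i (Fract [:a:] 1)" if "i \<in> {1..m}" for i a
      using that E(2) by (simp add: T_def derivation.twist_const[OF der(1)[OF that]])
  qed
  moreover have "E i (Fract [:0, 1:] 1) = Fract [:w i:] 1" if "i \<in> {1..m}" for i
    using E(2)[OF that] by (simp add: T_def derivation.twist_X[OF der(1)[OF that]])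
  ultimately show thesis by (rule that)
qed

section \<open>Roots and logarithms in a universal extension\<close>

text \<open>
  Horner's scheme for \<open>P\<close> in the unknown \<open>j\<close>.
\<close>

definition dpoly_of :: "nat \<Rightarrow> 'a poly \<Rightarrow> 'a::zero dpoly" where
  "dpoly_of j P = foldr (\<lambda>a e. Plus (Coeff a) (Times (Unknown j) e)) (coeffs P) (Coeff 0)"

lemma dpoly_of_0 [simp]: "dpoly_of j 0 = Coeff 0"
  by (simp add: dpoly_of_def)

lemma dpoly_of_pCons: "a \<noteq> 0 \<or> P \<noteq> 0 \<Longrightarrow>
    dpoly_of j (pCons a P) = Plus (Coeff a) (Times (Unknown j) (dpoly_of j P))"
  by (auto simp: dpoly_of_def cCons_def)

lemma dpoly_over_dpoly_of: "0 \<in> K \<Longrightarrow> P \<in> polys_over K \<Longrightarrow> j < n \<Longrightarrow> dpoly_over m K n (dpoly_of j P)"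
  by (induction P) (auto simp: dpoly_of_pCons polys_over_pCons_iff)

lemma dpoly_eval_dpoly_of_type:
  fixes \<phi> :: "'a::field \<Rightarrow> 'b::field"
  assumes "\<phi> 0 = 0"
  shows "dpoly_eval type_ring D \<phi> y (dpoly_of j P) = poly (map_poly \<phi> P) (y j)"
  using assms by (induction P) (simp_all add: dpoly_of_pCons map_poly_pCons)

lemma dpoly_eval_dpoly_of_residue_field:
  fixes P :: "'a::field poly"
  assumes "Polynomial.degree P > 0"
  shows "dpoly_eval (residue_field P) D (\<lambda>a. [:a:]) y (dpoly_of j Q) = pcompose Q (y j) mod P"
proof -
  have "[:a:] mod P = [:a:]" for a using assms by (simp add: mod_poly_less)
  then show ?thesis
    by (induction Q) (simp_all add: dpoly_of_pCons pcompose_pCons poly_mod_add_left mod_mult_right_eq)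
qed

definition unknown_difference :: "nat \<Rightarrow> nat \<Rightarrow> 'a::{one,uminus} dpoly" where
  "unknown_difference i j = Plus (Unknown i) (Times (Coeff (- 1)) (Unknown j))"

text \<open>
  The roots are found one after the other. If \<open>r\<close> roots are known and \<open>E\<close> is the remaining factor of \<open>D\<close>, a
  root of an irreducible factor \<open>P\<close> of \<open>E\<close> exists in the residue field of \<open>P\<close>, and it differs from the known
  roots because \<open>D\<close> has simple roots only. Universality returns \<open>r + 1\<close> distinct roots, which need not
  prolong the given ones.
\<close>

lemma distinct_roots_exist:
  fixes K :: "'u::field_char_0 set"
  assumes univ: "universal_over m K \<delta>" and K: "subfield_set K" and \<delta>: "diff_field_type m \<delta>"
    and D: "D \<in> polys_over K" "u * D + v * pderiv D = 1"
    and r: "r \<le> Polynomial.degree D"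
  shows "\<exists>a. inj_on a {..<r} \<and> (\<forall>j<r. poly D (a j) = 0)"
  using r
proof (induction r)
  case (Suc r)
  interpret K: subfield_set K by fact
  interpret U: subfield_set_0 "UNIV :: 'u set" by unfold_locales auto
  obtain a where a: "inj_on a {..<r}" "\<And>j. j < r \<Longrightarrow> poly D (a j) = 0" using Suc by auto
  define S where "S = a ` {..<r}"
  have S: "finite S" "card S = r" using a(1) by (auto simp: S_def card_image)
  have D0: "D \<noteq> 0" using Suc.prems by auto
  have simple: "poly (pderiv D) b \<noteq> 0" if "poly D b = 0" for b
    using arg_cong[OF D(2), of "\<lambda>p. poly p b"] that by auto
  have "split_poly S dvd D"
  proof -
    have "(\<Prod>b\<in>S. [:- b, 1:]) dvd D" if "finite S" "\<And>b. b \<in> S \<Longrightarrow> poly D b = 0" for S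
      using that
    proof (induction S rule: finite_induct)
      case (insert b S)
      then obtain E where E: "D = split_poly S * E" by (auto simp: split_poly_def elim!: dvdE)
      have "poly (split_poly S) b \<noteq> 0" using insert by (simp add: poly_split_poly_eq_0_iff)
      then have "poly E b = 0" using insert.prems[of b] E by simp
      then obtain E' where "E = [:- b, 1:] * E'" by (auto simp: poly_eq_0_iff_dvd)
      then show ?case using E insert.hyps by (simp add: split_poly_def mult.left_commute del: mult_pCons_left)
    qed auto
    then show ?thesis using S a(2) by (auto simp: split_poly_def S_def)
  qed
  then obtain E where E: "D = split_poly S * E" by blast
  have "Polynomial.degree D = r + Polynomial.degree E"
    using D0 S unfolding E by (subst degree_mult_eq) (auto simp: degree_split_poly)
  then have "Polynomial.degree E > 0" using Suc.prems by simp
  moreover have "E \<in> U.FX" by simp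
  ultimately obtain P where P: "P dvd E" "Polynomial.degree P > 0" "\<And>g. \<not> P dvd g \<Longrightarrow> U.comaximal P g"
    using U.irreducible_factor[of E] by auto
  have "\<exists>u v. u * P + v * g = 1" if "\<not> P dvd g" for g
    using P(3)[OF that] by (auto simp: U.comaximal_def)
  then obtain \<Delta> where ext: "differential_extension m type_ring \<delta> (residue_field P) \<Delta> (\<lambda>a. [:a:])"
    using residue_field_differential_extension[OF \<delta> P(2)] by blast
  obtain f :: "'u poly \<Rightarrow> 'u" where f: "inj f"
    using inj_poly_into_infinite[OF infinite_UNIV_char_0] by blast
  define y where "y j = (if j < r then [:a j:] else [:0, 1:] mod P)" for j
  have const: "[:c:] mod P = [:c:]" for c using P(2) by (simp add: mod_poly_less)
  have one: "1 mod P = 1" using const[of 1] by (simp add: one_pCons)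
  define N :: "'u dpoly set" where "N = {unknown_difference i j |i j. i < j \<and> j < Suc r}"
  have "N \<subseteq> (\<lambda>(i, j). unknown_difference i j) ` ({..<Suc r} \<times> {..<Suc r})" by (auto simp: N_def)
  then have N1: "finite N" by (rule finite_subset) auto
  have N2: "\<forall>e\<in>N. dpoly_over m K (Suc r) e"
    using K.uminus[OF K.one] by (auto simp: N_def unknown_difference_def)
  have N3: "\<forall>e\<in>N. dpoly_eval (residue_field P) \<Delta> (\<lambda>a. [:a:]) y e \<noteq> \<zero>\<^bsub>residue_field P\<^esub>"
  proof
    fix e assume e: "e \<in> N"
    obtain i j where ij: "e = unknown_difference i j" "i < j" "j < Suc r" using e by (auto simp: N_def)
    then have ev: "dpoly_eval (residue_field P) \<Delta> (\<lambda>a. [:a:]) y e = ([:a i:] - y j) mod P"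
      using const[of "a i"] by (simp add: unknown_difference_def y_def poly_mod_add_left poly_mod_minus_left poly_mod_diff_left)
    show "dpoly_eval (residue_field P) \<Delta> (\<lambda>a. [:a:]) y e \<noteq> \<zero>\<^bsub>residue_field P\<^esub>"
    proof (cases "j < r")
      case True
      then have "a i \<noteq> a j" using ij inj_onD[OF a(1), of i j] by auto
      then show ?thesis using True ev const[of "a i - a j"] by (simp add: y_def)
    next
      case False
      show ?thesis
      proof
        assume "dpoly_eval (residue_field P) \<Delta> (\<lambda>a. [:a:]) y e = \<zero>\<^bsub>residue_field P\<^esub>"
        then have "([:a i:] - [:0, 1:]) mod P = 0" using ev False by (simp add: y_def mod_diff_right_eq)
        then have "P dvd [:a i, - 1:]" by (simp add: mod_eq_0_iff_dvd)
        then obtain q where q: "[:a i, - 1:] = P * q" by blast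
        then have nz: "P \<noteq> 0" "q \<noteq> 0" by auto
        have "Polynomial.degree (P * q) = 1" unfolding q[symmetric] by simp
        then have "Polynomial.degree q = 0" using nz P(2) by (simp add: degree_mult_eq)
        then obtain c where c: "q = [:c:]" "c \<noteq> 0" using nz by (auto elim: degree_eq_zeroE)
        have "poly (P * q) (a i) = 0" unfolding q[symmetric] by simp
        then have "poly P (a i) = 0" using c by simp
        then have "poly E (a i) = 0" using P(1) by auto
        moreover have "poly (split_poly S) (a i) = 0"
          using S ij by (simp add: poly_split_poly_eq_0_iff S_def)
        ultimately have "poly (pderiv D) (a i) = 0" unfolding E pderiv_mult by simp
        then show False using simple a(2)[of i] ij by auto
      qed
    qed
  qed
  have y: "y j \<in> carrier (residue_field P)" for j
    using const by (simp add: y_def mem_residue_field)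
  have root: "dpoly_eval (residue_field P) \<Delta> (\<lambda>a. [:a:]) y (dpoly_of j D) = \<zero>\<^bsub>residue_field P\<^esub>" if "j < Suc r" for j
  proof (cases "j < r")
    case True
    have "pcompose D [:c:] = [:poly D c:]" for c by (induction D) (simp_all add: pcompose_pCons)
    then show ?thesis using a(2)[OF True] True
      by (simp add: dpoly_eval_dpoly_of_residue_field[OF P(2)] y_def)
  next
    case False
    have "pcompose Q (h mod P) mod P = pcompose Q h mod P" for Q h
    proof (induction Q)
      case (pCons c Q)
      have "(h mod P * pcompose Q (h mod P)) mod P = (h mod P * (pcompose Q (h mod P) mod P)) mod P"
        by (simp only: mod_mult_right_eq)
      also have "\<dots> = (h * pcompose Q h) mod P" by (simp only: pCons.IH mod_mult_eq)
      finally show ?case by (simp only: pcompose_pCons poly_mod_add_left)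
    qed simp
    from this[of D "[:0, 1:]"] have "pcompose D ([:0, 1:] mod P) mod P = D mod P" by (simp add: pcompose_idR)
    moreover have "D mod P = 0" using P(1) E by (simp add: mod_eq_0_iff_dvd)
    ultimately show ?thesis using False
      by (simp add: dpoly_eval_dpoly_of_residue_field[OF P(2)] y_def)
  qed
  obtain z where z: "\<forall>e. dpoly_over m K (Suc r) e \<longrightarrow>
        dpoly_eval (residue_field P) \<Delta> (\<lambda>a. [:a:]) y e = \<zero>\<^bsub>residue_field P\<^esub> \<longrightarrow> dpoly_eval type_ring \<delta> id z e = 0"
      "\<forall>e\<in>N. dpoly_eval type_ring \<delta> id z e \<noteq> 0"
    using universal_realization[OF univ K ext inj_on_subset[OF f subset_UNIV] y N1 N2 N3] by (elim exE conjE)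
  have "inj_on z {..<Suc r}"
  proof (rule linorder_inj_onI)
    fix i j :: nat assume "i < j" "i \<in> {..<Suc r}" "j \<in> {..<Suc r}"
    then have "unknown_difference i j \<in> N" by (auto simp: N_def)
    from z(2)[rule_format, OF this] show "z i \<noteq> z j" by (simp add: unknown_difference_def)
  qed auto
  moreover have "poly D (z j) = 0" if "j < Suc r" for j
    using z(1)[rule_format, OF dpoly_over_dpoly_of[OF K.zero D(1) that] root[OF that]] by (simp add: dpoly_eval_dpoly_of_type)
  ultimately show ?case by blast
qed auto

text \<open>
  The equation \<open>D\<^sub>s y\<^sub>j (t - y\<^sub>i) = D\<^sub>s (t - y\<^sub>i)\<close>, which for all \<open>s\<close> says that \<open>y\<^sub>j\<close> is a logarithm of
  \<open>t - y\<^sub>i\<close>.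
\<close>

definition log_equation :: "'a::{one,uminus} \<Rightarrow> nat \<Rightarrow> nat \<Rightarrow> nat \<Rightarrow> 'a dpoly" where
  "log_equation t i j s =
     (let b = Plus (Coeff t) (Times (Coeff (- 1)) (Unknown i))
      in Plus (Times (Deriv s (Unknown j)) b) (Times (Coeff (- 1)) (Deriv s b)))"

lemma dpoly_over_log_equation:
  "\<lbrakk>t \<in> K; - 1 \<in> K; i < n; j < n; s \<in> {1..m}\<rbrakk> \<Longrightarrow> dpoly_over m K n (log_equation t i j s)"
  by (auto simp: log_equation_def Let_def)

lemma dpoly_eval_log_equation:
  fixes \<phi> :: "'a::field \<Rightarrow> 'b::field"
  assumes "\<phi> (- 1) = - 1"
  shows "dpoly_eval type_ring D \<phi> y (log_equation t i j s) = D s (y j) * (\<phi> t - y i) - D s (\<phi> t - y i)"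
  using assms by (simp add: log_equation_def Let_def)

lemma log_derivative_closed:
  assumes "diff_field_type m \<delta>" "b \<noteq> 0" "i \<in> {1..m}" "j \<in> {1..m}"
  shows "\<delta> i (\<delta> j b / b) = \<delta> j (\<delta> i b / b)"
proof -
  have d: "derivation (\<delta> i)" "derivation (\<delta> j)" "\<delta> i (\<delta> j b) = \<delta> j (\<delta> i b)"
    using assms by (auto simp: diff_field_type_def)
  show ?thesis using derivation_divide[OF d(1) assms(2)] derivation_divide[OF d(2) assms(2)] d(3)
    by (simp add: mult.commute)
qed

text \<open>
  The logarithms are adjoined one after the other as well. Since universality holds over \<open>K\<close> and not over
  the field generated by the roots, each step solves again the whole system for all roots and for the
  logarithms already obtained. In this way an extension by a single transcendental element suffices.
\<close>

lemma roots_and_logs_exist: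
  fixes K :: "'u::field_char_0 set"
  assumes univ: "universal_over m K \<delta>" and K: "subfield_set K" and \<delta>: "diff_field_type m \<delta>"
    and D: "D \<in> polys_over K" "u * D + v * pderiv D = 1"
    and t: "t \<in> K" "poly D t \<noteq> 0"
    and r: "r \<le> Polynomial.degree D"
  defines "n \<equiv> Polynomial.degree D"
  shows "\<exists>a L. inj_on a {..<n} \<and> (\<forall>j<n. poly D (a j) = 0) \<and> (\<forall>j<r. is_log m \<delta> (t - a j) (L j))"
  using r
proof (induction r)
  case 0
  show ?case using distinct_roots_exist[OF univ K \<delta> D] by (auto simp: n_def)
next
  case (Suc r)
  interpret K: subfield_set K by fact
  obtain a L where a: "inj_on a {..<n}" "\<And>j. j < n \<Longrightarrow> poly D (a j) = 0"
    and L: "\<And>j. j < r \<Longrightarrow> is_log m \<delta> (t - a j) (L j)" using Suc by auto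
  have rn: "r < n" using Suc.prems by (simp add: n_def)
  define b where "b = t - a r"
  have b: "b \<noteq> 0" using a(2)[OF rn] t(2) by (auto simp: b_def)
  define w where "w i = \<delta> i b / b" for i
  have w: "\<delta> i (w j) = \<delta> j (w i)" if "i \<in> {1..m}" "j \<in> {1..m}" for i j
    unfolding w_def by (rule log_derivative_closed[OF \<delta> b that])
  \<comment> \<open>The extension \<open>'u(\<tau>)\<close>, where \<open>\<tau>\<close> is to be the logarithm of \<open>b\<close>.\<close>
  define \<psi> :: "'u \<Rightarrow> 'u poly fract" where "\<psi> c = Fract [:c:] 1" for c
  obtain \<Delta> \<tau> where ext: "differential_extension m type_ring \<delta> type_ring \<Delta> \<psi>"
    and \<tau>: "\<And>i. i \<in> {1..m} \<Longrightarrow> \<Delta> i \<tau> = \<psi> (w i)"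
    unfolding \<psi>_def using fract_differential_extension[OF \<delta> w] by blast
  have \<psi>: "\<psi> (c + e) = \<psi> c + \<psi> e" "\<psi> (c * e) = \<psi> c * \<psi> e" "\<psi> 0 = 0" "\<psi> 1 = 1" "\<psi> (- c) = - \<psi> c"
    "\<psi> (c - e) = \<psi> c - \<psi> e" "\<psi> c = 0 \<longleftrightarrow> c = 0" for c e
    by (simp_all add: \<psi>_def mult.commute Zero_fract_def One_fract_def one_pCons eq_fract)
  have \<psi>\<Delta>: "\<Delta> i (\<psi> c) = \<psi> (\<delta> i c)" if "i \<in> {1..m}" for i c
    using ext that by (simp add: differential_extension_def)
  have \<psi>poly: "poly (map_poly \<psi> P) (\<psi> c) = \<psi> (poly P c)" for P c
    by (induction P) (simp_all add: map_poly_pCons \<psi>)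
  obtain f0 :: "'u poly \<Rightarrow> 'u" where f0: "inj f0"
    using inj_poly_into_infinite[OF infinite_UNIV_char_0] by blast
  have "infinite (UNIV :: 'u poly set)" by (simp add: infinite_UNIV_char_0)
  then obtain f1 :: "'u poly fract \<Rightarrow> 'u poly" where f1: "inj f1"
    using inj_fract_into_infinite by blast
  have f: "inj_on (f0 \<circ> f1) (carrier (type_ring :: 'u poly fract ring))"
    using f0 f1 by (simp add: inj_compose)
  \<comment> \<open>The unknowns are the \<open>n\<close> roots, then the \<open>r\<close> logarithms already found, then the new one.\<close>
  define y where "y j = (if j < n then \<psi> (a j) else if j < n + r then \<psi> (L (j - n)) else \<tau>)" for j
  define N :: "'u dpoly set" where "N = {unknown_difference i j |i j. i < j \<and> j < n}"
  have "N \<subseteq> (\<lambda>(i, j). unknown_difference i j) ` ({..<n} \<times> {..<n})" by (auto simp: N_def)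
  then have N1: "finite N" by (rule finite_subset) auto
  have N2: "\<forall>e\<in>N. dpoly_over m K (Suc (n + r)) e"
    using K.uminus[OF K.one] by (auto simp: N_def unknown_difference_def)
  have N3: "\<forall>e\<in>N. dpoly_eval type_ring \<Delta> \<psi> y e \<noteq> \<zero>\<^bsub>type_ring :: 'u poly fract ring\<^esub>"
  proof
    fix e assume e: "e \<in> N"
    obtain i j where ij: "e = unknown_difference i j" "i < j" "j < n" using e by (auto simp: N_def)
    then have "a i \<noteq> a j" using inj_onD[OF a(1), of i j] by auto
    then show "dpoly_eval type_ring \<Delta> \<psi> y e \<noteq> \<zero>\<^bsub>type_ring :: 'u poly fract ring\<^esub>" using ij \<psi>(7)[of "a i - a j"] by (simp add: unknown_difference_def y_def \<psi>)
  qed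
  have root: "dpoly_eval type_ring \<Delta> \<psi> y (dpoly_of j D) = \<zero>\<^bsub>type_ring :: 'u poly fract ring\<^esub>" if "j < n" for j
    using that a(2) by (simp add: dpoly_eval_dpoly_of_type \<psi> y_def \<psi>poly)
  have log: "dpoly_eval type_ring \<Delta> \<psi> y (log_equation t j (n + j) s) = \<zero>\<^bsub>type_ring :: 'u poly fract ring\<^esub>"
    if "j < Suc r" "s \<in> {1..m}" for j s
  proof -
    have jn: "j < n" using that rn by simp
    have "\<Delta> s (y (n + j)) = \<psi> (\<delta> s (t - a j) / (t - a j))"
    proof (cases "j < r")
      case True
      then show ?thesis using L[OF True] that(2) by (simp add: y_def \<psi>\<Delta> is_log_def)
    next
      case False
      then have "j = r" using that by simp
      then show ?thesis using \<tau>[OF that(2)] by (simp add: y_def w_def b_def)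
    qed
    moreover have "t - a j \<noteq> 0" using a(2)[OF jn] t(2) by auto
    moreover have "\<psi> t - y j = \<psi> (t - a j)" using jn by (simp add: y_def \<psi>)
    ultimately show ?thesis using that(2)
      by (simp add: dpoly_eval_log_equation \<psi> \<psi>\<Delta> del: \<psi>(6) flip: \<psi>(2))
  qed
  have y: "y j \<in> carrier type_ring" for j by simp
  obtain z where z: "\<forall>e. dpoly_over m K (Suc (n + r)) e \<longrightarrow>
        dpoly_eval type_ring \<Delta> \<psi> y e = \<zero>\<^bsub>type_ring :: 'u poly fract ring\<^esub> \<longrightarrow> dpoly_eval type_ring \<delta> id z e = 0"
      "\<forall>e\<in>N. dpoly_eval type_ring \<delta> id z e \<noteq> 0"
    using universal_realization[OF univ K ext f y N1 N2 N3] by (elim exE conjE)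
  have "inj_on z {..<n}"
  proof (rule linorder_inj_onI)
    fix i j :: nat assume "i < j" "i \<in> {..<n}" "j \<in> {..<n}"
    then have "unknown_difference i j \<in> N" by (auto simp: N_def)
    from z(2)[rule_format, OF this] show "z i \<noteq> z j" by (simp add: unknown_difference_def)
  qed auto
  moreover have rt: "poly D (z j) = 0" if "j < n" for j
    using z(1)[rule_format, OF dpoly_over_dpoly_of[OF K.zero D(1)] root[OF that]] that
    by (simp add: dpoly_eval_dpoly_of_type)
  moreover have "is_log m \<delta> (t - z j) (z (n + j))" if "j < Suc r" for j
    unfolding is_log_def
  proof (intro conjI ballI)
    show nz: "t - z j \<noteq> 0" using rt[of j] t(2) that rn by auto
    fix s assume s: "s \<in> {1..m}"
    have "dpoly_over m K (Suc (n + r)) (log_equation t j (n + j) s)"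
      using that rn s t(1) by (intro dpoly_over_log_equation) auto
    from z(1)[rule_format, OF this log[OF that s]] nz show "\<delta> s (z (n + j)) = \<delta> s (t - z j) / (t - z j)"
      by (simp add: dpoly_eval_log_equation eq_divide_eq)
  qed
  ultimately have "inj_on z {..<n} \<and> (\<forall>j<n. poly D (z j) = 0) \<and> (\<forall>j<Suc r. is_log m \<delta> (t - z j) (z (n + j)))"
    by (intro conjI allI impI) assumption+
  then show ?case by (rule exI[of _ "\<lambda>j. z (n + j)", THEN exI[of _ z]])
qed

lemma splitting_with_logs:
  fixes K :: "'u::field_char_0 set"
  assumes univ: "universal_over m K \<delta>" and K: "subfield_set K" and \<delta>: "diff_field_type m \<delta>"
    and D: "D \<in> polys_over K" "u * D + v * pderiv D = 1"
    and t: "t \<in> K" "poly D t \<noteq> 0"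
  obtains S L where "finite S" "D = Polynomial.smult (Polynomial.lead_coeff D) (split_poly S)"
    "\<And>a. a \<in> S \<Longrightarrow> is_log m \<delta> (t - a) (L a)"
proof -
  define n where "n = Polynomial.degree D"
  obtain a L where a: "inj_on a {..<n}" "\<And>j. j < n \<Longrightarrow> poly D (a j) = 0"
    and L: "\<And>j. j < n \<Longrightarrow> is_log m \<delta> (t - a j) (L j)"
    using roots_and_logs_exist[OF univ K \<delta> D t order_refl] by (auto simp: n_def)
  define S where "S = a ` {..<n}"
  have S: "finite S" "card S = n" using a(1) by (auto simp: S_def card_image)
  have "D \<noteq> 0" using t(2) by auto
  have "D = Polynomial.smult (Polynomial.lead_coeff D) (split_poly S)"
  proof (rule poly_eqI_degree_lead_coeff[where A = S and n = n])
    show "poly D x = poly (Polynomial.smult (Polynomial.lead_coeff D) (split_poly S)) x" if "x \<in> S" for x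
    proof -
      have "poly (split_poly S) x = 0" using that S by (simp add: poly_split_poly_eq_0_iff)
      then show ?thesis using that a(2) by (auto simp: S_def)
    qed
    have "poly.coeff (split_poly S) n = Polynomial.lead_coeff (split_poly S)"
      using S by (simp add: degree_split_poly)
    also have "\<dots> = 1" by (simp add: split_poly_def lead_coeff_prod)
    finally show "poly.coeff D n = poly.coeff (Polynomial.smult (Polynomial.lead_coeff D) (split_poly S)) n"
      by (simp add: n_def)
  qed (use S in \<open>simp_all add: degree_split_poly n_def\<close>)
  moreover define L' where "L' b = L (inv_into {..<n} a b)" for b
  have "is_log m \<delta> (t - b) (L' b)" if "b \<in> S" for b
    using that L a(1) by (auto simp: S_def L'_def)
  ultimately show thesis using that[of S L'] S(1) by blast
qed

section \<open>Integrating rational functions in one of the variables\<close>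

locale rational_tower =
  fixes k :: "'u::field_char_0 set" and x :: "nat \<Rightarrow> 'u" and \<delta> :: "nat \<Rightarrow> 'u \<Rightarrow> 'u" and m :: nat
  assumes differential: "diff_field_type m \<delta>"
    and base: "i \<in> {1..m} \<Longrightarrow> a \<in> k \<Longrightarrow> \<delta> i a = 0"
    and vars: "i \<in> {1..m} \<Longrightarrow> j \<in> {1..m} \<Longrightarrow> \<delta> i (x j) = (if i = j then 1 else 0)"
    and universal: "universal_over m (ratfun k x m) \<delta>"
begin

lemma der: "i \<in> {1..m} \<Longrightarrow> derivation (\<delta> i)"
  using differential by (auto simp: diff_field_type_def)

lemma comm: "i \<in> {1..m} \<Longrightarrow> j \<in> {1..m} \<Longrightarrow> \<delta> i (\<delta> j a) = \<delta> j (\<delta> i a)"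
  using differential by (auto simp: diff_field_type_def)

lemma ratfun_independent:
  assumes "s \<in> {1..m}" "i < s" "f \<in> ratfun k x i"
  shows "\<delta> s f = 0"
  using assms(3) unfolding ratfun_def
  by (rule derivation_zero_adjoin[OF der[OF assms(1)], rotated]) (use assms base vars in auto)

lemma ratfun_closed:
  assumes "s \<in> {1..m}" "i \<le> m" "f \<in> ratfun k x i"
  shows "\<delta> s f \<in> ratfun k x i"
proof -
  interpret R: subfield_set "adjoin k (x ` {1..i})" by (rule subfield_adjoin)
  show ?thesis using assms(3) unfolding ratfun_def
    by (rule derivation_closed_adjoin[OF der[OF assms(1)], rotated])
       (use assms base vars R.zero R.one in \<open>auto simp del: One_nat_def\<close>)
qed

lemma constants_and_variable_ratfun:
  assumes "n \<in> {1..m}"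
  shows "constants_and_variable (\<delta> n) (ratfun k x (n - 1)) (x n)"
proof -
  interpret derivation "\<delta> n" using assms by (rule der)
  interpret subfield_set "ratfun k x (n - 1)" by (rule subfield_ratfun)
  show ?thesis using assms vars[OF assms assms] ratfun_independent[OF assms, of "n - 1"]
    by unfold_locales auto
qed

lemma ratfun_rational_values:
  assumes "n \<in> {1..m}"
  shows "ratfun k x n = rational_values (ratfun k x (n - 1)) (x n)"
  using ratfun_Suc[of k x "n - 1"] assms by simp

text \<open>
  None of the constituents of the expression involves a variable beyond \<open>x i\<close>.
\<close>

lemma log_expression_independent:
  assumes "s \<in> {1..m}" "1 \<le> i" "i < s" "log_expression m \<delta> k x i f"
  shows "\<delta> s f = 0"
proof -
  interpret derivation "\<delta> s" using assms(1) by (rule der)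
  interpret C: subfield_set "{c. \<delta> s c = 0}" by (rule subfield_constants) (rule der[OF assms(1)])
  obtain N :: nat and b c l where f: "f = b 0 + (\<Sum>j=1..N. c j * l j)" "b 0 \<in> ratfun k x i"
    and j: "\<And>j. j \<in> {1..N} \<Longrightarrow> c j \<in> alg_closure_in (ratfun k x (i - 1))"
      "\<And>j. j \<in> {1..N} \<Longrightarrow> b j \<in> polys_in (adjoin (ratfun k x (i - 1)) {c j}) (x i)"
      "\<And>j. j \<in> {1..N} \<Longrightarrow> is_log m \<delta> (b j) (l j)"
    using assms(4) unfolding log_expression_def by blast
  have F: "ratfun k x (i - 1) \<subseteq> {c. \<delta> s c = 0}"
    using ratfun_independent[OF assms(1), of "i - 1"] assms(3) by auto
  have "\<delta> s (c j * l j) = 0" if "j \<in> {1..N}" for j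
  proof -
    have c: "\<delta> s (c j) = 0"
      by (rule derivation_algebraic[OF der[OF assms(1)] subfield_ratfun _ j(1)[OF that]]) (use F in auto)
    then have "adjoin (ratfun k x (i - 1)) {c j} \<subseteq> {c. \<delta> s c = 0}"
      using F C.subfield_set_axioms by (intro adjoin_minimal) auto
    moreover have "\<delta> s (x i) = 0" using vars[of s i] assms by auto
    ultimately have "\<delta> s (b j) = 0"
      using polys_in_subfield[OF C.subfield_set_axioms _ _ j(2)[OF that]] by auto
    then have "\<delta> s (l j) = 0" using j(3)[OF that] assms(1) by (simp add: is_log_def)
    then show ?thesis using c by (simp add: mult)
  qed
  then show ?thesis using ratfun_independent[OF assms(1,3) f(2)] by (simp add: f(1) sum)
qed

text \<open>
  The roots with the same residue \<open>v\<close> are collected. The product of their linear factors \<open>t - a\<close> is the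
  greatest common divisor of \<open>D\<close> and \<open>A - v D'\<close>, so its coefficients lie in \<open>F(v)\<close>. The sum of the chosen
  logarithms of the linear factors is a logarithm of the product.
\<close>

lemma log_expressionI:
  fixes n :: nat
  defines "F \<equiv> ratfun k x (n - 1)" and "t \<equiv> x n"
  assumes D: "D \<in> polys_over F" "D = Polynomial.smult (Polynomial.lead_coeff D) (split_poly S)" "D \<noteq> 0"
    and S: "finite S" "\<And>a. a \<in> S \<Longrightarrow> is_log m \<delta> (t - a) (L a)"
      "\<And>a. a \<in> S \<Longrightarrow> poly (pderiv D) a \<noteq> 0"
    and A: "A \<in> polys_over F" and b: "b \<in> ratfun k x n"
    and c: "\<And>a. a \<in> S \<Longrightarrow> c a = poly A a / poly (pderiv D) a" "\<And>a. a \<in> S \<Longrightarrow> c a \<in> alg_closure_in F"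
  shows "log_expression m \<delta> k x n (b + (\<Sum>a\<in>S. c a * L a))"
proof -
  have "finite (c ` S)" using S(1) by simp
  then obtain e where e: "bij_betw e {1..card (c ` S)} (c ` S)"
    using ex_bij_betw_nat_finite_1 by blast
  define N where "N = card (c ` S)"
  define Z where "Z v = {a \<in> S. c a = v}" for v
  define B where "B j = (if j = 0 then b else poly (split_poly (Z (e j))) t)" for j
  define l where "l j = (\<Sum>a\<in>Z (e j). L a)" for j
  have Z: "finite (Z v)" "Z v \<subseteq> S" for v using S(1) by (auto simp: Z_def)
  have "(\<Sum>a\<in>S. c a * L a) = (\<Sum>v\<in>c ` S. \<Sum>a\<in>Z v. c a * L a)"
    unfolding Z_def by (rule sum.image_gen[OF S(1)])
  also have "\<dots> = (\<Sum>v\<in>c ` S. v * (\<Sum>a\<in>Z v. L a))"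
    by (intro sum.cong refl) (auto simp: Z_def sum_distrib_left)
  also have "\<dots> = (\<Sum>j=1..N. e j * l j)"
    unfolding l_def N_def by (rule sum.reindex_bij_betw[OF e, symmetric])
  finally have sum: "b + (\<Sum>a\<in>S. c a * L a) = B 0 + (\<Sum>j=1..N. e j * l j)" by (simp add: B_def)
  have "e j \<in> alg_closure_in F \<and> B j \<in> polys_in (adjoin F {e j}) t \<and> is_log m \<delta> (B j) (l j)"
    if j: "j \<in> {1..N}" for j
  proof (intro conjI)
    have "e j \<in> c ` S" using bij_betwE[OF e] j by (auto simp: N_def)
    then show "e j \<in> alg_closure_in F" using c(2) by auto
    interpret G: subfield_set "adjoin F {e j}" by (rule subfield_adjoin)
    have sub: "F \<subseteq> adjoin F {e j}" "e j \<in> adjoin F {e j}"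
      using adjoin_incl(1)[of F "{e j}"] adjoin_incl(2)[of "{e j}" F] by auto
    have D': "D \<in> G.FX" "A \<in> G.FX" using D(1) A polys_over_mono[OF sub(1)] by auto
    have "split_poly {a \<in> S. poly (A - Polynomial.smult (e j) (pderiv D)) a = 0} \<in> G.FX"
    proof (rule G.split_common_roots[OF S(1), of "Polynomial.lead_coeff D"])
      show "Polynomial.smult (Polynomial.lead_coeff D) (split_poly S) \<in> G.FX" using D(2) D'(1) by simp
    qed (use D(3) D' sub in auto)
    also have "{a \<in> S. poly (A - Polynomial.smult (e j) (pderiv D)) a = 0} = Z (e j)"
    proof -
      have "poly A a - e j * poly (pderiv D) a = 0 \<longleftrightarrow> c a = e j" if "a \<in> S" for a
        using S(3)[OF that] by (simp add: c(1)[OF that] divide_eq_eq)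
      then show ?thesis by (auto simp: Z_def)
    qed
    finally have "split_poly (Z (e j)) \<in> G.FX" .
    then show "B j \<in> polys_in (adjoin F {e j}) t"
      using polys_in_eval[OF subfield_adjoin] j by (simp add: B_def)
    have B: "B j = (\<Prod>a\<in>Z (e j). t - a)" using j by (simp add: B_def poly_split_poly)
    have log: "is_log m \<delta> (t - a) (L a)" if "a \<in> Z (e j)" for a using that Z S(2) by blast
    show "is_log m \<delta> (B j) (l j)"
      unfolding is_log_def
    proof (intro conjI ballI)
      show nz: "B j \<noteq> 0" unfolding B using log Z by (simp add: is_log_def)
      fix i assume i: "i \<in> {1..m}"
      interpret derivation "\<delta> i" using i by (rule der)
      have "\<delta> i (B j) = B j * (\<Sum>a\<in>Z (e j). \<delta> i (L a))"
        unfolding B using log i by (intro prod_log Z) (auto simp: is_log_def)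
      then show "\<delta> i (l j) = \<delta> i (B j) / B j" using nz by (simp add: l_def local.sum)
    qed
  qed
  moreover have "B 0 \<in> ratfun k x n" using b by (simp add: B_def)
  ultimately show ?thesis unfolding log_expression_def F_def t_def
    using sum by (intro exI[of _ N] exI[of _ B] exI[of _ e] exI[of _ l]) simp
qed

text \<open>
  All \<open>f i\<close> are integrated with the logarithms \<open>L a\<close> of the same linear factors, whose coefficients
  \<open>c i a\<close> are the residues. The last sum but one arises when \<open>\<delta> s\<close> is applied to the logarithms. It is
  symmetric in the roots \<open>a\<close>, and this is why it is rational over the base field.
\<close>

lemma simultaneous_integration:
  fixes f :: "'i \<Rightarrow> 'u"
  assumes n: "n \<in> {1..m}" and I: "finite I" "\<And>i. i \<in> I \<Longrightarrow> f i \<in> ratfun k x n"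
  shows "\<exists>S L b c. finite S \<and> S \<subseteq> alg_closure_in (ratfun k x (n - 1)) \<and>
    (\<forall>a\<in>S. is_log m \<delta> (x n - a) (L a)) \<and>
    (\<forall>i\<in>I. b i \<in> ratfun k x n \<and>
       (\<forall>a\<in>S. c i a \<in> alg_closure_in (ratfun k x (n - 1))) \<and>
       f i = \<delta> n (b i) + (\<Sum>a\<in>S. c i a / (x n - a)) \<and>
       (\<forall>s\<in>{1..<n}. (\<Sum>a\<in>S. c i a * \<delta> s a / (x n - a)) \<in> ratfun k x n) \<and>
       log_expression m \<delta> k x n (b i + (\<Sum>a\<in>S. c i a * L a)))"
proof -
  define F where "F = ratfun k x (n - 1)"
  define t where "t = x n"
  interpret constants_and_variable "\<delta> n" F t
    unfolding F_def t_def by (rule constants_and_variable_ratfun[OF n])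
  interpret alg: subfield_set "alg_closure_in F" by (rule subfield_alg_closure_in) (rule subfield_set_axioms)
  have R: "ratfun k x n = rational_values F t"
    unfolding F_def t_def by (rule ratfun_rational_values[OF n])
  have Falg: "F \<subseteq> alg_closure_in F" by (rule alg_closure_in_incl) (rule subfield_set_axioms)
  obtain Q where Q: "Q \<in> FX" "Q \<noteq> 0" "\<And>i. i \<in> I \<Longrightarrow> \<exists>P\<in>FX. f i = poly P t / poly Q t"
    using common_denominator[of I f] I unfolding R by blast
  obtain D where D: "D \<in> FX" "D \<noteq> 0" "comaximal D (pderiv D)"
    and herm: "\<And>P. P \<in> FX \<Longrightarrow> \<exists>b\<in>rational_values F t. \<exists>A\<in>FX. (A = 0 \<or> Polynomial.degree A < Polynomial.degree D) \<and>
        poly P t / poly Q t = \<delta> n b + poly A t / poly D t"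
    using hermite_reduction[OF Q(1,2)] by blast
  have "\<forall>i\<in>I. \<exists>b A. b \<in> rational_values F t \<and> A \<in> FX \<and> (A = 0 \<or> Polynomial.degree A < Polynomial.degree D) \<and>
      f i = \<delta> n b + poly A t / poly D t"
    using Q(3) herm by metis
  then obtain b A where bA: "\<And>i. i \<in> I \<Longrightarrow> b i \<in> rational_values F t"
      "\<And>i. i \<in> I \<Longrightarrow> A i \<in> FX" "\<And>i. i \<in> I \<Longrightarrow> A i = 0 \<or> Polynomial.degree (A i) < Polynomial.degree D"
      "\<And>i. i \<in> I \<Longrightarrow> f i = \<delta> n (b i) + poly (A i) t / poly D t" by metis
  obtain u v where uv: "u \<in> FX" "v \<in> FX" "u * D + v * pderiv D = 1" using D(3) by (auto simp: comaximal_def)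
  have Dt: "poly D t \<noteq> 0" using transcendental D(1,2) by auto
  have Fm: "F \<subseteq> ratfun k x m" unfolding F_def by (rule ratfun_mono) (use n in auto)
  have Dm: "D \<in> polys_over (ratfun k x m)" using D(1) polys_over_mono[OF Fm] by blast
  have tm: "t \<in> ratfun k x m" unfolding t_def using n by (intro ratfun_var) auto
  obtain S L where S: "finite S" "D = Polynomial.smult (Polynomial.lead_coeff D) (split_poly S)"
      "\<And>a. a \<in> S \<Longrightarrow> is_log m \<delta> (t - a) (L a)"
    using splitting_with_logs[OF universal subfield_ratfun differential Dm uv(3) tm Dt] by blast
  have deg: "Polynomial.degree D = card S"
    using S(1) D(2) by (subst S(2)) (simp add: degree_split_poly)
  have lc: "Polynomial.lead_coeff D \<noteq> 0" using D(2) by simp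
  have root: "poly D a = 0" if "a \<in> S" for a
    using S(1) that by (subst S(2)) (simp add: poly_split_poly_eq_0_iff)
  have inv: "poly v a * poly (pderiv D) a = 1" if "a \<in> S" for a
    using arg_cong[OF uv(3), of "\<lambda>p. poly p a"] root[OF that] by simp
  then have simple: "poly (pderiv D) a \<noteq> 0" if "a \<in> S" for a using that by force
  have tS: "t \<notin> S" using root Dt by auto
  have Salg: "S \<subseteq> alg_closure_in F"
    using root D(1,2) by (auto simp: mem_alg_closure_in_iff[OF subfield_set_axioms] intro!: bexI[of _ D])
  define c where "c i a = poly (A i) a / poly (pderiv D) a" for i a
  have algX: "P \<in> alg.FX" if "P \<in> FX" for P using that polys_over_mono[OF Falg] by blast
  have c: "c i a \<in> alg_closure_in F" if "i \<in> I" "a \<in> S" for i a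
    unfolding c_def using that Salg algX bA(2) D(1) by (intro alg.divide alg.over_eval) auto
  show ?thesis
  proof (intro exI[of _ S] exI[of _ L] exI[of _ b] exI[of _ c] conjI ballI)
    fix i assume i: "i \<in> I"
    have "poly (A i) t / poly D t = (\<Sum>a\<in>S. c i a / (t - a))"
      unfolding c_def using S(1) bA(3)[OF i] lc S(2) tS deg by (intro partial_fractions) auto
    then show "f i = \<delta> n (b i) + (\<Sum>a\<in>S. c i a / (x n - a))" using bA(4)[OF i] by (simp add: t_def)
    show "log_expression m \<delta> k x n (b i + (\<Sum>a\<in>S. c i a * L a))"
      using D S simple bA(1,2)[OF i] c[OF i] unfolding F_def t_def R[unfolded F_def t_def, symmetric]
      by (intro log_expressionI[of D n S L "A i" "b i" "c i"]) (auto simp: c_def)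
    fix s assume s: "s \<in> {1..<n}"
    then have sm: "s \<in> {1..m}" using n by auto
    interpret s: derivation "\<delta> s" using sm by (rule der)
    define Ds where "Ds = map_poly (\<delta> s) D"
    have "Ds \<in> FX" unfolding Ds_def F_def
      using D(1) ratfun_closed[OF sm, of "n - 1"] n by (intro map_poly_polys_over) (auto simp: F_def)
    \<comment> \<open>As \<open>v\<close> inverts \<open>D'\<close> modulo \<open>D\<close>, the derivative of a root is \<open>- D\<^sup>\<delta>(a) v(a)\<close>. This makes \<open>H\<close>
      the numerator over \<open>D\<close> whose residues are \<open>c i a * \<delta> s a\<close>.\<close>
    define H where "H = (- (A i * Ds * v)) mod D"
    have H: "H \<in> FX" unfolding H_def using bA(2)[OF i] \<open>Ds \<in> FX\<close> uv(2) D(1)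
      by (intro over_mod over_uminus over_mult)
    have "c i a * \<delta> s a = poly H a / poly (pderiv D) a" if a: "a \<in> S" for a
    proof -
      have "0 = poly Ds a + poly (pderiv D) a * \<delta> s a"
        using s.poly_rule[of D a] root[OF a] by (simp add: Ds_def)
      then have "poly (pderiv D) a * \<delta> s a = - poly Ds a" by (simp add: eq_neg_iff_add_eq_0 add.commute)
      then have "(poly v a * poly (pderiv D) a) * \<delta> s a = - (poly v a * poly Ds a)"
        by (simp add: mult.assoc)
      then have \<delta>a: "\<delta> s a = - (poly v a * poly Ds a)" using inv[OF a] by simp
      have "- (A i * Ds * v) = D * (- (A i * Ds * v) div D) + H"
        unfolding H_def by (rule mult_div_mod_eq[symmetric])
      then have "poly (- (A i * Ds * v)) a = poly H a"
        using root[OF a] by (metis Polynomial.poly_add Polynomial.poly_mult add_0 mult_zero_left)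
      then have "poly H a = - (poly (A i) a * poly Ds a * poly v a)" by simp
      then show ?thesis by (simp add: c_def \<delta>a mult_ac)
    qed
    then have "(\<Sum>a\<in>S. c i a * \<delta> s a / (t - a)) = (\<Sum>a\<in>S. poly H a / poly (pderiv D) a / (t - a))"
      by (intro sum.cong) auto
    also have "\<dots> = poly H t / poly D t"
      using S(1) lc S(2) tS degree_mod_less[OF D(2), of "- (A i * Ds * v)"] deg
      by (intro partial_fractions[symmetric]) (auto simp: H_def)
    also have "\<dots> \<in> rational_values F t" using H D(1) Dt by (rule rational_valuesI)
    finally show "(\<Sum>a\<in>S. c i a * \<delta> s a / (x n - a)) \<in> ratfun k x n" unfolding R t_def .
  qed (use S Salg bA c in \<open>auto simp: R F_def t_def\<close>)
qed

end

section \<open>Differential forms\<close>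

lemma is_form_mono: "is_form n p \<omega> \<Longrightarrow> n \<le> m \<Longrightarrow> is_form m p \<omega>"
  by (fastforce simp: is_form_def)

lemma dx_wedge_is_form:
  assumes "is_form n p \<omega>" "s \<in> {1..n}"
  shows "is_form n (Suc p) (dx_wedge s \<omega>)"
  unfolding is_form_def
proof (intro allI impI)
  fix J assume "dx_wedge s \<omega> J \<noteq> 0"
  then have s: "s \<in> J" "\<omega> (J - {s}) \<noteq> 0" by (auto simp: dx_wedge_def split: if_splits)
  then have "J - {s} \<subseteq> {1..n}" "card (J - {s}) = p" using assms(1) by (auto simp: is_form_def)
  moreover from this have "finite J" by (meson finite_Diff2 finite_atLeastAtMost finite.emptyI finite.insertI finite_subset)
  ultimately show "J \<subseteq> {1..n} \<and> card J = Suc p"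
    using s(1) assms(2) by (metis Diff_subset_conv card.remove insert_absorb insert_subset Un_insert_left sup_bot_left)
qed

context rational_tower begin

lemma der_0 [simp]: "i \<in> {1..m} \<Longrightarrow> \<delta> i 0 = 0"
  using derivation.zero[OF der] .

lemma d_upto_is_form:
  assumes "is_form n p \<omega>" "n \<le> m"
  shows "is_form n (Suc p) (d_upto \<delta> n \<omega>)"
  unfolding is_form_def
proof (intro allI impI)
  fix J assume "d_upto \<delta> n \<omega> J \<noteq> 0"
  then obtain r where r: "r \<in> {1..n}" "dx_wedge r (\<lambda>I. \<delta> r (\<omega> I)) J \<noteq> 0"
    unfolding d_upto_def d_partial_def using sum.neutral by (metis (no_types, lifting))
  have "\<delta> r 0 = 0" using r(1) assms(2) by auto
  then have "is_form n p (\<lambda>I. \<delta> r (\<omega> I))"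
    using assms(1) unfolding is_form_def by metis
  from dx_wedge_is_form[OF this r(1)] r(2) show "J \<subseteq> {1..n} \<and> card J = Suc p"
    unfolding is_form_def by blast
qed

lemma d_upto_sum:
  assumes "n \<le> m"
  shows "d_upto \<delta> n (\<lambda>I. \<Sum>i\<in>A. \<Psi> i I) J = (\<Sum>i\<in>A. d_upto \<delta> n (\<Psi> i) J)"
proof -
  have "d_partial \<delta> r (\<lambda>I. \<Sum>i\<in>A. \<Psi> i I) J = (\<Sum>i\<in>A. d_partial \<delta> r (\<Psi> i) J)" if "r \<in> {1..n}" for r
  proof -
    interpret derivation "\<delta> r" using that assms by (intro der) auto
    show ?thesis by (simp add: d_partial_def dx_wedge_def sum_distrib_left sum)
  qed
  then show ?thesis unfolding d_upto_def by (subst sum.swap) (intro sum.cong, auto)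
qed

lemma d_upto_diff:
  assumes "n \<le> m"
  shows "d_upto \<delta> n (\<lambda>I. \<phi> I - \<psi> I) J = d_upto \<delta> n \<phi> J - d_upto \<delta> n \<psi> J"
proof -
  have "d_partial \<delta> r (\<lambda>I. \<phi> I - \<psi> I) J = d_partial \<delta> r \<phi> J - d_partial \<delta> r \<psi> J" if "r \<in> {1..n}" for r
  proof -
    interpret derivation "\<delta> r" using that assms by (intro der) auto
    show ?thesis by (simp add: d_partial_def dx_wedge_def right_diff_distrib)
  qed
  then show ?thesis unfolding d_upto_def by (simp add: sum_subtractf)
qed

lemma d_upto_truncate:
  assumes "i \<le> n" "\<And>s I. s \<in> {i<..n} \<Longrightarrow> \<delta> s (\<Psi> I) = 0"
  shows "d_upto \<delta> n \<Psi> = d_upto \<delta> i \<Psi>"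
proof
  fix J
  show "d_upto \<delta> n \<Psi> J = d_upto \<delta> i \<Psi> J" unfolding d_upto_def
    by (rule sum.mono_neutral_right) (use assms in \<open>auto simp: d_partial_def dx_wedge_def\<close>)
qed

text \<open>
  The partial derivatives commute and the factors \<open>dx\<close> anticommute, so the double sum equals its negative.
\<close>

lemma d_upto_d_upto:
  assumes "n \<le> m" "finite J"
  shows "d_upto \<delta> n (d_upto \<delta> n \<Psi>) J = 0"
proof -
  define W where "W r t = dx_wedge r (dx_wedge t (\<lambda>I. \<delta> r (\<delta> t (\<Psi> I)))) J" for r t
  have W: "W r t = - W t r" if "r \<in> {1..n}" "t \<in> {1..n}" for r t
  proof (cases "r = t")
    case True
    then show ?thesis by (simp add: W_def dx_wedge_same)
  next
    case False
    have "\<delta> r (\<delta> t (\<Psi> I)) = \<delta> t (\<delta> r (\<Psi> I))" for I using that assms(1) by (intro comm) auto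
    then show ?thesis unfolding W_def by (subst dx_wedge_anticommute[OF False assms(2)]) simp
  qed
  have "d_upto \<delta> n (d_upto \<delta> n \<Psi>) J = (\<Sum>r=1..n. \<Sum>t=1..n. W r t)"
    unfolding d_upto_def[of _ _ "d_upto \<delta> n \<Psi>"]
  proof (rule sum.cong)
    fix r assume r: "r \<in> {1..n}"
    interpret derivation "\<delta> r" using r assms(1) by (intro der) auto
    have "\<delta> r (d_upto \<delta> n \<Psi> I) = (\<Sum>t=1..n. dx_wedge t (\<lambda>I. \<delta> r (\<delta> t (\<Psi> I))) I)" for I
      unfolding d_upto_def sum d_partial_def
      by (intro sum.cong) (auto simp: dx_wedge_def sign_mult)
    then show "d_partial \<delta> r (d_upto \<delta> n \<Psi>) J = (\<Sum>t=1..n. W r t)"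
      by (simp add: d_partial_def W_def dx_wedge_def[of r] sum_distrib_left)
  qed simp
  also have "\<dots> = 0"
  proof -
    have "(\<Sum>r=1..n. \<Sum>t=1..n. W r t) = (\<Sum>r=1..n. \<Sum>t=1..n. - W t r)"
      by (intro sum.cong W refl)
    also have "\<dots> = - (\<Sum>r=1..n. \<Sum>t=1..n. W r t)" by (subst sum.swap) (simp add: sum_negf)
    finally have "2 * (\<Sum>r=1..n. \<Sum>t=1..n. W r t) = 0" by (simp only: mult_2 eq_neg_iff_add_eq_0)
    then show ?thesis by simp
  qed
  finally show ?thesis .
qed

section \<open>Eliminating the variables one by one\<close>

text \<open>
  Write \<open>\<omega> = \<alpha> + dx\<^sub>n \<and> \<beta>\<close> with \<open>\<alpha>\<close> and \<open>\<beta>\<close> free of \<open>dx\<^sub>n\<close>, and integrate the coefficients of \<open>\<beta>\<close> with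
  respect to \<open>x\<^sub>n\<close> to get \<open>\<Psi>\<close>. The difference \<open>\<omega>' = \<omega> - d\<^sub>n \<Psi>\<close> is free of \<open>dx\<^sub>n\<close> and closed, hence its
  coefficients do not depend on \<open>x\<^sub>n\<close>. A coefficient of \<open>\<omega>'\<close> has the form \<open>\<rho> - (\<Sum>a\<in>S. E a * L a)\<close> with
  \<open>\<rho>\<close> rational and \<open>E a\<close> a constant for \<open>\<delta> n\<close>. Applying \<open>\<delta> n\<close> shows that \<open>\<Sum>a\<in>S. E a / (x\<^sub>n - a)\<close> is the
  derivative of a rational function. So every \<open>E a\<close> is zero, and the coefficient is rational and
  constant, that is, a rational function of the preceding variables.
\<close>

lemma eliminate_variable:
  assumes n: "n \<in> {1..m}" and p: "1 \<le> p"
    and \<omega>: "is_form n p \<omega>" "\<And>I. \<omega> I \<in> ratfun k x n" "\<And>J. d_upto \<delta> n \<omega> J = 0"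
  shows "\<exists>\<Psi>. is_form (n - 1) (p - 1) \<Psi> \<and> (\<forall>I. log_expression m \<delta> k x n (\<Psi> I)) \<and>
    is_form (n - 1) p (\<lambda>J. \<omega> J - d_upto \<delta> n \<Psi> J) \<and>
    (\<forall>J. \<omega> J - d_upto \<delta> n \<Psi> J \<in> ratfun k x (n - 1)) \<and>
    (\<forall>J. d_upto \<delta> (n - 1) (\<lambda>J. \<omega> J - d_upto \<delta> n \<Psi> J) J = 0)"
proof -
  define F where "F = ratfun k x (n - 1)"
  define t where "t = x n"
  interpret n: constants_and_variable "\<delta> n" F t
    unfolding F_def t_def by (rule constants_and_variable_ratfun[OF n])
  note dn_sum = derivation.sum[OF der[OF n]] and dn_const_mult = derivation.const_mult[OF der[OF n]]
    and dn_sign_mult = derivation.sign_mult[OF der[OF n]]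
  interpret R: subfield_set "ratfun k x n" by (rule subfield_ratfun)
  have Rt: "ratfun k x n = rational_values F t"
    unfolding F_def t_def by (rule ratfun_rational_values[OF n])
  have nm: "n \<le> m" using n by simp
  define \<I> where "\<I> = {I. I \<subseteq> {1..n - 1} \<and> card I = p - 1}"
  have fin: "finite \<I>" unfolding \<I>_def by (rule finite_subset[of _ "Pow {1..n - 1}"]) auto
  \<comment> \<open>Moving \<open>dx\<^sub>n\<close> past the \<open>p - 1\<close> factors of \<open>dx\<^sub>I\<close> gives the sign.\<close>
  define \<beta> where "\<beta> I = (- 1) ^ (p - 1) * \<omega> (insert n I)" for I
  have "\<beta> I \<in> ratfun k x n" for I unfolding \<beta>_def by (intro R.mult R.sign \<omega>(2))
  from simultaneous_integration[where f = \<beta>, OF n fin this]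
  obtain S L b c where S: "finite S" "S \<subseteq> alg_closure_in F"
    and L': "\<forall>a\<in>S. is_log m \<delta> (t - a) (L a)"
    and int: "\<forall>I\<in>\<I>. b I \<in> ratfun k x n \<and> (\<forall>a\<in>S. c I a \<in> alg_closure_in F) \<and>
       \<beta> I = \<delta> n (b I) + (\<Sum>a\<in>S. c I a / (t - a)) \<and>
       (\<forall>s\<in>{1..<n}. (\<Sum>a\<in>S. c I a * \<delta> s a / (t - a)) \<in> ratfun k x n) \<and>
       log_expression m \<delta> k x n (b I + (\<Sum>a\<in>S. c I a * L a))"
    unfolding F_def t_def by (elim exE conjE)
  have L: "is_log m \<delta> (t - a) (L a)" if "a \<in> S" for a using L' that by simp
  have b: "b I \<in> ratfun k x n" if "I \<in> \<I>" for I using int that by simp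
  have c: "c I a \<in> alg_closure_in F" if "I \<in> \<I>" "a \<in> S" for I a using int that by simp
  have \<beta>: "\<beta> I = \<delta> n (b I) + (\<Sum>a\<in>S. c I a / (t - a))" if "I \<in> \<I>" for I using int that by simp
  have rat: "(\<Sum>a\<in>S. c I a * \<delta> s a / (t - a)) \<in> ratfun k x n" if "I \<in> \<I>" "s \<in> {1..<n}" for I s
    using int that by simp
  have log: "log_expression m \<delta> k x n (b I + (\<Sum>a\<in>S. c I a * L a))" if "I \<in> \<I>" for I
    using int that by simp
  have alg0: "\<delta> n a = 0" if "a \<in> alg_closure_in F" for a
    by (rule derivation_algebraic[OF der[OF n] n.subfield_set_axioms n.const that])
  have Ln: "\<delta> n (L a) = 1 / (t - a)" if "a \<in> S" for a
    using L[OF that] n alg0[of a] S(2) that n.var by (auto simp: is_log_def)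
  have Ls: "\<delta> s (L a) = - \<delta> s a / (t - a)" if "a \<in> S" "s \<in> {1..<n}" for a s
  proof -
    have "s \<in> {1..m}" "\<delta> s t = 0" using that(2) n vars[of s n] by (auto simp: t_def)
    then show ?thesis using L[OF that(1)] derivation.diff[OF der, of s t a] by (simp add: is_log_def)
  qed
  define \<Psi> where "\<Psi> I = (if I \<in> \<I> then b I + (\<Sum>a\<in>S. c I a * L a) else 0)" for I
  define \<omega>' where "\<omega>' J = \<omega> J - d_upto \<delta> n \<Psi> J" for J
  have \<Psi>form: "is_form (n - 1) (p - 1) \<Psi>" by (auto simp: is_form_def \<Psi>_def \<I>_def)
  have \<Psi>n: "\<delta> n (\<Psi> I) = \<beta> I" if "I \<in> \<I>" for I
    using that Ln by (simp add: \<Psi>_def \<beta> dn_sum dn_const_mult[OF alg0[OF c]])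
  have \<Psi>log: "log_expression m \<delta> k x n (\<Psi> I)" for I
  proof (cases "I \<in> \<I>")
    case True
    then show ?thesis using log by (simp add: \<Psi>_def)
  next
    case False
    have "log_expression m \<delta> k x n 0" unfolding log_expression_def
      by (rule exI[of _ 0], rule exI[of _ "\<lambda>_. 0"]) simp
    then show ?thesis using False by (simp add: \<Psi>_def)
  qed
  have \<Psi>0: "\<Psi> I = 0" if "n \<in> I" for I
    using that n by (auto simp: \<Psi>_def \<I>_def)
  have "is_form n (Suc (p - 1)) (d_upto \<delta> n \<Psi>)"
    by (rule d_upto_is_form[OF is_form_mono[OF \<Psi>form] nm]) simp
  then have \<omega>'form: "is_form n p \<omega>'"
    using \<omega>(1) p by (simp add: is_form_def \<omega>'_def) (metis diff_self)

  have \<omega>'0: "\<omega>' J = 0" if nJ: "n \<in> J" for J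
  proof -
    have "d_partial \<delta> r \<Psi> J = 0" if "r \<in> {1..n} - {n}" for r
      using that nJ nm \<Psi>0[of "J - {r}"] by (auto simp: d_partial_def dx_wedge_def)
    then have "d_upto \<delta> n \<Psi> J = d_partial \<delta> n \<Psi> J"
      unfolding d_upto_def using n by (subst sum.remove[of _ n]) auto
    also have "\<dots> = (-1) ^ card {i \<in> J. i < n} * \<delta> n (\<Psi> (J - {n}))"
      using nJ by (simp add: d_partial_def dx_wedge_def)
    also have "\<dots> = \<omega> J"
    proof (cases "J - {n} \<in> \<I>")
      case True
      then have "{i \<in> J. i < n} = J - {n}" by (auto simp: \<I>_def) force
      then have "card {i \<in> J. i < n} = p - 1" using True by (simp add: \<I>_def)
      then show ?thesis using nJ by (simp add: \<Psi>n[OF True] \<beta>_def insert_absorb flip: mult.assoc power_add)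
    next
      case False
      have "\<omega> J = 0"
      proof (rule ccontr)
        assume "\<omega> J \<noteq> 0"
        then have J: "J \<subseteq> {1..n}" "card J = p" using \<omega>(1) by (auto simp: is_form_def)
        moreover have "J - {n} \<subseteq> {1..n - 1}" using J(1) by force
        ultimately have "J - {n} \<in> \<I>" using nJ by (simp add: \<I>_def)
        then show False using False by simp
      qed
      then show ?thesis using False n by (simp add: \<Psi>_def)
    qed
    finally show ?thesis by (simp add: \<omega>'_def)
  qed
  have \<omega>'form': "is_form (n - 1) p \<omega>'"
    unfolding is_form_def
  proof (intro allI impI)
    fix J assume J: "\<omega>' J \<noteq> 0"
    then have "n \<notin> J" "J \<subseteq> {1..n}" "card J = p" using \<omega>'form \<omega>'0 by (auto simp: is_form_def)
    moreover have "{1..n} - {n} = {1..n - 1}" using n by auto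
    ultimately show "J \<subseteq> {1..n - 1} \<and> card J = p" by blast
  qed

  have closed: "d_upto \<delta> n \<omega>' J = 0" for J
  proof (cases "finite J")
    case True
    then show ?thesis unfolding \<omega>'_def
      by (subst d_upto_diff[OF nm]) (simp add: \<omega>(3) d_upto_d_upto[OF nm])
  next
    case False
    then have "\<not> J \<subseteq> {1..n}" by (meson finite_atLeastAtMost finite_subset)
    then show ?thesis using d_upto_is_form[OF \<omega>'form nm] by (auto simp: is_form_def)
  qed
  have const: "\<delta> n (\<omega>' J) = 0" for J
  proof (cases "n \<in> J")
    case True
    then show ?thesis using \<omega>'0 n by simp
  next
    case False
    have "d_partial \<delta> r \<omega>' (insert n J) = 0" if "r \<in> {1..n} - {n}" for r
      using that nm \<omega>'0[of "insert n J - {r}"] by (auto simp: d_partial_def dx_wedge_def)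
    then have "d_upto \<delta> n \<omega>' (insert n J) = d_partial \<delta> n \<omega>' (insert n J)"
      unfolding d_upto_def using n by (subst sum.remove[of _ n]) auto
    then show ?thesis using closed[of "insert n J"] False
      by (simp add: d_partial_def dx_wedge_def)
  qed
  have closed': "d_upto \<delta> (n - 1) \<omega>' J = 0" for J
  proof -
    have "d_upto \<delta> n \<omega>' = d_upto \<delta> (n - 1) \<omega>'"
    proof (rule d_upto_truncate)
      fix s I assume "s \<in> {n - 1<..n}"
      then have "s = n" by auto
      then show "\<delta> s (\<omega>' I) = 0" using const by simp
    qed simp
    then show ?thesis using closed by metis
  qed

  have "\<omega>' J \<in> F" for J
  proof (cases "J \<subseteq> {1..n - 1} \<and> card J = p")
    case False
    then have "\<omega>' J = 0" using \<omega>'form' by (auto simp: is_form_def)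
    then show ?thesis by simp
  next
    case J: True
    define \<sigma> :: "nat \<Rightarrow> 'u" where "\<sigma> r = (- 1) ^ card {i \<in> J. i < r}" for r
    define \<rho> where "\<rho> = \<omega> J - (\<Sum>r\<in>J. \<sigma> r * (\<delta> r (b (J - {r})) - (\<Sum>a\<in>S. c (J - {r}) a * \<delta> r a / (t - a))))"
    \<comment> \<open>\<open>E a\<close> collects what multiplies the logarithm \<open>L a\<close> in the coefficient of \<open>dx\<^sub>J\<close> in \<open>d\<^sub>n \<Psi>\<close>.\<close>
    define E where "E a = (\<Sum>r\<in>J. \<sigma> r * \<delta> r (c (J - {r}) a))" for a
    have Jr: "r \<in> {1..<n}" "r \<in> {1..m}" "J - {r} \<in> \<I>" if "r \<in> J" for r
    proof -
      show "r \<in> {1..<n}" using J that n by force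
      then show "r \<in> {1..m}" using n by auto
      show "J - {r} \<in> \<I>" using J that by (auto simp: \<I>_def)
    qed
    have "d_upto \<delta> n \<Psi> J = (\<Sum>r\<in>J. \<sigma> r * \<delta> r (\<Psi> (J - {r})))"
    proof -
      have "J \<subseteq> {1..n}" using Jr(1) by fastforce
      then have "d_upto \<delta> n \<Psi> J = (\<Sum>r\<in>J. d_partial \<delta> r \<Psi> J)" unfolding d_upto_def
        by (intro sum.mono_neutral_right) (auto simp: d_partial_def dx_wedge_def)
      then show ?thesis by (simp add: d_partial_def dx_wedge_def \<sigma>_def)
    qed
    also have "\<dots> = (\<Sum>r\<in>J. \<sigma> r * (\<delta> r (b (J - {r})) - (\<Sum>a\<in>S. c (J - {r}) a * \<delta> r a / (t - a)))
        + \<sigma> r * (\<Sum>a\<in>S. \<delta> r (c (J - {r}) a) * L a))"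
    proof (rule sum.cong)
      fix r assume r: "r \<in> J"
      interpret r: derivation "\<delta> r" using Jr(2)[OF r] by (rule der)
      have "(\<Sum>a\<in>S. \<delta> r (c (J - {r}) a * L a))
         = (\<Sum>a\<in>S. \<delta> r (c (J - {r}) a) * L a) - (\<Sum>a\<in>S. c (J - {r}) a * \<delta> r a / (t - a))"
        unfolding sum_subtractf[symmetric] using Ls[OF _ Jr(1)[OF r]]
        by (intro sum.cong) (auto simp: r.mult)
      then have "\<delta> r (\<Psi> (J - {r})) = \<delta> r (b (J - {r})) - (\<Sum>a\<in>S. c (J - {r}) a * \<delta> r a / (t - a))
          + (\<Sum>a\<in>S. \<delta> r (c (J - {r}) a) * L a)"
        using Jr(3)[OF r] by (simp add: \<Psi>_def r.sum)
      then show "\<sigma> r * \<delta> r (\<Psi> (J - {r})) = \<sigma> r * (\<delta> r (b (J - {r})) - (\<Sum>a\<in>S. c (J - {r}) a * \<delta> r a / (t - a)))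
        + \<sigma> r * (\<Sum>a\<in>S. \<delta> r (c (J - {r}) a) * L a)" by (simp only: distrib_left)
    qed simp
    also have "\<dots> = \<omega> J - \<rho> + (\<Sum>r\<in>J. \<Sum>a\<in>S. \<sigma> r * \<delta> r (c (J - {r}) a) * L a)"
      by (simp add: \<rho>_def sum.distrib sum_distrib_left mult.assoc)
    also have "(\<Sum>r\<in>J. \<Sum>a\<in>S. \<sigma> r * \<delta> r (c (J - {r}) a) * L a) = (\<Sum>a\<in>S. E a * L a)"
      by (subst sum.swap) (simp add: E_def sum_distrib_right)
    finally have \<omega>'J: "\<omega>' J = \<rho> - (\<Sum>a\<in>S. E a * L a)" by (simp add: \<omega>'_def)
    have \<rho>: "\<rho> \<in> ratfun k x n"
      unfolding \<rho>_def
    proof (rule R.diff[OF \<omega>(2) R.sum])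
      fix r assume r: "r \<in> J"
      show "\<sigma> r * (\<delta> r (b (J - {r})) - (\<Sum>a\<in>S. c (J - {r}) a * \<delta> r a / (t - a))) \<in> ratfun k x n"
        unfolding \<sigma>_def
        by (rule R.mult[OF R.sign R.diff[OF ratfun_closed[OF Jr(2)[OF r] nm b[OF Jr(3)[OF r]]]
              rat[OF Jr(3)[OF r] Jr(1)[OF r]]]])
    qed
    have En: "\<delta> n (E a) = 0" if "a \<in> S" for a
    proof -
      have "\<delta> n (\<delta> r (c (J - {r}) a)) = 0" if r: "r \<in> J" for r
        using comm[OF n Jr(2)[OF r], of "c (J - {r}) a"] alg0[OF c[OF Jr(3)[OF r] \<open>a \<in> S\<close>]] Jr(2)[OF r] by simp
      then show ?thesis by (simp add: E_def dn_sum \<sigma>_def dn_sign_mult)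
    qed
    have "0 = \<delta> n \<rho> - (\<Sum>a\<in>S. E a / (t - a))"
      using const[of J] Ln En by (simp add: \<omega>'J dn_sum dn_const_mult)
    then have exact: "\<delta> n \<rho> = (\<Sum>a\<in>S. E a / (t - a))" by simp
    have "F \<subseteq> n.C" using n.const by auto
    then have "rational_values F t \<subseteq> rational_values n.C t"
      using polys_over_mono[of F n.C] by (auto simp: rational_values_def)
    then have "\<rho> \<in> rational_values n.C t" using \<rho> Rt by blast
    then have "E a = 0" if "a \<in> S" for a
      using n.log_derivative_not_exact[of S E \<rho>, OF S(1) _ _ _ exact that] alg0 S(2) En by auto
    then have "\<omega>' J = \<rho>" by (simp add: \<omega>'J)
    then have "\<omega>' J \<in> rational_values F t" using \<rho> Rt by simp
    then show ?thesis using const by (rule n.rational_constant)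
  qed
  then show ?thesis
    using \<Psi>form \<Psi>log \<omega>'form' closed' unfolding \<omega>'_def[abs_def] F_def
    by (intro exI[of _ \<Psi>] conjI allI)
qed

text \<open>
  If \<open>n < p\<close>, there is no nonzero \<open>p\<close>-form in \<open>n\<close> variables.
\<close>

lemma decomposition:
  assumes "n \<le> m" "1 \<le> p" "is_form n p \<omega>" "\<And>I. \<omega> I \<in> ratfun k x n" "\<And>J. d_upto \<delta> n \<omega> J = 0"
  shows "\<exists>\<Psi>. (\<forall>i\<in>{p..n}. is_form (i - 1) (p - 1) (\<Psi> i) \<and> (\<forall>I. log_expression m \<delta> k x i (\<Psi> i I))) \<and>
    (\<forall>J. \<omega> J = (\<Sum>i=p..n. d_upto \<delta> i (\<Psi> i) J))"
  using assms
proof (induction n arbitrary: \<omega>)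
  case 0
  have "\<omega> J = 0" for J
  proof (rule ccontr)
    assume "\<omega> J \<noteq> 0"
    then have "J \<subseteq> {}" "card J = p" using 0(3) by (auto simp: is_form_def)
    then show False using 0(2) by simp
  qed
  then show ?case using 0 by simp
next
  case (Suc n)
  show ?case
  proof (cases "p \<le> Suc n")
    case False
    have "\<omega> J = 0" for J
    proof (rule ccontr)
      assume "\<omega> J \<noteq> 0"
      then have "J \<subseteq> {1..Suc n}" "card J = p" using Suc.prems(3) by (auto simp: is_form_def)
      then show False using False card_mono[of "{1..Suc n}" J] by simp
    qed
    then show ?thesis using False by simp
  next
    case True
    have "Suc n \<in> {1..m}" using Suc.prems(1) by simp
    from eliminate_variable[OF this Suc.prems(2-5)]
    obtain \<Phi> where "is_form n (p - 1) \<Phi>" "\<forall>I. log_expression m \<delta> k x (Suc n) (\<Phi> I)"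
      "is_form n p (\<lambda>J. \<omega> J - d_upto \<delta> (Suc n) \<Phi> J)"
      "\<forall>J. \<omega> J - d_upto \<delta> (Suc n) \<Phi> J \<in> ratfun k x n"
      "\<forall>J. d_upto \<delta> n (\<lambda>J. \<omega> J - d_upto \<delta> (Suc n) \<Phi> J) J = 0"
      unfolding diff_Suc_1 by (elim exE conjE)
    note \<Phi> = this(1) this(2)[rule_format] this(3) this(4,5)[rule_format]
    have "n \<le> m" using Suc.prems(1) by simp
    from Suc.IH[OF this Suc.prems(2) \<Phi>(3-5)]
    obtain \<Psi> where \<Psi>: "\<forall>i\<in>{p..n}. is_form (i - 1) (p - 1) (\<Psi> i) \<and> (\<forall>I. log_expression m \<delta> k x i (\<Psi> i I))"
      "\<forall>J. \<omega> J - d_upto \<delta> (Suc n) \<Phi> J = (\<Sum>i=p..n. d_upto \<delta> i (\<Psi> i) J)"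
      by (elim exE conjE)
    have "\<omega> J = (\<Sum>i=p..Suc n. d_upto \<delta> i ((\<Psi>(Suc n := \<Phi>)) i) J)" for J
    proof -
      have "(\<Sum>i=p..n. d_upto \<delta> i ((\<Psi>(Suc n := \<Phi>)) i) J) = (\<Sum>i=p..n. d_upto \<delta> i (\<Psi> i) J)"
        by (intro sum.cong) auto
      then show ?thesis using True \<Psi>(2)[rule_format, of J] by (simp add: algebra_simps)
    qed
    moreover have "is_form (i - 1) (p - 1) ((\<Psi>(Suc n := \<Phi>)) i) \<and> (\<forall>I. log_expression m \<delta> k x i ((\<Psi>(Suc n := \<Phi>)) i I))"
      if "i \<in> {p..Suc n}" for i
      using that \<Psi>(1) \<Phi>(1,2) by (cases "i = Suc n") auto
    ultimately show ?thesis by blast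
  qed
qed

end

theorem theorem4p3:
  fixes k :: "'u::field_char_0 set"
    and x :: "nat \<Rightarrow> 'u"
    and \<delta> :: "nat \<Rightarrow> 'u \<Rightarrow> 'u"
    and m p :: nat
    and \<omega> :: "'u form"
  assumes "subfield k ring_of_type_algebra"
    and "algebraically_independent k m x"
    and "differential_field m (ring_of_type_algebra :: 'u ring) \<delta>"
    and "\<forall>i\<in>{1..m}. \<forall>a\<in>k. \<delta> i a = 0"
    and "\<forall>i\<in>{1..m}. \<forall>j\<in>{1..m}. \<delta> i (x j) = (if i = j then 1 else 0)"
    and "universal_over m (ratfun k x m) \<delta>"
    and "1 \<le> p" and "p \<le> m"
    and "is_form m p \<omega>"
    and "\<forall>I. \<omega> I \<in> ratfun k x m"
    and "closed_form m \<delta> \<omega>"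
  shows "\<exists>\<Psi> :: nat \<Rightarrow> 'u form.
    (\<forall>i\<in>{p..m}.
       is_form m (p - 1) (\<Psi> i) \<and>
       (\<forall>s\<in>{i..m}. free_of s (\<Psi> i)) \<and>
       (\<forall>I. log_expression m \<delta> k x i (\<Psi> i I))) \<and>
    \<omega> = (\<lambda>J. \<Sum>i=p..m. d_upto \<delta> i (\<Psi> i) J) \<and>
    \<omega> = ext_d m \<delta> (\<lambda>I. \<Sum>i=p..m. \<Psi> i I)"
proof -
  interpret rational_tower k x \<delta> m
    using assms(3-6) by unfold_locales (auto simp: differential_field_type_iff)
  obtain \<Psi> where \<Psi>: "\<And>i. i \<in> {p..m} \<Longrightarrow> is_form (i - 1) (p - 1) (\<Psi> i)"
      "\<And>i I. i \<in> {p..m} \<Longrightarrow> log_expression m \<delta> k x i (\<Psi> i I)"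
      "\<And>J. \<omega> J = (\<Sum>i=p..m. d_upto \<delta> i (\<Psi> i) J)"
  proof -
    have "\<exists>\<Psi>. (\<forall>i\<in>{p..m}. is_form (i - 1) (p - 1) (\<Psi> i) \<and> (\<forall>I. log_expression m \<delta> k x i (\<Psi> i I))) \<and>
        (\<forall>J. \<omega> J = (\<Sum>i=p..m. d_upto \<delta> i (\<Psi> i) J))"
      using assms(7,9-11) by (intro decomposition) (simp_all add: closed_form_def)
    then show thesis using that by blast
  qed
  have "is_form m (p - 1) (\<Psi> i)" if "i \<in> {p..m}" for i
    using that by (intro is_form_mono[OF \<Psi>(1)]) auto
  moreover have "free_of s (\<Psi> i)" if "i \<in> {p..m}" "s \<in> {i..m}" for i s
    unfolding free_of_def
  proof (intro allI impI)
    fix I assume "s \<in> I"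
    then have "\<not> I \<subseteq> {1..i - 1}" using that assms(7) by auto
    then show "\<Psi> i I = 0" using \<Psi>(1)[OF that(1)] by (auto simp: is_form_def)
  qed
  moreover have "\<omega> = ext_d m \<delta> (\<lambda>I. \<Sum>i=p..m. \<Psi> i I)"
  proof
    fix J
    have "ext_d m \<delta> (\<Psi> i) = d_upto \<delta> i (\<Psi> i)" if i: "i \<in> {p..m}" for i
      using i assms(7) log_expression_independent[OF _ _ _ \<Psi>(2)[OF i]]
      by (intro d_upto_truncate) auto
    then have "ext_d m \<delta> (\<lambda>I. \<Sum>i=p..m. \<Psi> i I) J = (\<Sum>i=p..m. d_upto \<delta> i (\<Psi> i) J)"
      by (simp add: d_upto_sum)
    then show "\<omega> J = ext_d m \<delta> (\<lambda>I. \<Sum>i=p..m. \<Psi> i I) J" using \<Psi>(3) by simp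
  qed
  moreover have "\<omega> = (\<lambda>J. \<Sum>i=p..m. d_upto \<delta> i (\<Psi> i) J)" using \<Psi>(3) by blast
  ultimately show ?thesis using \<Psi>(2) by blast
qed

end
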